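(* Let $n\ge 2$ and let $M^{n+1}=\left([0,\bar r)\times N^n(K),\ \bar g=dr^2+\lambda(r)^2 g_N\right)$ be a warped product manifold, where $(N^n(K),g_N)$ is a compact Riemannian manifold with constant sectional curvature $K$, and suppose that $$\lambda'(r)^2-\lambda''(r)\lambda(r)<K,\qquad \forall r\in(0,\bar r).$$ Let $\varepsilon\in\mathbb{R}$ be a constant, let $\Sigma$ be a closed hypersurface in $M^{n+1}$, and let $\{a_{i,j}(x)\mid 0\le i<j\le n\}$ be nonnegative functions on $\Sigma$ satisfying $\sum_{0\le i<j\le n}a_{i,j}(x)=1$. Let $k=\max\{j\mid a_{i,j}>0 \text{ somewhere on }\Sigma\text{ for some } 0\le i<j\le n\}$, and assume that $\Sigma$ is strictly shifted $k$-convex (i.e. $\kappa-\varepsilon\in\Gamma_k^+$ at every point) and that $\lambda'-\varepsilon u>0$ on $\Sigma$. If there exists a constant $\beta>0$ such that on $\Sigma$ $$\sum_{0\le i<j\le k}a_{i,j}\left(\frac{H_i(\kappa-\varepsilon)}{H_j(\kappa-\varepsilon)}\right)^{\frac{1}{j-i}}=\beta\,\frac{u}{\lambda'-\varepsilon u},$$ then $\Sigma$ is a slice $\{r_0\}\times N(K)$ for some constant $r_0$.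
   Context: $0<\bar r\le\infty$ and $\lambda:[0,\bar r)\to\mathbb{R}$ is a smooth positive function. Hypersurfaces are smooth, embedded and connected; closed means compact without boundary. For a hypersurface $\Sigma\subset M^{n+1}$ with unit outward normal $\nu$: $\kappa=(\kappa_1,\dots,\kappa_n)$ are the principal curvatures (eigenvalues of $h_{ij}=\langle\bar\nabla_{e_i}\nu,e_j\rangle$ relative to the induced metric), and $\kappa-\varepsilon=(\kappa_1-\varepsilon,\dots,\kappa_n-\varepsilon)$ are the shifted principal curvatures. The support function is $u=\bar g(\lambda\partial_r,\nu)$. $\sigma_k$ is the $k$-th elementary symmetric function on $\mathbb{R}^n$, $H_k=\sigma_k/\binom{n}{k}$, $H_0=1$, and $\Gamma_k^+=\{x\in\mathbb{R}^n:\sigma_i(x)>0,\ 1\le i\le k\}$. *)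

theory Defs
  imports "HOL-Analysis.Analysis"
begin

section \<open>Smooth maps between Euclidean spaces\<close>

primrec Ck_on :: "nat \<Rightarrow> ('a::euclidean_space \<Rightarrow> 'b::real_normed_vector) \<Rightarrow> 'a set \<Rightarrow> bool" where
  "Ck_on 0 f S \<longleftrightarrow> continuous_on S f"
| "Ck_on (Suc k) f S \<longleftrightarrow>
     f differentiable_on S \<and> (\<forall>v. Ck_on k (\<lambda>x. frechet_derivative f (at x) v) S)"

definition smooth_on :: "('a::euclidean_space \<Rightarrow> 'b::real_normed_vector) \<Rightarrow> 'a set \<Rightarrow> bool" where
  "smooth_on f S \<longleftrightarrow> open S \<and> (\<forall>k. Ck_on k f S)"


section \<open>Riemannian metrics on open subsets of a Euclidean space\<close>

text \<open>A metric is a function \<open>g\<close>, where \<open>g x v w\<close> is the inner product of the tangent vectors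
  \<open>v\<close>, \<open>w\<close> at the point \<open>x\<close>. The value \<open>christoffel g x v w\<close> is the vector with components
  \<open>\<Gamma>\<^sup>k\<^sub>i\<^sub>j v\<^sup>i w\<^sup>j\<close> of the Levi-Civita connection (Koszul formula for constant vector fields).\<close>

definition christoffel ::
  "('b::euclidean_space \<Rightarrow> 'b \<Rightarrow> 'b \<Rightarrow> real) \<Rightarrow> 'b \<Rightarrow> 'b \<Rightarrow> 'b \<Rightarrow> 'b" where
  "christoffel g x v w = (THE z. \<forall>y. 2 * g x z y =
      frechet_derivative (\<lambda>p. g p w y) (at x) v
    + frechet_derivative (\<lambda>p. g p v y) (at x) w
    - frechet_derivative (\<lambda>p. g p v w) (at x) y)"

text \<open>The sign convention is
  \<open>R(v,w)z = \<nabla>\<^sub>v \<nabla>\<^sub>w z - \<nabla>\<^sub>w \<nabla>\<^sub>v z - \<nabla>\<^bsub>[v,w]\<^esub> z\<close>.\<close>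

definition riemann_curvature ::
  "('b::euclidean_space \<Rightarrow> 'b \<Rightarrow> 'b \<Rightarrow> real) \<Rightarrow> 'b \<Rightarrow> 'b \<Rightarrow> 'b \<Rightarrow> 'b \<Rightarrow> 'b" where
  "riemann_curvature g x v w z =
      frechet_derivative (\<lambda>p. christoffel g p w z) (at x) v
    - frechet_derivative (\<lambda>p. christoffel g p v z) (at x) w
    + christoffel g x v (christoffel g x w z)
    - christoffel g x w (christoffel g x v z)"

definition sectional_curvature ::
  "('b::euclidean_space \<Rightarrow> 'b \<Rightarrow> 'b \<Rightarrow> real) \<Rightarrow> 'b \<Rightarrow> 'b \<Rightarrow> 'b \<Rightarrow> real" where
  "sectional_curvature g x v w =
     g x (riemann_curvature g x v w w) v / (g x v v * g x w w - (g x v w)\<^sup>2)"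


section \<open>Riemannian manifolds\<close>

type_synonym ('p, 'n) chart = "'p set \<times> ('p \<Rightarrow> real ^ 'n)"

type_synonym ('p, 'n) metric = "('p, 'n) chart \<Rightarrow> real ^ 'n \<Rightarrow> real ^ 'n \<Rightarrow> real ^ 'n \<Rightarrow> real"

abbreviation cdom :: "('p, 'n) chart \<Rightarrow> 'p set" where "cdom c \<equiv> fst c"

abbreviation cmap :: "('p, 'n) chart \<Rightarrow> 'p \<Rightarrow> real ^ 'n" where "cmap c \<equiv> snd c"

abbreviation cimage :: "('p, 'n) chart \<Rightarrow> (real ^ 'n) set" where
  "cimage c \<equiv> cmap c ` cdom c"

definition cinv :: "('p, 'n) chart \<Rightarrow> real ^ 'n \<Rightarrow> 'p" where
  "cinv c = inv_into (cdom c) (cmap c)"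

definition transition :: "('p, 'n) chart \<Rightarrow> ('p, 'n) chart \<Rightarrow> real ^ 'n \<Rightarrow> real ^ 'n" where
  "transition c c' = cmap c' \<circ> cinv c"

definition smooth_atlas ::
  "('p::t2_space) set \<Rightarrow> ('p, 'n::finite) chart set \<Rightarrow> bool" where
  "smooth_atlas N A \<longleftrightarrow>
     (\<forall>c\<in>A. openin (top_of_set N) (cdom c) \<and> open (cimage c) \<and>
            homeomorphism (cdom c) (cimage c) (cmap c) (cinv c)) \<and>
     (\<Union>c\<in>A. cdom c) = N \<and>
     (\<forall>c\<in>A. \<forall>c'\<in>A. smooth_on (transition c c') (cmap c ` (cdom c \<inter> cdom c')))"

definition inner_product_form :: "('b::real_vector \<Rightarrow> 'b \<Rightarrow> real) \<Rightarrow> bool" where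
  "inner_product_form b \<longleftrightarrow>
     bilinear b \<and> (\<forall>v w. b v w = b w v) \<and> (\<forall>v. v \<noteq> 0 \<longrightarrow> b v v > 0)"

text \<open>A Riemannian metric is given by its components \<open>g c\<close> in the charts \<open>c\<close>, which transform as
  a covariant 2-tensor.\<close>

definition riemannian_metric :: "('p, 'n::finite) chart set \<Rightarrow> ('p, 'n) metric \<Rightarrow> bool" where
  "riemannian_metric A g \<longleftrightarrow>
     (\<forall>c\<in>A. (\<forall>x\<in>cimage c. inner_product_form (g c x)) \<and>
            (\<forall>v w. smooth_on (\<lambda>x. g c x v w) (cimage c))) \<and>
     (\<forall>c\<in>A. \<forall>c'\<in>A. \<forall>p\<in>cdom c \<inter> cdom c'. \<forall>v w.
        g c (cmap c p) v w =
        g c' (cmap c' p)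
          (frechet_derivative (transition c c') (at (cmap c p)) v)
          (frechet_derivative (transition c c') (at (cmap c p)) w))"

definition riemannian_manifold ::
  "('p::t2_space) set \<Rightarrow> ('p, 'n::finite) chart set \<Rightarrow> ('p, 'n) metric \<Rightarrow> bool" where
  "riemannian_manifold N A g \<longleftrightarrow> smooth_atlas N A \<and> riemannian_metric A g \<and> connected N"

definition constant_sectional_curvature ::
  "('p, 'n::finite) chart set \<Rightarrow> ('p, 'n) metric \<Rightarrow> real \<Rightarrow> bool" where
  "constant_sectional_curvature A g K \<longleftrightarrow>
     (\<forall>c\<in>A. \<forall>x\<in>cimage c. \<forall>v w. v \<noteq> w \<and> independent {v, w} \<longrightarrow>
        sectional_curvature (g c) x v w = K)"


section \<open>Warped products\<close>

definition base_interval :: "ereal \<Rightarrow> real set" where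
  "base_interval rbar = {r. 0 \<le> r \<and> ereal r < rbar}"

text \<open>Smoothness on \<open>[0, rbar)\<close> means having a smooth extension to an open neighbourhood. The
  function itself is taken to be such an extension, so that \<open>deriv\<close> at \<open>0\<close> is the one-sided
  derivative; its values at negative arguments are irrelevant otherwise.\<close>

definition warping_function :: "ereal \<Rightarrow> (real \<Rightarrow> real) \<Rightarrow> bool" where
  "warping_function rbar lam \<longleftrightarrow>
     (\<exists>T. base_interval rbar \<subseteq> T \<and> smooth_on lam T) \<and> (\<forall>r\<in>base_interval rbar. lam r > 0)"

definition warped_space :: "ereal \<Rightarrow> 'p set \<Rightarrow> (real \<times> 'p) set" where
  "warped_space rbar N = base_interval rbar \<times> N"

text \<open>Each chart \<open>c\<close> of \<open>N\<close> gives the chart \<open>(r, p) \<mapsto> (r, cmap c p)\<close> of the product.\<close>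

definition mmap :: "('p, 'n) chart \<Rightarrow> real \<times> 'p \<Rightarrow> real \<times> (real ^ 'n)" where
  "mmap c q = (fst q, cmap c (snd q))"

definition minv :: "('p, 'n) chart \<Rightarrow> real \<times> (real ^ 'n) \<Rightarrow> real \<times> 'p" where
  "minv c y = (fst y, cinv c (snd y))"

definition warped_metric ::
  "(real \<Rightarrow> real) \<Rightarrow> ('p, 'n) metric \<Rightarrow> ('p, 'n) chart \<Rightarrow>
   real \<times> (real ^ 'n) \<Rightarrow> real \<times> (real ^ 'n) \<Rightarrow> real \<times> (real ^ 'n) \<Rightarrow> real" where
  "warped_metric lam g c y v w =
     fst v * fst w + (lam (fst y))\<^sup>2 * g c (snd y) (snd v) (snd w)"


section \<open>Hypersurfaces\<close>

text \<open>\<open>X : D \<rightarrow> \<real> \<times> \<real>\<^sup>n\<close> is the expression, in the chart of the product induced by \<open>c\<close>, of a local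
  parametrization of \<open>S\<close>: a smooth immersion which is a homeomorphism onto an open part of \<open>S\<close>.\<close>

definition local_parametrization ::
  "('p::t2_space, 'n::finite) chart set \<Rightarrow> (real \<times> 'p) set \<Rightarrow> ('p, 'n) chart \<Rightarrow>
   (real ^ 'n) set \<Rightarrow> (real ^ 'n \<Rightarrow> real \<times> (real ^ 'n)) \<Rightarrow> bool" where
  "local_parametrization A S c D X \<longleftrightarrow>
     c \<in> A \<and> smooth_on X D \<and> X ` D \<subseteq> UNIV \<times> cimage c \<and>
     (\<forall>y\<in>D. inj (frechet_derivative X (at y))) \<and>
     openin (top_of_set S) ((minv c \<circ> X) ` D) \<and>
     (\<exists>Y. homeomorphism D ((minv c \<circ> X) ` D) (minv c \<circ> X) Y)"

text \<open>Embedded, connected, nonempty hypersurface without boundary.\<close>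

definition hypersurface ::
  "('p::t2_space, 'n::finite) chart set \<Rightarrow> (real \<times> 'p) set \<Rightarrow> (real \<times> 'p) set \<Rightarrow> bool" where
  "hypersurface A M S \<longleftrightarrow>
     S \<subseteq> M \<and> S \<noteq> {} \<and> connected S \<and>
     (\<forall>p\<in>S. \<exists>c D X. local_parametrization A S c D X \<and> p \<in> (minv c \<circ> X) ` D)"

definition closed_hypersurface ::
  "('p::t2_space, 'n::finite) chart set \<Rightarrow> (real \<times> 'p) set \<Rightarrow> (real \<times> 'p) set \<Rightarrow> bool" where
  "closed_hypersurface A M S \<longleftrightarrow> hypersurface A M S \<and> compact S"

text \<open>A vector field along \<open>S\<close> is given by its components \<open>V c p\<close> in the charts \<open>c\<close> around \<open>p\<close>.\<close>

type_synonym ('p, 'n) field_along = "('p, 'n) chart \<Rightarrow> real \<times> 'p \<Rightarrow> real \<times> (real ^ 'n)"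

definition smooth_field_along ::
  "('p::t2_space, 'n::finite) chart set \<Rightarrow> (real \<times> 'p) set \<Rightarrow> ('p, 'n) field_along \<Rightarrow> bool" where
  "smooth_field_along A S V \<longleftrightarrow>
     (\<forall>c\<in>A. \<forall>c'\<in>A. \<forall>p\<in>S. snd p \<in> cdom c \<inter> cdom c' \<longrightarrow>
        V c' p = (fst (V c p),
          frechet_derivative (transition c c') (at (cmap c (snd p))) (snd (V c p)))) \<and>
     (\<forall>c D X. local_parametrization A S c D X \<longrightarrow> smooth_on (\<lambda>y. V c (minv c (X y))) D)"

definition unit_normal ::
  "('p::t2_space, 'n::finite) chart set \<Rightarrow> ('p, 'n) metric \<Rightarrow> (real \<Rightarrow> real) \<Rightarrow>
   (real \<times> 'p) set \<Rightarrow> ('p, 'n) field_along \<Rightarrow> bool" where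
  "unit_normal A g lam S \<nu> \<longleftrightarrow>
     smooth_field_along A S \<nu> \<and>
     (\<forall>c D X. local_parametrization A S c D X \<longrightarrow>
        (\<forall>y\<in>D. let n = \<nu> c (minv c (X y)) in
           warped_metric lam g c (X y) n n = 1 \<and>
           (\<forall>v. warped_metric lam g c (X y) n (frechet_derivative X (at y) v) = 0)))"

text \<open>The exterior of a compact \<open>S\<close> is the component of its complement that contains the points
  with \<open>r\<close> close to \<open>rbar\<close>. The complement is taken in \<open>(-\<infinity>, rbar) \<times> N\<close> so that this also makes
  sense at points where \<open>S\<close> touches the boundary \<open>r = 0\<close>: the slice \<open>{0} \<times> N\<close> has outward normal
  \<open>\<partial>\<^sub>r\<close>, and a hypersurface bounding a domain that touches \<open>r = 0\<close> from above has outward normal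
  \<open>- \<partial>\<^sub>r\<close> there.\<close>

definition exterior ::
  "ereal \<Rightarrow> ('p::t2_space) set \<Rightarrow> (real \<times> 'p) set \<Rightarrow> (real \<times> 'p) set" where
  "exterior rbar N S =
     (let C = {r. ereal r < rbar} \<times> N in
      {q. \<exists>q'\<in>C. (\<forall>s\<in>S. fst s < fst q') \<and> connected_component (C - S) q q'})"

definition unit_outward_normal ::
  "ereal \<Rightarrow> ('p::t2_space) set \<Rightarrow> ('p, 'n::finite) chart set \<Rightarrow> ('p, 'n) metric \<Rightarrow>
   (real \<Rightarrow> real) \<Rightarrow> (real \<times> 'p) set \<Rightarrow> ('p, 'n) field_along \<Rightarrow> bool" where
  "unit_outward_normal rbar N A g lam S \<nu> \<longleftrightarrow>
     unit_normal A g lam S \<nu> \<and>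
     (\<forall>p\<in>S. \<forall>c\<in>A. snd p \<in> cdom c \<longrightarrow>
        (\<forall>\<^sub>F t in at_right 0. minv c (mmap c p + t *\<^sub>R \<nu> c p) \<in> exterior rbar N S))"

definition first_form ::
  "(real \<times> (real ^ 'n) \<Rightarrow> real \<times> (real ^ 'n) \<Rightarrow> real \<times> (real ^ 'n) \<Rightarrow> real) \<Rightarrow>
   (real ^ 'n::finite \<Rightarrow> real \<times> (real ^ 'n)) \<Rightarrow> real ^ 'n \<Rightarrow> real ^ 'n ^ 'n" where
  "first_form G X y = (\<chi> i j.
     G (X y) (frechet_derivative X (at y) (axis i 1)) (frechet_derivative X (at y) (axis j 1)))"

text \<open>\<open>h\<^sub>i\<^sub>j = G(\<nabla>\<^bsub>e_i\<^esub> \<nu>, e\<^sub>j)\<close> for the coordinate frame \<open>e\<^sub>i = \<partial>\<^sub>i X\<close>; here \<open>n y\<close> is the normal at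
  \<open>X y\<close>.\<close>

definition second_form ::
  "(real \<times> (real ^ 'n) \<Rightarrow> real \<times> (real ^ 'n) \<Rightarrow> real \<times> (real ^ 'n) \<Rightarrow> real) \<Rightarrow>
   (real ^ 'n::finite \<Rightarrow> real \<times> (real ^ 'n)) \<Rightarrow> (real ^ 'n \<Rightarrow> real \<times> (real ^ 'n)) \<Rightarrow>
   real ^ 'n \<Rightarrow> real ^ 'n ^ 'n" where
  "second_form G X n y = (\<chi> i j.
     G (X y)
       (frechet_derivative n (at y) (axis i 1) +
        christoffel G (X y) (frechet_derivative X (at y) (axis i 1)) (n y))
       (frechet_derivative X (at y) (axis j 1)))"

text \<open>\<open>\<kappa> p\<close> lists, with multiplicity, the eigenvalues of the second fundamental form relative to the
  induced metric, i.e.\ the roots \<open>t\<close> of \<open>det (h - t g)\<close>. Their order is not prescribed; only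
  symmetric functions of them are used.\<close>

definition principal_curvatures ::
  "('p::t2_space, 'n::finite) chart set \<Rightarrow> ('p, 'n) metric \<Rightarrow> (real \<Rightarrow> real) \<Rightarrow>
   (real \<times> 'p) set \<Rightarrow> ('p, 'n) field_along \<Rightarrow> (real \<times> 'p \<Rightarrow> real ^ 'n) \<Rightarrow> bool" where
  "principal_curvatures A g lam S \<nu> \<kappa> \<longleftrightarrow>
     (\<forall>c D X. local_parametrization A S c D X \<longrightarrow>
        (\<forall>y\<in>D.
           let G = warped_metric lam g c;
               I = first_form G X y;
               h = second_form G X (\<lambda>z. \<nu> c (minv c (X z))) y
           in \<forall>t. det (h - t *\<^sub>R I) = det I * (\<Prod>i\<in>UNIV. \<kappa> (minv c (X y)) $ i - t)))"

text \<open>The chosen chart is immaterial.\<close>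

definition support_function ::
  "('p, 'n::finite) chart set \<Rightarrow> ('p, 'n) metric \<Rightarrow> (real \<Rightarrow> real) \<Rightarrow>
   ('p, 'n) field_along \<Rightarrow> real \<times> 'p \<Rightarrow> real" where
  "support_function A g lam \<nu> p =
     (let c = SOME c. c \<in> A \<and> snd p \<in> cdom c
      in warped_metric lam g c (mmap c p) (lam (fst p) *\<^sub>R (1, 0)) (\<nu> c p))"


section \<open>Elementary symmetric functions\<close>

definition esym :: "nat \<Rightarrow> real ^ 'n::finite \<Rightarrow> real" where
  "esym k x = (\<Sum>S | S \<subseteq> UNIV \<and> card S = k. \<Prod>i\<in>S. x $ i)"

definition Hk :: "nat \<Rightarrow> real ^ 'n::finite \<Rightarrow> real" where
  "Hk k x = esym k x / real (CARD('n) choose k)"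

definition Gamma_plus :: "nat \<Rightarrow> (real ^ 'n::finite) set" where
  "Gamma_plus k = {x. \<forall>i. 1 \<le> i \<and> i \<le> k \<longrightarrow> esym i x > 0}"

definition shifted :: "real \<Rightarrow> real ^ 'n::finite \<Rightarrow> real ^ 'n" where
  "shifted \<epsilon> x = (\<chi> i. x $ i - \<epsilon>)"

end

theory Submission
  imports Defs "HOL-Computational_Algebra.Fundamental_Theorem_Algebra"
begin

text \<open>
  By Newton's inequalities, each \<open>(H\<^sub>i / H\<^sub>j)\<^bsup>1/(j-i)\<^esup>\<close> of \<open>\<kappa> - \<epsilon> \<in> \<Gamma>\<^sub>k\<^sup>+\<close> is at least
  \<open>1 / H\<^sub>1\<close>, so the equation forces \<open>u > 0\<close>. At a maximum of \<open>r\<close> on \<open>\<Sigma>\<close> comparison with the slice gives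
  \<open>\<kappa>\<^sub>i \<ge> \<lambda>' / \<lambda>\<close>, hence \<open>\<beta> \<le> 1\<close>. Both facts together yield \<open>n \<lambda>' \<le> (\<Sum> \<kappa>\<^sub>i) u\<close> on \<open>\<Sigma>\<close>, i.e. a
  primitive of \<open>\<lambda>(r)\<close> is superharmonic on \<open>\<Sigma>\<close>. By the strong maximum principle \<open>r\<close> is constant. The
  maximum principle is proved geometrically: \<open>\<Sigma>\<close> is touched from below by the graph of Hopf's
  barrier, which lives on a chart of \<open>N\<close>, so that only the metric of \<open>N\<close> and \<open>\<lambda>\<close> have to be bounded
  near the touching point.
\<close>

section \<open>Newton inequalities for elementary symmetric functions\<close>

text \<open>Write \<open>m = \<lambda>' - \<epsilon> u\<close> and
  \<open>H_1 = H_1(\<kappa> - \<epsilon>)\<close>. The chain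
  \<open>1 / H_1 \<le> \<beta> u / m \<le> u / m\<close> says \<open>m \<le> H_1 u\<close>. Since
  \<open>H_1\<close> is the mean of the \<open>\<kappa>_i\<close> minus \<open>\<epsilon>\<close>,
  the two terms \<open>\<epsilon> u\<close> cancel; this is how the shift disappears from the final
  inequality. For a primitive \<open>\<Phi>\<close> of \<open>\<lambda>\<close> one has
  \<open>\<Delta> \<Phi>(r) = n \<lambda>' - (\<Sum> \<kappa>_i) u\<close>, but neither a Laplacian
  nor \<open>\<Phi>\<close> is formed below. Positivity of \<open>u\<close> acts through the radial
  component of \<open>\<nu>\<close>: with its sign fixed, one-sided second order information on
  \<open>r\<close> becomes one-sided information on curvature. The obstacle is uniformity.
  Parametrizations are arbitrary, and the touching point moves with the steepness of the barrier.
  Frames are therefore orthonormal for the induced metric and only their projections to the chart of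
  \<open>N\<close> are measured. Every error is bounded by the slope of the barrier times the radial
  component of the normal, so that this component cancels without a lower bound.\<close>

definition real_rooted :: "complex poly \<Rightarrow> bool" where
  "real_rooted p \<longleftrightarrow> p = 0 \<or> (\<forall>z. poly p z = 0 \<longrightarrow> z \<in> \<real>)"

lemma poly_pderiv_prod_linear:
  fixes z :: "'a::field_char_0"
  assumes "z \<notin># M"
  shows "poly (pderiv (\<Prod>x\<in>#M. [:-x, 1:])) z
           = poly (\<Prod>x\<in>#M. [:-x, 1:]) z * (\<Sum>x\<in>#M. 1 / (z - x))"
  using assms
proof (induction M)
  case empty
  then show ?case by simp
next
  case (add r M)
  then have "z - r \<noteq> 0" by auto
  moreover have "poly (pderiv (\<Prod>x\<in>#M. [:-x, 1:])) z
           = poly (\<Prod>x\<in>#M. [:-x, 1:]) z * (\<Sum>x\<in>#M. 1 / (z - x))"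
    using add by simp
  moreover have "poly (pderiv ([:-r, 1:] * q)) z = (z - r) * poly (pderiv q) z + poly q z" for q
    by (simp only: pderiv_mult) (simp add: pderiv_pCons algebra_simps)
  ultimately show ?case
    by (simp only: prod_mset.add_mset image_mset_add_mset sum_mset.add_mset poly_mult)
      (simp add: field_simps)
qed

text \<open>For real \<open>x\<close> the imaginary part of \<open>1 / (z - x)\<close> is
  \<open>- Im z / |z - x|^2\<close>. All summands carry the same sign, so they cannot
  cancel.\<close>

lemma Im_sum_inverse_diff:
  assumes "\<And>x. x \<in># M \<Longrightarrow> x \<in> \<real>"
  shows "Im (\<Sum>x\<in>#M. 1 / (z - x)) = - Im z * (\<Sum>x\<in>#M. 1 / (cmod (z - x))\<^sup>2)"
  using assms
proof (induction M)
  case (add r M)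
  have "Im (1 / (z - r)) = - Im z * (1 / (cmod (z - r))\<^sup>2)"
    using add.prems[of r] by (auto simp: Im_divide cmod_power2 complex_is_Real_iff)
  then show ?case using add by (simp add: algebra_simps)
qed simp

text \<open>Gauss--Lucas: off the real axis the logarithmic derivative of \<open>p\<close> has nonzero imaginary
  part.\<close>

lemma real_rooted_pderiv:
  assumes "real_rooted p"
  shows "real_rooted (pderiv p)"
proof (rule ccontr)
  assume "\<not> real_rooted (pderiv p)"
  then obtain z where z: "poly (pderiv p) z = 0" "z \<notin> \<real>" and nz: "pderiv p \<noteq> 0"
    by (auto simp: real_rooted_def)
  have p0: "p \<noteq> 0" using nz by auto
  have root: "w \<in> \<real>" if "poly p w = 0" for w
    using assms p0 that by (auto simp: real_rooted_def)
  obtain M where M: "size M = degree p" "p = smult (lead_coeff p) (\<Prod>x\<in>#M. [:-x, 1:])"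
    using alg_closed_imp_factorization[OF p0] by blast
  let ?q = "\<Prod>x\<in>#M. [:-x, 1:]"
  have MR: "x \<in> \<real>" if "x \<in># M" for x
  proof (rule root)
    have "[:-x, 1:] dvd ?q" using that by (auto intro: dvd_prod_mset)
    then have "poly ?q x = 0" by (metis poly_eq_0_iff_dvd)
    then show "poly p x = 0" by (metis M(2) mult_zero_right poly_smult)
  qed
  have zM: "z \<notin># M" using MR z by auto
  \<comment> \<open>A nonzero derivative excludes constants. One root is split off because it alone
    makes the sum of the \<open>1 / |z - x|^2\<close> strictly positive.\<close>
  have "M \<noteq> {#}"
    using nz M(1) by (auto simp: pderiv_eq_0_iff)
  then obtain r M' where r: "M = add_mset r M'" by (meson multiset_cases)
  have "poly (pderiv p) z = lead_coeff p * poly (pderiv ?q) z"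
    by (subst M(2)) (simp add: pderiv_smult)
  also have "\<dots> = poly p z * (\<Sum>x\<in>#M. 1 / (z - x))"
    by (subst (2) M(2)) (simp add: poly_pderiv_prod_linear[OF zM])
  finally have "(\<Sum>x\<in>#M. 1 / (z - x)) = 0"
    using z root by auto
  then have "Im z * (\<Sum>x\<in>#M. 1 / (cmod (z - x))\<^sup>2) = 0"
    using Im_sum_inverse_diff[of M z] MR by simp
  moreover have "Im z \<noteq> 0" using z by (simp add: complex_is_Real_iff)
  moreover have "(\<Sum>x\<in>#M'. 1 / (cmod (z - x))\<^sup>2) \<ge> 0"
    by (induction M') auto
  moreover have "1 / (cmod (z - r))\<^sup>2 > 0" using zM r by auto
  ultimately show False using r by (simp add: add_nonneg_eq_0_iff)
qed

text \<open>Counting the zero polynomial as real-rooted makes this hold for every \<open>m\<close>,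
  also beyond the degree.\<close>

lemma real_rooted_higher_pderiv:
  "real_rooted p \<Longrightarrow> real_rooted ((pderiv ^^ m) p)"
  by (induction m) (auto intro: real_rooted_pderiv)

text \<open>This is \<open>z^n p(1/z)\<close>. The reversal is relative to a degree bound
  \<open>n\<close>, whereas \<open>reflect_poly\<close> uses the actual degree; the monomial
  compensates, so that coefficient positions are known even if leading coefficients vanish.\<close>

definition reverse_poly :: "nat \<Rightarrow> 'a::comm_semiring_1 poly \<Rightarrow> 'a poly" where
  "reverse_poly n p = monom 1 (n - degree p) * reflect_poly p"

lemma coeff_reverse_poly:
  assumes "degree p \<le> n"
  shows "coeff (reverse_poly n p) i = (if i \<le> n then coeff p (n - i) else 0)"
  using assms
  by (auto simp: reverse_poly_def coeff_monom_mult coeff_reflect_poly coeff_eq_0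
      intro!: arg_cong[where f = "coeff p"])

lemma real_rooted_reverse_poly:
  assumes "real_rooted p"
  shows "real_rooted (reverse_poly n p)"
proof (cases "p = 0")
  case True
  then show ?thesis by (simp add: reverse_poly_def real_rooted_def)
next
  case False
  have "z \<in> \<real>" if "poly (reverse_poly n p) z = 0" for z
  proof (cases "z = 0")
    case nz: False
    then have "poly p (inverse z) = 0"
      using that by (simp add: reverse_poly_def poly_monom poly_reflect_poly_nz)
    then have "inverse z \<in> \<real>"
      using assms False by (auto simp: real_rooted_def)
    then show ?thesis by (metis Reals_inverse inverse_inverse_eq)
  qed simp
  then show ?thesis by (simp add: real_rooted_def)
qed

lemma real_rooted_quadratic:
  fixes a b c :: real
  assumes "real_rooted [:of_real c, of_real b, of_real a:]"
  shows "4 * a * c \<le> b\<^sup>2"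
proof (rule ccontr)
  assume neg: "\<not> 4 * a * c \<le> b\<^sup>2"
  \<comment> \<open>With \<open>a = 0\<close> the negated inequality would read
    \<open>b^2 < 0\<close>.\<close>
  then have a: "a \<noteq> 0" by auto
  define s where "s = sqrt (4 * a * c - b\<^sup>2)"
  have s: "s\<^sup>2 = 4 * a * c - b\<^sup>2" "s > 0" using neg by (auto simp: s_def)
  define z where "z = Complex (- b / (2 * a)) (s / (2 * a))"
  have "poly [:of_real c, of_real b, of_real a:] z = 0"
  proof (rule complex_eqI)
    have "c + b * (- b / (2 * a)) + a * ((- b / (2 * a))\<^sup>2 - (s / (2 * a))\<^sup>2) = 0"
      using a unfolding power_divide s(1) by (simp add: field_simps power2_eq_square)
    then show "Re (poly [:of_real c, of_real b, of_real a:] z) = Re 0"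
      by (simp add: z_def algebra_simps power2_eq_square)
    show "Im (poly [:of_real c, of_real b, of_real a:] z) = Im 0"
      using a by (simp add: z_def field_simps)
  qed
  moreover have "[:of_real c, of_real b, of_real a :: complex:] \<noteq> 0" using a by simp
  ultimately have "z \<in> \<real>" using assms by (auto simp: real_rooted_def)
  then show False using s a by (simp add: z_def complex_is_Real_iff)
qed

text \<open>Differentiating, reversing and differentiating again isolates three consecutive coefficients in
  a real-rooted quadratic.\<close>

lemma newton_coeffs:
  fixes c :: "nat \<Rightarrow> real"
  assumes rr: "real_rooted p" and deg: "degree p \<le> n" and c: "\<And>i. coeff p i = of_real (c i)"
    and j: "1 \<le> j" "j + 1 \<le> n"
  shows "real ((n - j + 1) * (j + 1)) * (c (j - 1) * c (j + 1)) \<le> real ((n - j) * j) * (c j)\<^sup>2"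
proof -
  \<comment> \<open>\<open>m\<close> bounds the degree of \<open>q\<close>. The first
    \<open>j - 1\<close> derivatives remove the coefficients below \<open>c (j - 1)\<close>; after
    the reversal, \<open>m - 2\<close> further ones remove those above
    \<open>c (j + 1)\<close>.\<close>
  define m where "m = n - j + 1"
  have m: "m \<ge> 2" using j by (simp add: m_def)
  define q where "q = (pderiv ^^ (j - 1)) p"
  define s where "s = (pderiv ^^ (m - 2)) (reverse_poly m q)"
  have dq: "degree q \<le> m" using deg j by (simp add: q_def m_def degree_higher_pderiv)
  have rs: "real_rooted s"
    unfolding s_def q_def using rr by (intro real_rooted_higher_pderiv real_rooted_reverse_poly)
  have cq: "coeff q i = of_real (pochhammer (real (Suc i)) (j - 1) * c (i + (j - 1)))" for i
    unfolding q_def coeff_higher_pderiv c by (simp add: pochhammer_of_real[symmetric] del: of_nat_Suc)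
  have cs: "coeff s i = (if i \<le> 2 then of_real (pochhammer (real (Suc i)) (m - 2) *
      (pochhammer (real (Suc (2 - i))) (j - 1) * c (2 - i + (j - 1)))) else 0)" for i
  proof -
    have e: "m - (i + (m - 2)) = 2 - i" "i + (m - 2) \<le> m \<longleftrightarrow> i \<le> 2" using m by auto
    show ?thesis
      unfolding s_def coeff_higher_pderiv coeff_reverse_poly[OF dq] e
      by (simp add: cq pochhammer_of_real[symmetric] del: of_nat_Suc)
  qed
  have poch: "pochhammer (real (Suc i)) k = fact (i + k) / fact i" for i k
    using pochhammer_product'[of "1 :: real" i k] by (simp add: pochhammer_fact[symmetric])
  obtain m' j' where mj: "m = Suc (Suc m')" "j = Suc j'"
  proof
    show "m = Suc (Suc (m - 2))" "j = Suc (j - 1)" using m j by auto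
  qed
  have nj: "n - j = Suc m'" using mj m_def by simp
  \<comment> \<open>Coefficient \<open>i\<close> of \<open>s\<close> is \<open>c (j + 1 - i)\<close>
    times \<open>(i + m')! / i!\<close> from the outer and \<open>(2 - i + j')! / (2 - i)!\<close>
    from the inner differentiation. \<open>P\<close> and \<open>Q\<close> are the factorials common
    to all three.\<close>
  define P Q :: real where "P = fact m'" and "Q = fact j'"
  define s0 where "s0 = P * ((j' + 2) * (j' + 1) * Q / 2 * c (j + 1))"
  define s1 where "s1 = (m' + 1) * P * ((j' + 1) * Q * c j)"
  define s2 where "s2 = (m' + 2) * (m' + 1) * P / 2 * (Q * c (j - 1))"
  have "s = [:of_real s0, of_real s1, of_real s2:]"
  proof (rule poly_eqI)
    fix i :: nat
    consider "i = 0" | "i = 1" | "i = 2" | "i > 2" by linarith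
    then show "coeff s i = coeff [:of_real s0, of_real s1, of_real s2:] i"
    proof cases
      case 1
      have "coeff s 0 = of_real (fact m' * (fact (2 + j') / 2 * c (2 + j')))"
        by (simp only: cs poch mj) simp
      then show ?thesis
        using 1 by (simp add: s0_def P_def Q_def mj algebra_simps)
    next
      case 2
      have "coeff s 1 = of_real (fact (1 + m') * (fact (1 + j') * c (1 + j')))"
        by (simp only: cs poch mj) simp
      then show ?thesis
        using 2 by (simp add: s1_def P_def Q_def mj algebra_simps)
    next
      case 3
      have "coeff s 2 = of_real (fact (2 + m') / 2 * (fact j' * c j'))"
        by (simp only: cs poch mj) simp
      then show ?thesis
        using 3 by (simp add: s2_def P_def Q_def mj algebra_simps eval_nat_numeral)
    next
      case 4
      then show ?thesis by (auto simp: cs coeff_pCons split: nat.split)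
    qed
  qed
  then have "4 * s2 * s0 \<le> s1\<^sup>2"
    using rs real_rooted_quadratic[of s0 s1 s2] by simp
  moreover have gen: "4 * ((b + 2) * (b + 1) * P / 2 * (Q * x)) * (P * ((a + 2) * (a + 1) * Q / 2 * y)) =
      (P\<^sup>2 * Q\<^sup>2 * ((b + 1) * (a + 1))) * ((b + 2) * (a + 2) * (x * y))" for a b P Q x y :: real
    by (simp add: power2_eq_square)
  moreover have "4 * s2 * s0 =
      (P\<^sup>2 * Q\<^sup>2 * ((m' + 1) * (j' + 1))) * (real ((m' + 2) * (j' + 2)) * (c (j - 1) * c (j + 1)))"
    using gen[of "real m'" P Q "c (j - 1)" "real j'" "c (j + 1)"]
    by (simp only: s0_def s2_def of_nat_mult of_nat_add of_nat_1 of_nat_numeral)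
  moreover have "s1\<^sup>2 = (P\<^sup>2 * Q\<^sup>2 * ((m' + 1) * (j' + 1))) * (real ((m' + 1) * (j' + 1)) * (c j)\<^sup>2)"
    by (simp add: s1_def power2_eq_square algebra_simps)
  ultimately have "(P\<^sup>2 * Q\<^sup>2 * ((m' + 1) * (j' + 1))) * (real ((m' + 2) * (j' + 2)) * (c (j - 1) * c (j + 1)))
      \<le> (P\<^sup>2 * Q\<^sup>2 * ((m' + 1) * (j' + 1))) * (real ((m' + 1) * (j' + 1)) * (c j)\<^sup>2)"
    by simp
  moreover have "P\<^sup>2 * Q\<^sup>2 * ((m' + 1) * (j' + 1)) > 0"
    unfolding P_def Q_def by (intro mult_pos_pos) (simp_all add: add_pos_nonneg)
  ultimately have "real ((m' + 2) * (j' + 2)) * (c (j - 1) * c (j + 1))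
      \<le> real ((m' + 1) * (j' + 1)) * (c j)\<^sup>2"
    by (simp only: mult_le_cancel_left_pos)
  then show ?thesis using mj nj by simp
qed

text \<open>In the expansion of the product a subset contributes in the degree given by its
  cardinality. Factors \<open>1 + x_i t\<close> rather than \<open>t + x_i\<close> put
  \<open>esym k x\<close> at degree \<open>k\<close>; entries \<open>x_i = 0\<close> only lower the
  degree.\<close>

lemma prod_pCons_1_esym:
  fixes x :: "real ^ 'n::finite"
  shows "coeff (\<Prod>i\<in>UNIV. [:1, of_real (x $ i) :: 'a::real_normed_field:]) k = of_real (esym k x)"
proof -
  have m: "(\<Prod>i\<in>X. monom (of_real (x $ i)) (Suc 0)) = monom (\<Prod>i\<in>X. of_real (x $ i) :: 'a) (card X)"
    for X using finite[of X] by induction (auto simp: mult_monom monom_0)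
  have "(\<Prod>i\<in>UNIV. [:1, of_real (x $ i) :: 'a:]) = (\<Prod>i\<in>UNIV. monom (of_real (x $ i)) 1 + 1)"
    by (simp add: monom_altdef one_pCons)
  also have "\<dots> = (\<Sum>X\<in>UNIV. monom (of_real (\<Prod>i\<in>X. x $ i)) (card X))"
    by (subst prod_add) (auto intro!: sum.cong m)
  also have "coeff \<dots> k = (\<Sum>X\<in>UNIV. if card X = k then (\<Prod>i\<in>X. of_real (x $ i)) else 0)"
    by (simp add: coeff_sum cong: if_cong)
  also have "\<dots> = (\<Sum>X | card X = k. \<Prod>i\<in>X. of_real (x $ i))"
    by (subst sum.inter_filter[symmetric]) auto
  finally show ?thesis by (simp add: esym_def)
qed

lemma newton_esym:
  fixes x :: "real ^ 'n::finite"
  assumes "1 \<le> j" "j + 1 \<le> CARD('n)"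
  shows "real ((CARD('n) - j + 1) * (j + 1)) * (esym (j - 1) x * esym (j + 1) x)
           \<le> real ((CARD('n) - j) * j) * (esym j x)\<^sup>2"
proof (rule newton_coeffs[OF _ _ _ assms])
  let ?p = "\<Prod>i\<in>UNIV. [:1, of_real (x $ i) :: complex:]"
  show "real_rooted ?p"
    unfolding real_rooted_def
  proof (intro disjI2 allI impI)
    fix z assume "poly ?p z = 0"
    then obtain i where i: "1 + z * of_real (x $ i) = 0" by (auto simp: poly_prod)
    then have "x $ i \<noteq> 0" by auto
    with i have "z = of_real (- 1 / x $ i)" by (simp add: field_simps add_eq_0_iff)
    then show "z \<in> \<real>" by simp
  qed
  have "degree ?p \<le> (\<Sum>i\<in>(UNIV :: 'n set). degree [:1, of_real (x $ i) :: complex:])"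
    using degree_prod_sum_le[of UNIV "\<lambda>i. [:1, of_real (x $ i) :: complex:]"] by (simp add: o_def)
  also have "\<dots> \<le> (\<Sum>i\<in>(UNIV :: 'n set). 1)" by (intro sum_mono) simp
  finally show "degree ?p \<le> CARD('n)" by simp
  show "coeff ?p i = of_real (esym i x)" for i by (rule prod_pCons_1_esym)
qed

text \<open>The factors in \<open>newton_esym\<close> are ratios of neighbouring binomial
  coefficients (\<open>b1\<close> and \<open>b2\<close> below), so the normalisation absorbs them.
  Log-concavity rests on the reality of the roots alone, whatever the signs of the entries.\<close>

lemma newton_Hk:
  fixes x :: "real ^ 'n::finite"
  assumes j: "1 \<le> j" "j + 1 \<le> CARD('n)"
  shows "Hk (j - 1) x * Hk (j + 1) x \<le> (Hk j x)\<^sup>2"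
proof -
  let ?n = "CARD('n)"
  define B where "B i = real (?n choose i)" for i
  have B: "B i > 0" if "i \<le> ?n" for i using that by (simp add: B_def)
  have e: "esym i x = B i * Hk i x" if "i \<le> ?n" for i
    using B[OF that] by (simp add: Hk_def B_def)
  obtain j' where j': "j = Suc j'" using j by (cases j) auto
  have "Suc j' * (?n choose Suc j') = (?n - j') * (?n choose j')"
    by (metis binomial_absorb_comp binomial_absorption mult.commute)
  then have b1: "real j * B j = real (?n - j + 1) * B (j - 1)"
    using j j' unfolding B_def by (metis Suc_diff_Suc add.commute diff_Suc_1 less_eq_Suc_le of_nat_mult plus_1_eq_Suc add_leD1)
  have "Suc j * (?n choose Suc j) = (?n - j) * (?n choose j)"
    by (metis binomial_absorb_comp binomial_absorption mult.commute)
  then have b2: "real (j + 1) * B (j + 1) = real (?n - j) * B j"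
    unfolding B_def by (metis Suc_eq_plus1 of_nat_mult)
  have "real (?n - j + 1) * real (j + 1) * (B (j - 1) * Hk (j - 1) x * (B (j + 1) * Hk (j + 1) x))
           \<le> real (?n - j) * real j * (B j * Hk j x)\<^sup>2"
    using newton_esym[OF j, of x] e[of "j - 1"] e[of j] e[of "j + 1"] j
    by (simp only: of_nat_mult le_diff_conv add_leD1 trans_le_add1)
  moreover have "real (?n - j + 1) * real (j + 1) * (B (j - 1) * Hk (j - 1) x * (B (j + 1) * Hk (j + 1) x))
     = (real (?n - j + 1) * B (j - 1)) * (real (j + 1) * B (j + 1)) * (Hk (j - 1) x * Hk (j + 1) x)"
    by (simp only: ac_simps)
  moreover have "\<dots> = (real j * real (?n - j) * (B j)\<^sup>2) * (Hk (j - 1) x * Hk (j + 1) x)"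
    unfolding b1[symmetric] b2 by (simp only: power2_eq_square ac_simps)
  moreover have "real (?n - j) * real j * (B j * Hk j x)\<^sup>2
     = (real j * real (?n - j) * (B j)\<^sup>2) * (Hk j x)\<^sup>2"
    by (simp only: power_mult_distrib ac_simps)
  moreover have "real j * real (?n - j) * (B j)\<^sup>2 > 0" using j B[of j] by simp
  ultimately show ?thesis by (simp only: mult_le_cancel_left_pos)
qed

section \<open>Bounds for quotients of normalised symmetric functions\<close>

lemma Hk_0 [simp]: "Hk 0 x = 1"
proof -
  have "{S::'a set. S \<subseteq> UNIV \<and> card S = 0} = {{}}" by auto
  then show ?thesis by (simp add: Hk_def esym_def)
qed

lemma Gamma_plus_Hk_pos:
  fixes x :: "real ^ 'n::finite"
  assumes "x \<in> Gamma_plus k" "i \<le> k" "k \<le> CARD('n)"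
  shows "Hk i x > 0"
proof (cases "i = 0")
  case False
  then show ?thesis using assms by (auto simp: Gamma_plus_def Hk_def)
qed simp

text \<open>By \<open>newton_Hk\<close> the ratios \<open>Hk (Suc l) x / Hk l x\<close> do not
  increase with \<open>l\<close>, and the first one is \<open>Hk 1 x\<close>. Positivity on
  \<open>Gamma_plus k\<close> permits the cancellation.\<close>

lemma Hk_Suc_le:
  fixes x :: "real ^ 'n::finite"
  assumes x: "x \<in> Gamma_plus k" "k \<le> CARD('n)" and l: "l < k"
  shows "Hk (Suc l) x \<le> Hk 1 x * Hk l x"
  using l
proof (induction l)
  case (Suc l)
  have pos: "Hk l x > 0" "Hk (Suc l) x > 0"
    using Gamma_plus_Hk_pos[OF x(1) _ x(2)] Suc.prems by auto
  have "Hk l x * Hk (Suc (Suc l)) x \<le> (Hk (Suc l) x)\<^sup>2"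
    using newton_Hk[of "Suc l" x] Suc.prems x(2) by simp
  also have "\<dots> \<le> Hk (Suc l) x * (Hk 1 x * Hk l x)"
    using Suc pos by (simp add: power2_eq_square)
  also have "\<dots> = Hk l x * (Hk 1 x * Hk (Suc l) x)" by simp
  finally show ?case using pos by (simp only: mult_le_cancel_left_pos)
qed simp

lemma Hk_le_power:
  fixes x :: "real ^ 'n::finite"
  assumes x: "x \<in> Gamma_plus k" "k \<le> CARD('n)" and "i + d \<le> k"
  shows "Hk (i + d) x \<le> (Hk 1 x) ^ d * Hk i x"
  using assms(3)
proof (induction d)
  case (Suc d)
  have "Hk (i + Suc d) x \<le> Hk 1 x * Hk (i + d) x"
    using Hk_Suc_le[OF x, of "i + d"] Suc.prems by simp
  also have "\<dots> \<le> Hk 1 x * ((Hk 1 x) ^ d * Hk i x)"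
    using Suc Gamma_plus_Hk_pos[OF x(1) _ x(2), of 1] by (intro mult_left_mono) auto
  finally show ?case by simp
qed simp

text \<open>Multiplying the ratios gives \<open>H_j \<le> H_1^(j-i) H_i\<close>, and a root of order
  \<open>j - i\<close> is taken. The bound is the same for all \<open>i < j\<close>, so it passes to
  convex combinations.\<close>

lemma curvature_quotient_ge:
  fixes x :: "real ^ 'n::finite"
  assumes x: "x \<in> Gamma_plus k" "k \<le> CARD('n)" and ij: "i < j" "j \<le> k"
  shows "1 / Hk 1 x \<le> (Hk i x / Hk j x) powr (1 / (real j - real i))"
proof -
  define d where "d = j - i"
  have d: "d > 0" "j = i + d" using ij by (auto simp: d_def)
  have pos: "Hk 1 x > 0" "Hk i x > 0" "Hk j x > 0"
    using Gamma_plus_Hk_pos[OF x(1) _ x(2)] ij by auto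
  have "(1 / Hk 1 x) ^ d \<le> Hk i x / Hk j x"
    using Hk_le_power[OF x, of i d] ij d pos by (simp add: field_simps)
  then have "((1 / Hk 1 x) powr real d) powr (1 / real d) \<le> (Hk i x / Hk j x) powr (1 / real d)"
    using pos by (intro powr_mono2) (auto simp: powr_realpow)
  also have "((1 / Hk 1 x) powr real d) powr (1 / real d) = 1 / Hk 1 x"
    using pos d unfolding powr_powr by simp
  finally show ?thesis using d by simp
qed

text \<open>Double counting: pairs of an \<open>l\<close>-set and an element outside it correspond
  to pairs of an \<open>(l+1)\<close>-set and one of its elements. Each product over the smaller set
  is nonnegative, so the factor \<open>c\<close> gives no more than the entry that is added.\<close>

lemma esym_Suc_ge:
  fixes x :: "real ^ 'n::finite"
  assumes c: "c \<ge> 0" "\<And>i. c \<le> x $ i"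
  shows "c * (real (CARD('n) - l) * esym l x) \<le> real (Suc l) * esym (Suc l) x"
proof -
  have x0: "x $ i \<ge> 0" for i using c order_trans by blast
  have "real (CARD('n) - l) * esym l x = (\<Sum>S | card S = l. \<Sum>i\<in>- S. \<Prod>i\<in>S. x $ i)"
    by (auto simp: esym_def sum_distrib_left Compl_eq_Diff_UNIV card_Diff_subset intro!: sum.cong)
  also have "\<dots> = (\<Sum>(S, i)\<in>(SIGMA S:{S. card S = l}. - S). \<Prod>i\<in>S. x $ i)"
    by (subst sum.Sigma) auto
  also have "\<dots> = (\<Sum>(T, i)\<in>(SIGMA T:{T. card T = Suc l}. T). \<Prod>i\<in>T - {i}. x $ i)"
    by (rule sum.reindex_bij_witness[where i = "\<lambda>(T, i). (T - {i}, i)" and j = "\<lambda>(S, i). (insert i S, i)"])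
      (auto simp: card_Diff_singleton insert_absorb)
  also have "\<dots> = (\<Sum>T | card T = Suc l. \<Sum>i\<in>T. \<Prod>i\<in>T - {i}. x $ i)"
    by (subst sum.Sigma) auto
  finally have "c * (real (CARD('n) - l) * esym l x)
      = (\<Sum>T | card T = Suc l. \<Sum>i\<in>T. c * (\<Prod>i\<in>T - {i}. x $ i))"
    by (simp add: sum_distrib_left)
  also have "\<dots> \<le> (\<Sum>T | card T = Suc l. \<Sum>i\<in>T. x $ i * (\<Prod>i\<in>T - {i}. x $ i))"
    by (intro sum_mono mult_right_mono c prod_nonneg ballI x0)
  also have "\<dots> = (\<Sum>T | card T = Suc l. \<Sum>i\<in>T. (\<Prod>i\<in>T. x $ i))"
    by (intro sum.cong refl) (auto intro!: prod.remove[symmetric])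
  also have "\<dots> = real (Suc l) * esym (Suc l) x"
    by (simp add: esym_def sum_distrib_left del: of_nat_Suc)
  finally show ?thesis .
qed

lemma Hk_Suc_ge:
  fixes x :: "real ^ 'n::finite"
  assumes c: "c \<ge> 0" "\<And>i. c \<le> x $ i" and l: "l < CARD('n)"
  shows "c * Hk l x \<le> Hk (Suc l) x"
proof -
  let ?n = "CARD('n)"
  have "real (Suc l * (?n choose Suc l)) = real ((?n - l) * (?n choose l))"
    by (metis binomial_absorb_comp binomial_absorption mult.commute)
  then have b: "real (Suc l) * real (?n choose Suc l) = real (?n - l) * real (?n choose l)"
    by (simp only: of_nat_mult)
  have pos: "real (?n choose l) > 0" "real (?n choose Suc l) > 0" "real (?n - l) > 0" using l by auto
  have "c * Hk l x = c * (real (?n - l) * esym l x) / (real (?n - l) * real (?n choose l))"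
    using pos by (simp add: Hk_def)
  also have "\<dots> \<le> real (Suc l) * esym (Suc l) x / (real (?n - l) * real (?n choose l))"
    using pos by (intro divide_right_mono esym_Suc_ge c) auto
  also have "\<dots> = Hk (Suc l) x"
    unfolding b[symmetric] by (simp add: Hk_def)
  finally show ?thesis .
qed

text \<open>Counterpart of \<open>curvature_quotient_ge\<close> when all entries are at least
  \<open>c > 0\<close>: each ratio \<open>Hk (Suc l) x / Hk l x\<close> is then at least
  \<open>c\<close>, and positivity of all \<open>Hk l x\<close> comes along by induction. It serves
  at the point where \<open>r\<close> is maximal.\<close>

lemma curvature_quotient_le:
  fixes x :: "real ^ 'n::finite"
  assumes c: "c > 0" "\<And>i. c \<le> x $ i" and ij: "i < j" "j \<le> CARD('n)"
  shows "(Hk i x / Hk j x) powr (1 / (real j - real i)) \<le> 1 / c"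
proof -
  define d where "d = j - i"
  have d: "d > 0" "j = i + d" using ij by (auto simp: d_def)
  have ge: "c * Hk l x \<le> Hk (Suc l) x" if "l < CARD('n)" for l
    using Hk_Suc_ge[of c x l] c that by auto
  have pos: "Hk l x > 0" if "l \<le> CARD('n)" for l
    using that
  proof (induction l)
    case (Suc l)
    then have "0 < c * Hk l x" using c by simp
    then show ?case using ge[of l] Suc.prems by linarith
  qed simp
  have "c ^ d * Hk i x \<le> Hk (i + d) x"
    using ij(2) unfolding d(2)
  proof (induction d)
    case (Suc d)
    then have "c * (c ^ d * Hk i x) \<le> c * Hk (i + d) x" using c by (intro mult_left_mono) auto
    then show ?case using ge[of "i + d"] Suc.prems by simp
  qed simp
  moreover have "Hk i x > 0" "Hk j x > 0" using pos ij by auto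
  ultimately have *: "Hk i x / Hk j x \<le> (1 / c) ^ d" "Hk i x / Hk j x > 0"
    using c d by (auto simp: field_simps)
  then have "(Hk i x / Hk j x) powr (1 / real d) \<le> ((1 / c) powr real d) powr (1 / real d)"
    using c by (intro powr_mono2) (auto simp: powr_realpow)
  also have "\<dots> = 1 / c" using c d unfolding powr_powr by simp
  finally show ?thesis using d by simp
qed

lemma Hk_1_shifted:
  fixes x :: "real ^ 'n::finite"
  shows "Hk 1 (shifted \<epsilon> x) = (\<Sum>i\<in>UNIV. x $ i) / CARD('n) - \<epsilon>"
proof -
  have "{S :: 'n set. S \<subseteq> UNIV \<and> card S = 1} = (\<lambda>i. {i}) ` UNIV"
    by (auto simp: card_1_singleton_iff)
  then have "esym 1 (shifted \<epsilon> x) = (\<Sum>i\<in>UNIV. x $ i - \<epsilon>)"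
    by (simp add: esym_def sum.reindex shifted_def)
  then show ?thesis by (simp add: Hk_def sum_subtractf diff_divide_distrib)
qed

section \<open>Inner product forms and relative eigenvalues\<close>

lemma inner_product_form_bounded:
  fixes b :: "'a::euclidean_space \<Rightarrow> 'a \<Rightarrow> real"
  assumes "inner_product_form b"
  shows "bounded_bilinear b"
  using assms by (simp add: inner_product_form_def bilinear_conv_bounded_bilinear)

lemma inner_product_form_sym: "inner_product_form b \<Longrightarrow> b v w = b w v"
  by (simp add: inner_product_form_def)

lemma inner_product_form_pos: "inner_product_form b \<Longrightarrow> v \<noteq> 0 \<Longrightarrow> b v v > 0"
  by (simp add: inner_product_form_def)

lemma inner_product_form_eq_0:
  fixes b :: "'a::euclidean_space \<Rightarrow> 'a \<Rightarrow> real"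
  assumes "inner_product_form b"
  shows "b v v = 0 \<longleftrightarrow> v = 0"
  using inner_product_form_pos[OF assms, of v]
    bounded_bilinear.zero_left[OF inner_product_form_bounded[OF assms]] by force

text \<open>Riesz representation for a form other than the ambient inner product. Unique existence
  gives a meaning to the definite description in \<open>christoffel\<close>.\<close>

lemma inner_product_form_representation:
  fixes b :: "'a::euclidean_space \<Rightarrow> 'a \<Rightarrow> real"
  assumes b: "inner_product_form b" and f: "linear f"
  shows "\<exists>!z. \<forall>y. b z y = f y"
proof -
  interpret bounded_bilinear b by (rule inner_product_form_bounded[OF b])
  define T where "T z = (\<Sum>i\<in>Basis. b z i *\<^sub>R i)" for z
  have Tz: "T z \<bullet> y = b z y" for z y
  proof -
    have "b z y = b z (\<Sum>i\<in>Basis. (y \<bullet> i) *\<^sub>R i)" by (simp add: euclidean_representation)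
    also have "\<dots> = T z \<bullet> y"
      by (simp add: sum_right scaleR_right T_def inner_sum_left inner_commute[of y] mult.commute)
    finally show ?thesis ..
  qed
  have "linear T"
    by (rule linearI) (simp_all add: T_def add_left scaleR_left scaleR_left_distrib sum.distrib scaleR_sum_right)
  moreover have "inj T"
  proof (subst linear_injective_0[OF \<open>linear T\<close>], intro allI impI)
    fix z assume "T z = 0"
    then show "z = 0" using Tz[of z z] inner_product_form_eq_0[OF b, of z] by simp
  qed
  ultimately have "surj T" by (intro linear_injective_imp_surjective) auto
  then obtain z where "T z = (\<Sum>i\<in>Basis. f i *\<^sub>R i)" by (metis surj_def)
  then have "b z y = (\<Sum>i\<in>Basis. f i *\<^sub>R i) \<bullet> y" for y using Tz[of z y] by simp
  also have "(\<Sum>i\<in>Basis. f i *\<^sub>R i) \<bullet> y = f (\<Sum>i\<in>Basis. (y \<bullet> i) *\<^sub>R i)" for y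
    unfolding linear_sum[OF f] linear_cmul[OF f]
    by (simp add: inner_sum_left inner_commute[of y] mult.commute)
  finally have "b z y = f y" for y by (simp add: euclidean_representation)
  moreover have "z' = z" if "\<forall>y. b z' y = f y" for z'
    using that calculation inner_product_form_eq_0[OF b, of "z' - z"] by (simp add: diff_left)
  ultimately show ?thesis by blast
qed

lemma orthonormal_set_exists:
  fixes b :: "'a::euclidean_space \<Rightarrow> 'a \<Rightarrow> real"
  assumes b: "inner_product_form b" and "k \<le> DIM('a)"
  shows "\<exists>B. finite B \<and> card B = k \<and> (\<forall>v\<in>B. \<forall>w\<in>B. b v w = (if v = w then 1 else 0))"
  using assms(2)
proof (induction k)
  case 0
  then show ?case by (intro exI[of _ "{}"]) auto
next
  case (Suc k)
  interpret bounded_bilinear b by (rule inner_product_form_bounded[OF b])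
  obtain B where B: "finite B" "card B = k" "\<And>v w. v \<in> B \<Longrightarrow> w \<in> B \<Longrightarrow> b v w = (if v = w then 1 else 0)"
    using Suc by force
  have "dim (span B) \<le> k" using B dim_le_card'[OF B(1)] by simp
  then have "span B \<noteq> UNIV" using Suc.prems by (metis dim_UNIV not_less_eq_eq)
  then obtain v where v: "v \<notin> span B" by auto
  define w where "w = v - (\<Sum>e\<in>B. b v e *\<^sub>R e)"
  have "w \<noteq> 0"
  proof
    assume "w = 0"
    then have "v = (\<Sum>e\<in>B. b v e *\<^sub>R e)" by (simp add: w_def)
    also have "\<dots> \<in> span B" by (intro span_sum span_scale span_base)
    finally show False using v by simp
  qed
  then have pos: "b w w > 0" by (rule inner_product_form_pos[OF b])
  have orth: "b w e = 0" "b e w = 0" if "e \<in> B" for e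
  proof -
    have "b w e = b v e - (\<Sum>e'\<in>B. b v e' * b e' e)"
      by (simp add: w_def diff_left sum_left scaleR_left)
    also have "(\<Sum>e'\<in>B. b v e' * b e' e) = (\<Sum>e'\<in>B. if e' = e then b v e else 0)"
      using B(3) that by (intro sum.cong) auto
    finally show "b w e = 0" using that B(1) by simp
    then show "b e w = 0" using inner_product_form_sym[OF b] by metis
  qed
  define z where "z = w /\<^sub>R sqrt (b w w)"
  have z: "b z z = 1" using pos by (simp add: z_def scaleR_left scaleR_right field_simps)
  have orth_z: "b z e = 0" "b e z = 0" if "e \<in> B" for e
    using orth[OF that] by (simp_all add: z_def scaleR_left scaleR_right)
  have "z \<notin> B" using z orth_z by force
  then show ?case
    using B z orth_z by (intro exI[of _ "insert z B"]) auto
qed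

lemma orthonormal_frame_exists:
  fixes b :: "real ^ 'n::finite \<Rightarrow> real ^ 'n \<Rightarrow> real"
  assumes "inner_product_form b"
  obtains E :: "'n \<Rightarrow> real ^ 'n" where "\<And>i j. b (E i) (E j) = (if i = j then 1 else 0)"
proof -
  obtain B where B: "finite B" "card B = CARD('n)"
    "\<And>v w. v \<in> B \<Longrightarrow> w \<in> B \<Longrightarrow> b v w = (if v = w then 1 else 0)"
    using orthonormal_set_exists[OF assms, of "CARD('n)"] by auto
  then obtain E where E: "bij_betw E (UNIV :: 'n set) B"
    by (metis finite_same_card_bij finite)
  have "b (E i) (E j) = (if i = j then 1 else 0)" for i j
    using B(3)[of "E i" "E j"] bij_betwE[OF E] bij_betw_imp_inj_on[OF E]
    by (auto dest: injD)
  then show ?thesis using that by blast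
qed

lemma orthonormal_frame_expansion:
  fixes b :: "real ^ 'n::finite \<Rightarrow> real ^ 'n \<Rightarrow> real" and E :: "'n \<Rightarrow> real ^ 'n"
  assumes b: "inner_product_form b" and E: "\<And>i j. b (E i) (E j) = (if i = j then 1 else 0)"
  shows "v = (\<Sum>i\<in>UNIV. b v (E i) *\<^sub>R E i)" and "b v v = (\<Sum>i\<in>UNIV. (b v (E i))\<^sup>2)"
proof -
  interpret bounded_bilinear b by (rule inner_product_form_bounded[OF b])
  define T where "T c = (\<Sum>i\<in>UNIV. (c $ i) *\<^sub>R E i)" for c :: "real ^ 'n"
  have bT: "b (T c) (E j) = c $ j" for c j
  proof -
    have "b (T c) (E j) = (\<Sum>i\<in>UNIV. if i = j then c $ i else 0)"
      by (simp add: T_def sum_left scaleR_left E if_distrib cong: if_cong)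
    then show ?thesis by simp
  qed
  have "linear T"
    by (rule linearI) (simp_all add: T_def scaleR_left_distrib sum.distrib scaleR_sum_right)
  moreover have "inj T"
  proof (subst linear_injective_0[OF \<open>linear T\<close>], intro allI impI)
    fix c assume "T c = 0"
    then have "c $ j = 0" for j using bT[of c j] zero_left by simp
    then show "c = 0" by (simp add: vec_eq_iff)
  qed
  ultimately have "surj T" by (intro linear_injective_imp_surjective) auto
  then obtain c where c: "v = T c" by (metis surj_def)
  show v: "v = (\<Sum>i\<in>UNIV. b v (E i) *\<^sub>R E i)"
    unfolding c bT by (simp add: T_def)
  have "b v v = b v (\<Sum>i\<in>UNIV. b v (E i) *\<^sub>R E i)" using v by simp
  also have "\<dots> = (\<Sum>i\<in>UNIV. (b v (E i))\<^sup>2)"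
    by (simp add: sum_right scaleR_right power2_eq_square)
  finally show "b v v = (\<Sum>i\<in>UNIV. (b v (E i))\<^sup>2)" .
qed

section \<open>Traces and eigenvalues relative to a metric\<close>

lemma det_scaleR:
  fixes M :: "real ^ 'n::finite ^ 'n"
  shows "det (c *\<^sub>R M) = c ^ CARD('n) * det M"
proof -
  have "c *\<^sub>R M = mat c ** M"
    by (simp add: vec_eq_iff matrix_matrix_mult_def mat_def if_distrib if_distribR cong: if_cong)
  then show ?thesis
    by (simp add: det_mul det_matrix_scaleR[unfolded matrix_scaleR])
qed

text \<open>A permutation other than the identity moves at least two indices. After differentiating
  one factor of its Leibniz term, an off-diagonal entry of the identity matrix is left, so only the
  diagonal term survives.\<close>

lemma has_field_derivative_det_at_identity:
  fixes M :: "real ^ 'n::finite ^ 'n"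
  shows "((\<lambda>s. det (mat 1 - s *\<^sub>R M)) has_field_derivative - (\<Sum>i\<in>UNIV. M $ i $ i)) (at 0)"
proof -
  let ?P = "{p. p permutes (UNIV :: 'n set)}"
  let ?D = "\<lambda>p. \<Sum>i\<in>(UNIV :: 'n set). - M $ i $ p i * (\<Prod>j\<in>UNIV - {i}. (mat 1 :: real ^ 'n ^ 'n) $ j $ p j)"
  have "((\<lambda>s. \<Sum>p\<in>?P. of_int (sign p) * (\<Prod>i\<in>UNIV. (mat 1 - s *\<^sub>R M) $ i $ p i))
      has_field_derivative (\<Sum>p\<in>?P. of_int (sign p) * ?D p)) (at 0)"
  proof (rule DERIV_cong[OF DERIV_sum])
    fix p
    have "((\<lambda>s. (mat 1 - s *\<^sub>R M) $ i $ p i) has_field_derivative - M $ i $ p i) (at 0)" for i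
      by (auto intro!: derivative_eq_intros)
    then have "((\<lambda>s. \<Prod>i\<in>UNIV. (mat 1 - s *\<^sub>R M) $ i $ p i) has_field_derivative
        (\<Sum>i\<in>UNIV. - M $ i $ p i * (\<Prod>j\<in>UNIV - {i}. (mat 1 - 0 *\<^sub>R M) $ j $ p j))) (at 0)"
      by (rule has_field_derivative_prod)
    then show "((\<lambda>s. of_int (sign p) * (\<Prod>i\<in>UNIV. (mat 1 - s *\<^sub>R M) $ i $ p i))
      has_field_derivative of_int (sign p) * ?D p) (at 0)"
      by (intro DERIV_cmult) simp
  qed simp
  moreover have "of_int (sign p) * ?D p = (if p = id then - (\<Sum>i\<in>UNIV. M $ i $ i) else 0)"
    if p: "p \<in> ?P" for p
  proof (cases "p = id")
    case True
    then show ?thesis by (simp add: mat_def sum_negf sign_id)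
  next
    case False
    have z0: "(\<Prod>j\<in>UNIV - {i}. (mat 1 :: real ^ 'n ^ 'n) $ j $ p j) = 0" for i
    proof -
      obtain k where k: "p k \<noteq> k" using False by (auto simp: fun_eq_iff)
      have "\<exists>j. j \<noteq> i \<and> p j \<noteq> j"
      proof (cases "k = i")
        case True
        have "inj p" using p by (auto dest: permutes_inj)
        then have "p (p k) \<noteq> p k" using k by (auto dest: injD)
        then show ?thesis using k True by metis
      qed (use k in blast)
      then obtain j where "j \<in> UNIV - {i}" "(mat 1 :: real ^ 'n ^ 'n) $ j $ p j = 0"
        by (auto simp: mat_def)
      then show ?thesis by (intro prod_zero) auto
    qed
    then show ?thesis by (simp only: z0 False mult_zero_right sum.neutral_const if_False)
  qed
  then have "(\<Sum>p\<in>?P. of_int (sign p) * ?D p)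
      = (\<Sum>p\<in>?P. if p = id then - (\<Sum>i\<in>UNIV. M $ i $ i) else 0)"
    by (rule sum.cong[OF refl])
  also have "\<dots> = - (\<Sum>i\<in>UNIV. M $ i $ i)"
    by (simp add: sum.delta finite_permutations permutes_id)
  ultimately show ?thesis unfolding det_def by simp
qed

text \<open>Substituting \<open>t = 1 / s\<close> turns the hypothesis into
  \<open>det (1 - s M) = \<Prod> (1 - s k_i)\<close>, and both sides are differentiated at
  \<open>s = 0\<close>. No diagonalisation is involved.\<close>

lemma trace_eq_sum_roots:
  fixes M :: "real ^ 'n::finite ^ 'n" and k :: "'n \<Rightarrow> real"
  assumes "\<And>t. det (M - t *\<^sub>R mat 1) = (\<Prod>i\<in>UNIV. k i - t)"
  shows "(\<Sum>i\<in>UNIV. M $ i $ i) = (\<Sum>i\<in>UNIV. k i)"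
proof -
  have "det (mat 1 - s *\<^sub>R M) = (\<Prod>i\<in>UNIV. 1 - s * k i)" for s
  proof (cases "s = 0")
    case False
    then have "mat 1 - s *\<^sub>R M = (- s) *\<^sub>R (M - (1 / s) *\<^sub>R mat 1)"
      by (simp add: algebra_simps)
    then have "det (mat 1 - s *\<^sub>R M) = (- s) ^ CARD('n) * (\<Prod>i\<in>UNIV. k i - 1 / s)"
      by (simp only: det_scaleR assms)
    also have "\<dots> = (\<Prod>i\<in>UNIV. (- s) * (k i - 1 / s))"
      by (simp only: prod.distrib) simp
    also have "\<dots> = (\<Prod>i\<in>UNIV. 1 - s * k i)"
      using False by (intro prod.cong) (auto simp: algebra_simps)
    finally show ?thesis .
  qed (simp add: det_I)
  then have "((\<lambda>s. \<Prod>i\<in>UNIV. 1 - s * k i) has_field_derivative - (\<Sum>i\<in>UNIV. M $ i $ i)) (at 0)"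
    using has_field_derivative_det_at_identity[of M] by simp
  moreover have "((\<lambda>s. \<Prod>i\<in>UNIV. 1 - s * k i) has_field_derivative (\<Sum>i\<in>UNIV. - k i)) (at 0)"
  proof -
    have "((\<lambda>s. 1 - s * k i) has_field_derivative - k i) (at 0)" for i
      by (auto intro!: derivative_eq_intros)
    from has_field_derivative_prod[of UNIV "\<lambda>i s. 1 - s * k i", OF this] show ?thesis by simp
  qed
  ultimately have "- (\<Sum>i\<in>UNIV. M $ i $ i) = (\<Sum>i\<in>UNIV. - k i)"
    by (rule DERIV_unique)
  then show ?thesis by (simp add: sum_negf)
qed

text \<open>With the frame vectors as rows of \<open>P\<close>, the relation
  \<open>P I P^T = 1\<close> turns the relative characteristic polynomial of \<open>h\<close> into
  the ordinary one of \<open>P h P^T\<close>, whose diagonal holds the values of \<open>h\<close> on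
  the frame.\<close>

lemma trace_second_form_eq:
  fixes I h :: "real ^ 'n::finite ^ 'n" and E :: "'n \<Rightarrow> real ^ 'n" and k :: "'n \<Rightarrow> real"
  assumes char: "\<And>t. det (h - t *\<^sub>R I) = det I * (\<Prod>i\<in>UNIV. k i - t)"
    and E: "\<And>i j. E i \<bullet> (I *v E j) = (if i = j then 1 else 0)"
  shows "(\<Sum>i\<in>UNIV. E i \<bullet> (h *v E i)) = (\<Sum>i\<in>UNIV. k i)"
proof -
  define P where "P = (\<chi> i. E i)"
  have P: "(P ** M ** transpose P) $ i $ j = E i \<bullet> (M *v E j)" for M :: "real ^ 'n ^ 'n" and i j
  proof -
    have "(P ** M ** transpose P) $ i $ j = (\<Sum>l\<in>UNIV. (\<Sum>m\<in>UNIV. E i $ m * M $ m $ l) * E j $ l)"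
      by (simp add: P_def matrix_matrix_mult_def transpose_def)
    also have "\<dots> = (\<Sum>m\<in>UNIV. \<Sum>l\<in>UNIV. E i $ m * M $ m $ l * E j $ l)"
      by (subst sum.swap) (simp add: sum_distrib_right)
    also have "\<dots> = E i \<bullet> (M *v E j)"
      by (simp add: inner_vec_def matrix_vector_mult_def sum_distrib_left mult.assoc)
    finally show ?thesis .
  qed
  have I1: "P ** I ** transpose P = mat 1"
    by (simp add: vec_eq_iff P E mat_def)
  then have d: "det P * det I * det P = 1"
    by (metis det_I det_mul det_transpose)
  have "det (P ** h ** transpose P - t *\<^sub>R mat 1) = (\<Prod>i\<in>UNIV. k i - t)" for t
  proof -
    have "P ** h ** transpose P - t *\<^sub>R mat 1 = P ** (h - t *\<^sub>R I) ** transpose P"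
      unfolding I1[symmetric]
      by (simp add: vec_eq_iff P matrix_vector_mult_diff_rdistrib inner_diff_right
          scaleR_matrix_vector_assoc[symmetric])
    then have "det (P ** h ** transpose P - t *\<^sub>R mat 1) = det P * (det I * (\<Prod>i\<in>UNIV. k i - t)) * det P"
      by (simp only: det_mul det_transpose char)
    also have "\<dots> = (det P * det I * det P) * (\<Prod>i\<in>UNIV. k i - t)" by (simp only: ac_simps)
    finally show ?thesis using d by simp
  qed
  then have "(\<Sum>i\<in>UNIV. (P ** h ** transpose P) $ i $ i) = (\<Sum>i\<in>UNIV. k i)"
    by (rule trace_eq_sum_roots[where k = "\<lambda>i. k i"])
  then show ?thesis by (simp add: P)
qed

text \<open>A root of the relative characteristic polynomial belongs to some \<open>v\<close> with
  \<open>h v = k_i I v\<close>, and its Rayleigh quotient is the root. A lower bound for the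
  quadratic form thus reaches every principal curvature.\<close>

lemma relative_eigenvalue_ge:
  fixes I h :: "real ^ 'n::finite ^ 'n" and k :: "'n \<Rightarrow> real"
  assumes char: "\<And>t. det (h - t *\<^sub>R I) = det I * (\<Prod>i\<in>UNIV. k i - t)"
    and I: "\<And>v. v \<noteq> 0 \<Longrightarrow> v \<bullet> (I *v v) > 0"
    and h: "\<And>v. c * (v \<bullet> (I *v v)) \<le> v \<bullet> (h *v v)"
  shows "c \<le> k i"
proof -
  have "det (h - k i *\<^sub>R I) = 0" unfolding char by (simp add: prod_zero_iff) (metis right_minus_eq)
  then have "\<not> invertible (h - k i *\<^sub>R I)" by (simp add: invertible_det_nz)
  then obtain v where v: "v \<noteq> 0" "(h - k i *\<^sub>R I) *v v = 0"
    using matrix_left_invertible_ker[of "h - k i *\<^sub>R I"] invertible_left_inverse by blast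
  then have "h *v v = k i *\<^sub>R (I *v v)"
    by (simp add: matrix_vector_mult_diff_rdistrib scaleR_matrix_vector_assoc)
  then have "c * (v \<bullet> (I *v v)) \<le> k i * (v \<bullet> (I *v v))" using h[of v] by simp
  then show ?thesis using I[OF v(1)] by simp
qed

section \<open>Second fundamental form and the Koszul formula\<close>

definition differentiable_metric :: "'b::euclidean_space set \<Rightarrow> ('b \<Rightarrow> 'b \<Rightarrow> 'b \<Rightarrow> real) \<Rightarrow> bool" where
  "differentiable_metric U G \<longleftrightarrow> open U \<and> (\<forall>p\<in>U. inner_product_form (G p) \<and>
     (\<forall>v w. (\<lambda>q. G q v w) differentiable (at p)))"

definition metric_deriv :: "('b::euclidean_space \<Rightarrow> 'b \<Rightarrow> 'b \<Rightarrow> real) \<Rightarrow> 'b \<Rightarrow> 'b \<Rightarrow> 'b \<Rightarrow> 'b \<Rightarrow> real" where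
  "metric_deriv G p z v w = frechet_derivative (\<lambda>q. G q v w) (at p) z"

lemma has_derivative_metric:
  assumes "differentiable_metric U G" "p \<in> U"
  shows "((\<lambda>q. G q v w) has_derivative (\<lambda>z. metric_deriv G p z v w)) (at p)"
  using assms unfolding metric_deriv_def differentiable_metric_def
  by (metis frechet_derivative_works)

lemma linear_metric_deriv:
  assumes "differentiable_metric U G" "p \<in> U"
  shows "linear (\<lambda>z. metric_deriv G p z v w)"
  using has_derivative_metric[OF assms] by (rule has_derivative_linear)

text \<open>Symmetry holds at all points of the open set \<open>U\<close>, so both sides have the
  same derivative. Linearity in the last two arguments is obtained below in the same way.\<close>

lemma metric_deriv_commute:
  assumes "differentiable_metric U G" "p \<in> U"
  shows "metric_deriv G p z v w = metric_deriv G p z w v"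
proof -
  have "((\<lambda>q. G q w v) has_derivative (\<lambda>z. metric_deriv G p z v w)) (at p)"
    by (rule has_derivative_transform_within_open[OF has_derivative_metric[OF assms]])
      (use assms in \<open>auto simp: differentiable_metric_def inner_product_form_sym\<close>)
  then have "(\<lambda>z. metric_deriv G p z v w) = (\<lambda>z. metric_deriv G p z w v)"
    using has_derivative_metric[OF assms] by (rule has_derivative_unique)
  then show ?thesis by metis
qed

lemma linear_metric_deriv_left:
  assumes G: "differentiable_metric U G" "p \<in> U"
  shows "linear (\<lambda>v. metric_deriv G p z v w)"
proof (rule linearI)
  have U: "open U" and b: "\<And>q. q \<in> U \<Longrightarrow> bounded_bilinear (G q)"
    using G by (auto simp: differentiable_metric_def inner_product_form_bounded)
  fix v v' c
  have "((\<lambda>q. G q (v + v') w) has_derivative (\<lambda>z. metric_deriv G p z v w + metric_deriv G p z v' w)) (at p)"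
    by (rule has_derivative_transform_within_open[OF has_derivative_add[OF has_derivative_metric[OF G] has_derivative_metric[OF G]] U G(2)])
      (use b in \<open>auto simp: bounded_bilinear.add_left\<close>)
  then have "(\<lambda>z. metric_deriv G p z (v + v') w) = (\<lambda>z. metric_deriv G p z v w + metric_deriv G p z v' w)"
    by (rule has_derivative_unique[OF has_derivative_metric[OF G]])
  then show "metric_deriv G p z (v + v') w = metric_deriv G p z v w + metric_deriv G p z v' w" by metis
  have "((\<lambda>q. G q (c *\<^sub>R v) w) has_derivative (\<lambda>z. c *\<^sub>R metric_deriv G p z v w)) (at p)"
    by (rule has_derivative_transform_within_open[OF has_derivative_scaleR_right[OF has_derivative_metric[OF G]] U G(2)])
      (use b in \<open>auto simp: bounded_bilinear.scaleR_left\<close>)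
  then have "(\<lambda>z. metric_deriv G p z (c *\<^sub>R v) w) = (\<lambda>z. c *\<^sub>R metric_deriv G p z v w)"
    by (rule has_derivative_unique[OF has_derivative_metric[OF G]])
  then show "metric_deriv G p z (c *\<^sub>R v) w = c *\<^sub>R metric_deriv G p z v w" by metis
qed

lemma linear_metric_deriv_right:
  assumes "differentiable_metric U G" "p \<in> U"
  shows "linear (\<lambda>w. metric_deriv G p z v w)"
  unfolding metric_deriv_commute[OF assms, of z v] by (rule linear_metric_deriv_left[OF assms])

lemma bounded_bilinear_metric_deriv:
  assumes "differentiable_metric U G" "p \<in> U"
  shows "bounded_bilinear (metric_deriv G p z)"
  using linear_metric_deriv_left[OF assms] linear_metric_deriv_right[OF assms]
  by (simp add: bilinear_conv_bounded_bilinear[symmetric] bilinear_def)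

text \<open>The regularity of a metric is given for fixed arguments \<open>v\<close>,
  \<open>w\<close>. This expansion transfers derivatives, continuity and bounds from the finitely
  many functions \<open>b i j\<close> to varying arguments.\<close>

lemma bilinear_expansion:
  fixes b :: "'a::euclidean_space \<Rightarrow> 'a \<Rightarrow> real"
  assumes "bounded_bilinear b"
  shows "b v w = (\<Sum>i\<in>Basis. \<Sum>j\<in>Basis. (v \<bullet> i) * (w \<bullet> j) * b i j)"
proof -
  interpret bounded_bilinear b by fact
  have "b v w = b (\<Sum>i\<in>Basis. (v \<bullet> i) *\<^sub>R i) (\<Sum>j\<in>Basis. (w \<bullet> j) *\<^sub>R j)"
    by (simp add: euclidean_representation)
  also have "\<dots> = (\<Sum>j\<in>Basis. \<Sum>i\<in>Basis. (v \<bullet> i) * (w \<bullet> j) * b i j)"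
    by (simp only: sum_left sum_right scaleR_left scaleR_right sum_distrib_left real_scaleR_def ac_simps)
  finally show ?thesis by (subst sum.swap)
qed

lemma has_derivative_metric_compose:
  fixes X :: "'a::real_normed_vector \<Rightarrow> 'b::euclidean_space"
  assumes G: "differentiable_metric U G" "X y \<in> U"
    and X: "(X has_derivative X') (at y)"
    and a: "(a has_derivative a') (at y)" and b: "(b has_derivative b') (at y)"
  shows "((\<lambda>x. G (X x) (a x) (b x)) has_derivative
     (\<lambda>e. metric_deriv G (X y) (X' e) (a y) (b y) + G (X y) (a' e) (b y) + G (X y) (a y) (b' e))) (at y)"
proof -
  have bb: "\<And>q. q \<in> U \<Longrightarrow> bounded_bilinear (G q)"
    using G by (auto simp: differentiable_metric_def inner_product_form_bounded)
  have GX: "((\<lambda>x. G (X x) i j) has_derivative (\<lambda>e. metric_deriv G (X y) (X' e) i j)) (at y)" for i j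
    using diff_chain_at[OF X has_derivative_metric[OF G]] by (simp add: o_def)
  have ai: "((\<lambda>x. a x \<bullet> i) has_derivative (\<lambda>e. a' e \<bullet> i)) (at y)" for i
    by (rule has_derivative_inner_left[OF a])
  have bj: "((\<lambda>x. b x \<bullet> i) has_derivative (\<lambda>e. b' e \<bullet> i)) (at y)" for i
    by (rule has_derivative_inner_left[OF b])
  let ?F = "\<lambda>x. \<Sum>i\<in>Basis. \<Sum>j\<in>Basis. (a x \<bullet> i) * (b x \<bullet> j) * G (X x) i j"
  have "(?F has_derivative (\<lambda>e. \<Sum>i\<in>Basis. \<Sum>j\<in>Basis.
      (a y \<bullet> i) * (b y \<bullet> j) * metric_deriv G (X y) (X' e) i j +
      ((a y \<bullet> i) * (b' e \<bullet> j) + (a' e \<bullet> i) * (b y \<bullet> j)) * G (X y) i j)) (at y)"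
    by (intro has_derivative_sum has_derivative_mult GX ai bj)
  also have "(\<lambda>e. \<Sum>i\<in>Basis. \<Sum>j\<in>Basis.
      (a y \<bullet> i) * (b y \<bullet> j) * metric_deriv G (X y) (X' e) i j +
      ((a y \<bullet> i) * (b' e \<bullet> j) + (a' e \<bullet> i) * (b y \<bullet> j)) * G (X y) i j)
    = (\<lambda>e. metric_deriv G (X y) (X' e) (a y) (b y) + G (X y) (a' e) (b y) + G (X y) (a y) (b' e))"
  proof
    fix e
    show "(\<Sum>i\<in>Basis. \<Sum>j\<in>Basis.
      (a y \<bullet> i) * (b y \<bullet> j) * metric_deriv G (X y) (X' e) i j +
      ((a y \<bullet> i) * (b' e \<bullet> j) + (a' e \<bullet> i) * (b y \<bullet> j)) * G (X y) i j)
      = metric_deriv G (X y) (X' e) (a y) (b y) + G (X y) (a' e) (b y) + G (X y) (a y) (b' e)"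
      unfolding bilinear_expansion[OF bounded_bilinear_metric_deriv[OF G], of "X' e" "a y"]
        bilinear_expansion[OF bb[OF G(2)], of "a' e" "b y"]
        bilinear_expansion[OF bb[OF G(2)], of "a y" "b' e"]
      by (simp add: sum.distrib distrib_right)
  qed
  finally have F: "(?F has_derivative
    (\<lambda>e. metric_deriv G (X y) (X' e) (a y) (b y) + G (X y) (a' e) (b y) + G (X y) (a y) (b' e))) (at y)" .
  have ev: "\<forall>\<^sub>F x in at y. X x \<in> U"
    using has_derivative_continuous[OF X] G
    by (auto simp: isCont_def differentiable_metric_def intro: topological_tendstoD)
  have eq: "?F x = G (X x) (a x) (b x)" if "X x \<in> U" for x
    by (rule bilinear_expansion[OF bb[OF that], symmetric])
  show ?thesis
  proof (rule has_derivative_transform_eventually[OF F])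
    show "\<forall>\<^sub>F x in at y. ?F x = G (X x) (a x) (b x)"
      using ev by eventually_elim (rule eq)
    show "?F y = G (X y) (a y) (b y)" using G(2) by (rule eq)
  qed simp
qed

lemma christoffel_koszul:
  assumes G: "differentiable_metric U G" "p \<in> U"
  shows "2 * G p (christoffel G p v w) y
    = metric_deriv G p v w y + metric_deriv G p w v y - metric_deriv G p y v w"
proof -
  have form: "inner_product_form (G p)" using G by (auto simp: differentiable_metric_def)
  interpret bounded_bilinear "G p" by (rule inner_product_form_bounded[OF form])
  let ?f = "\<lambda>y. (metric_deriv G p v w y + metric_deriv G p w v y - metric_deriv G p y v w) / 2"
  have "linear ?f"
    by (intro linearI)
      (simp_all add: linear_add[OF linear_metric_deriv_right[OF G]] linear_add[OF linear_metric_deriv[OF G]]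
        linear_cmul[OF linear_metric_deriv_right[OF G]] linear_cmul[OF linear_metric_deriv[OF G]]
        field_simps)
  then have "\<exists>!z. \<forall>y. G p z y = ?f y" by (rule inner_product_form_representation[OF form])
  then have "\<exists>!z. \<forall>y. 2 * G p z y = metric_deriv G p v w y + metric_deriv G p w v y - metric_deriv G p y v w"
    by (simp add: field_simps)
  from theI'[OF this] show ?thesis
    unfolding christoffel_def metric_deriv_def by blast
qed

section \<open>Fundamental forms as quadratic forms of tangent vectors\<close>

lemma bilinear_form_matrix:
  fixes b :: "real ^ 'n::finite \<Rightarrow> real ^ 'n \<Rightarrow> real"
  assumes "bilinear b"
  shows "v \<bullet> ((\<chi> i j. b (axis i 1) (axis j 1)) *v w) = b v w"
proof -
  interpret bounded_bilinear b using assms by (simp add: bilinear_conv_bounded_bilinear)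
  have e: "x = (\<Sum>i\<in>UNIV. (x $ i) *\<^sub>R axis i 1)" for x :: "real ^ 'n"
    using basis_expansion[of x] by (simp add: scalar_mult_eq_scaleR)
  have "b v w = b (\<Sum>i\<in>UNIV. (v $ i) *\<^sub>R axis i 1) (\<Sum>i\<in>UNIV. (w $ i) *\<^sub>R axis i 1)"
    by (simp flip: e)
  also have "\<dots> = (\<Sum>j\<in>UNIV. \<Sum>i\<in>UNIV. (v $ i) * (w $ j) * b (axis i 1) (axis j 1))"
    by (simp only: sum_left sum_right scaleR_left scaleR_right sum_distrib_left real_scaleR_def ac_simps)
  also have "\<dots> = v \<bullet> ((\<chi> i j. b (axis i 1) (axis j 1)) *v w)"
    by (subst sum.swap) (simp add: inner_vec_def matrix_vector_mult_def sum_distrib_left ac_simps)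
  finally show ?thesis ..
qed

lemma first_form_apply:
  assumes G: "inner_product_form (G (X y))" and X: "(X has_derivative X') (at y)"
  shows "v \<bullet> (first_form G X y *v w) = G (X y) (X' v) (X' w)"
proof -
  interpret bounded_bilinear "G (X y)" by (rule inner_product_form_bounded[OF G])
  have X': "frechet_derivative X (at y) = X'" using frechet_derivative_at[OF X] by simp
  have "linear X'" using X by (rule has_derivative_linear)
  then have "bilinear (\<lambda>v w. G (X y) (X' v) (X' w))"
    unfolding bilinear_def
    by (auto intro!: linearI simp: linear_add linear_cmul add_left add_right scaleR_left scaleR_right)
  from bilinear_form_matrix[OF this] show ?thesis by (simp add: first_form_def X')
qed

text \<open>Differentiating \<open>G(n, X\<^sub>w) = 0\<close> in the direction \<open>v\<close> and eliminating the derivative of \<open>n\<close>.\<close>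

lemma second_form_apply:
  fixes X :: "real ^ 'n::finite \<Rightarrow> real \<times> (real ^ 'n)"
  assumes G: "differentiable_metric U G" "X y \<in> U" and D: "open D" "y \<in> D"
    and X: "\<And>x. x \<in> D \<Longrightarrow> (X has_derivative X' x) (at x)"
    and X2: "((\<lambda>x. X' x w) has_derivative X2) (at y)"
    and n: "(n has_derivative n') (at y)"
    and orth: "\<And>x. x \<in> D \<Longrightarrow> G (X x) (n x) (X' x w) = 0"
  shows "v \<bullet> (second_form G X n y *v w) = - G (X y) (n y) (X2 v) +
    (metric_deriv G (X y) (n y) (X' y v) (X' y w) - metric_deriv G (X y) (X' y v) (n y) (X' y w)
      - metric_deriv G (X y) (X' y w) (n y) (X' y v)) / 2"
proof -
  have form: "inner_product_form (G (X y))" using G by (auto simp: differentiable_metric_def)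
  interpret bounded_bilinear "G (X y)" by (rule inner_product_form_bounded[OF form])
  note lin = linear_metric_deriv[OF G] linear_metric_deriv_left[OF G] linear_metric_deriv_right[OF G]
  have Xy: "frechet_derivative X (at y) = X' y" using frechet_derivative_at[OF X[OF D(2)]] by simp
  have ny: "frechet_derivative n (at y) = n'" using frechet_derivative_at[OF n] by simp
  have lX: "linear (X' y)" using X[OF D(2)] by (rule has_derivative_linear)
  have ln: "linear n'" using n by (rule has_derivative_linear)
  \<comment> \<open>Koszul's formula has replaced the Christoffel term. Since \<open>?h\<close> is
    bilinear, the matrix entries on the coordinate frame determine its values on all
    \<open>v\<close>, \<open>w\<close>.\<close>
  let ?h = "\<lambda>v w. G (X y) (n' v) (X' y w) +
    (metric_deriv G (X y) (X' y v) (n y) (X' y w) + metric_deriv G (X y) (n y) (X' y v) (X' y w)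
      - metric_deriv G (X y) (X' y w) (X' y v) (n y)) / 2"
  have h: "G (X y) (n' v + christoffel G (X y) (X' y v) (n y)) (X' y w) = ?h v w" for v w
    using christoffel_koszul[OF G, of "X' y v" "n y" "X' y w"] by (simp add: add_left)
  have half: "linear (\<lambda>v. f v / 2)" if "linear f" for f :: "(real, 'n) vec \<Rightarrow> real"
    using linear_compose_scale_right[OF that, of "1 / 2"] by simp
  note cX = linear_compose[OF lX, unfolded o_def]
  have "linear (\<lambda>v. ?h v w)" for w
    by (rule linear_compose_add[OF
          linear_compose[OF ln bounded_linear.linear[OF bounded_linear_left], unfolded o_def]
          half[OF linear_compose_sub[OF linear_compose_add[OF cX[OF lin(1)] cX[OF lin(2)]] cX[OF lin(2)]]]])
  moreover have "linear (\<lambda>w. ?h v w)" for v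
    by (rule linear_compose_add[OF cX[OF bounded_linear.linear[OF bounded_linear_right]]
          half[OF linear_compose_sub[OF linear_compose_add[OF cX[OF lin(3)] cX[OF lin(3)]] cX[OF lin(1)]]]])
  ultimately have "bilinear ?h" by (simp add: bilinear_def)
  then have "v \<bullet> (second_form G X n y *v w) = ?h v w"
    unfolding second_form_def Xy ny h
    by (rule bilinear_form_matrix[where b = ?h])
  moreover have "metric_deriv G (X y) (X' y v) (n y) (X' y w) + G (X y) (n' v) (X' y w) + G (X y) (n y) (X2 v) = 0"
  proof -
    have "((\<lambda>x. G (X x) (n x) (X' x w)) has_derivative (\<lambda>v. 0)) (at y)"
      by (rule has_derivative_transform_within_open[OF has_derivative_const D]) (use orth in auto)
    from fun_cong[OF has_derivative_unique[OF has_derivative_metric_compose[OF G X[OF D(2)] n X2] this], of v]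
    show ?thesis .
  qed
  ultimately show ?thesis
    using metric_deriv_commute[OF G, of "X' y w" "X' y v" "n y"] by (simp add: field_simps)
qed

section \<open>Hypersurfaces in warped products\<close>

lemma smooth_on_open: "smooth_on f S \<Longrightarrow> open S"
  by (simp add: smooth_on_def)

lemma smooth_on_has_derivative:
  assumes "smooth_on f S" "x \<in> S"
  shows "(f has_derivative frechet_derivative f (at x)) (at x)"
proof -
  have "Ck_on (Suc 0) f S" "open S" using assms by (auto simp: smooth_on_def)
  then show ?thesis
    using assms(2) by (simp add: differentiable_on_eq_differentiable_at frechet_derivative_works)
qed

lemma smooth_on_frechet_derivative:
  assumes "smooth_on f S"
  shows "smooth_on (\<lambda>x. frechet_derivative f (at x) v) S"
proof -
  have "Ck_on (Suc k) f S" for k using assms by (simp only: smooth_on_def)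
  then show ?thesis using assms by (simp add: smooth_on_def)
qed

lemma smooth_on_continuous: "smooth_on f S \<Longrightarrow> continuous_on S f"
  unfolding smooth_on_def by (metis Ck_on.simps(1))

lemma smooth_on_imp_deriv:
  fixes f :: "real \<Rightarrow> real"
  assumes "smooth_on f S" "x \<in> S"
  shows "(f has_real_derivative deriv f x) (at x)"
  using smooth_on_has_derivative[OF assms] DERIV_deriv_iff_real_differentiable differentiableI
  by blast

lemma smooth_on_continuous_deriv:
  fixes f :: "real \<Rightarrow> real"
  assumes "smooth_on f S"
  shows "continuous_on S (deriv f)"
proof -
  have "frechet_derivative f (at x) 1 = deriv f x" if "x \<in> S" for x
    using smooth_on_has_derivative[OF assms that] smooth_on_imp_deriv[OF assms that]
    by (metis has_derivative_unique has_field_derivative_imp_has_derivative mult.right_neutral)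
  then show ?thesis
    using smooth_on_continuous[OF smooth_on_frechet_derivative[OF assms, of 1]]
    by (simp cong: continuous_on_cong)
qed

lemma inner_product_form_warped:
  assumes g: "inner_product_form (g c (snd p))" and l: "lam (fst p) \<noteq> 0"
  shows "inner_product_form (warped_metric lam g c p)"
proof -
  interpret bounded_bilinear "g c (snd p)" by (rule inner_product_form_bounded[OF g])
  have "bilinear (warped_metric lam g c p)"
    unfolding bilinear_def
    by (auto intro!: linearI simp: warped_metric_def add_left add_right scaleR_left scaleR_right algebra_simps)
  moreover have "warped_metric lam g c p v v > 0" if "v \<noteq> 0" for v
  proof (cases "snd v = 0")
    case True
    then have "fst v \<noteq> 0" using that by (simp add: prod_eq_iff)
    then have "0 < fst v * fst v" by (metis not_real_square_gt_zero)
    then show ?thesis using True by (simp add: warped_metric_def zero_left)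
  next
    case False
    then have "(lam (fst p))\<^sup>2 * g c (snd p) (snd v) (snd v) > 0"
      using inner_product_form_pos[OF g] l by simp
    then show ?thesis by (simp add: warped_metric_def add_nonneg_pos)
  qed
  ultimately show ?thesis
    using inner_product_form_sym[OF g] by (auto simp: inner_product_form_def warped_metric_def mult.commute)
qed

lemma has_derivative_warped:
  assumes g: "differentiable_metric V (g c)" "snd p \<in> V"
    and l: "(lam has_real_derivative l') (at (fst p))"
  shows "((\<lambda>q. warped_metric lam g c q v w) has_derivative
     (\<lambda>z. 2 * lam (fst p) * l' * fst z * g c (snd p) (snd v) (snd w)
        + (lam (fst p))\<^sup>2 * metric_deriv (g c) (snd p) (snd z) (snd v) (snd w))) (at p)"
proof -
  have 1: "((\<lambda>q. lam (fst q)) has_derivative (\<lambda>z. l' * fst z)) (at p)"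
    using diff_chain_at[OF has_derivative_fst[OF has_derivative_ident] has_field_derivative_imp_has_derivative[OF l]]
    by (simp add: o_def)
  have 2: "((\<lambda>q. g c (snd q) (snd v) (snd w)) has_derivative
      (\<lambda>z. metric_deriv (g c) (snd p) (snd z) (snd v) (snd w))) (at p)"
    using diff_chain_at[OF has_derivative_snd[OF has_derivative_ident] has_derivative_metric[OF g]]
    by (simp add: o_def)
  show ?thesis
    unfolding warped_metric_def
    by (auto intro!: derivative_eq_intros 1 2 simp: algebra_simps power2_eq_square)
qed

lemma metric_deriv_warped:
  assumes "differentiable_metric V (g c)" "snd p \<in> V"
    and "(lam has_real_derivative l') (at (fst p))"
  shows "metric_deriv (warped_metric lam g c) p z v w
    = 2 * lam (fst p) * l' * fst z * g c (snd p) (snd v) (snd w)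
        + (lam (fst p))\<^sup>2 * metric_deriv (g c) (snd p) (snd z) (snd v) (snd w)"
  using frechet_derivative_at[OF has_derivative_warped[where g = g and c = c and v = v and w = w, OF assms], symmetric]
  by (simp add: metric_deriv_def[of "warped_metric lam g c"])

text \<open>\<open>lam\<close> may vanish or be negative on parts of \<open>T\<close>, so the radial
  factor is cut down to the set where it is positive, which is open by continuity.\<close>

lemma differentiable_metric_warped:
  assumes g: "differentiable_metric V (g c)" and T: "smooth_on lam T"
  shows "differentiable_metric ({r \<in> T. lam r > 0} \<times> V) (warped_metric lam g c)"
proof -
  have "open {r \<in> T. lam r > 0}"
    using continuous_on_open_vimage[OF smooth_on_open[OF T], THEN iffD1, OF smooth_on_continuous[OF T], rule_format, of "{0<..}"]
    by (simp add: vimage_def Int_def conj_commute)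
  then have "open ({r \<in> T. lam r > 0} \<times> V)"
    using g by (simp add: open_Times differentiable_metric_def)
  then show ?thesis
    using g differentiableI[OF has_derivative_warped[where g = g and c = c, OF g _ smooth_on_imp_deriv[OF T]]]
    unfolding differentiable_metric_def
    by (auto intro!: inner_product_form_warped)
qed

text \<open>At a point where \<open>X\<close> is tangent to a level set of \<open>r - \<phi>\<close>, with \<open>l = d\<phi>\<close>.\<close>

lemma tangent_normal:
  fixes X' :: "real ^ 'n::finite \<Rightarrow> real \<times> (real ^ 'n)"
  assumes lin: "linear X'" "inj X'" and l: "linear l" "\<And>v. fst (X' v) = l (snd (X' v))"
    and orth: "\<And>v. warped_metric lam g c p n (X' v) = 0"
  shows "surj (\<lambda>v. snd (X' v))" and "(lam (fst p))\<^sup>2 * g c (snd p) (snd n) w = - fst n * l w"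
proof -
  define f where "f v = snd (X' v)" for v
  have "linear f"
    using linear_compose[OF lin(1) linear_snd] by (simp add: o_def f_def[abs_def])
  moreover have "inj f"
    unfolding linear_injective_0[OF \<open>linear f\<close>]
  proof (intro allI impI)
    fix v assume "f v = 0"
    then have "X' v = 0" using l(2)[of v] linear_0[OF l(1)] by (simp add: prod_eq_iff f_def)
    then show "v = 0" using lin linear_injective_0[OF lin(1)] by blast
  qed
  ultimately have "surj f" by (intro linear_injective_imp_surjective) auto
  then show s: "surj (\<lambda>v. snd (X' v))" by (simp add: f_def[abs_def])
  then obtain v where "w = snd (X' v)" by (rule surjE)
  then show "(lam (fst p))\<^sup>2 * g c (snd p) (snd n) w = - fst n * l w"
    using orth[of v] l(2)[of v] by (simp add: warped_metric_def)
qed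

text \<open>By \<open>tangent_normal\<close> the left-hand side is the inner product of the normal
  with \<open>X2 e\<close>. Up to the Hessian of \<open>\<phi>\<close>, the factor
  \<open>fst (X2 e) - l (snd (X2 e))\<close> is the second derivative of \<open>r - \<phi>\<close>
  along the hypersurface. The term with \<open>deriv lam\<close> collects the radial derivatives of
  the metric, the last one the derivatives of the metric of \<open>N\<close>; the latter is linear
  in \<open>snd (n y)\<close>, hence small together with \<open>l\<close>.\<close>

lemma tangent_second_form:
  fixes X :: "real ^ 'n::finite \<Rightarrow> real \<times> (real ^ 'n)"
  assumes g: "differentiable_metric V (g c)" "snd (X y) \<in> V"
    and T: "smooth_on lam T" "fst (X y) \<in> T" "lam (fst (X y)) > 0"
    and D: "open D" "y \<in> D"
    and X: "\<And>x. x \<in> D \<Longrightarrow> (X has_derivative X' x) (at x)" "inj (X' y)"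
    and X2: "((\<lambda>x. X' x e) has_derivative X2) (at y)"
    and n: "(n has_derivative n') (at y)"
    and orth: "\<And>x v. x \<in> D \<Longrightarrow> warped_metric lam g c (X x) (n x) (X' x v) = 0"
    and l: "linear l" "\<And>v. fst (X' y v) = l (snd (X' y v))"
  shows "fst (n y) * (fst (X2 e) - l (snd (X2 e))) =
    - (e \<bullet> (second_form (warped_metric lam g c) X n y *v e))
    + deriv lam (fst (X y)) / lam (fst (X y)) * fst (n y) *
        (e \<bullet> (first_form (warped_metric lam g c) X y *v e) + (l (snd (X' y e)))\<^sup>2)
    + (lam (fst (X y)))\<^sup>2 *
        (metric_deriv (g c) (snd (X y)) (snd (n y)) (snd (X' y e)) (snd (X' y e)) / 2
          - metric_deriv (g c) (snd (X y)) (snd (X' y e)) (snd (n y)) (snd (X' y e)))"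
proof -
  let ?G = "warped_metric lam g c"
  let ?U = "{r \<in> T. lam r > 0} \<times> V"
  have G: "differentiable_metric ?U ?G" by (rule differentiable_metric_warped[where g = g and c = c, OF g(1) T(1)])
  have XU: "X y \<in> ?U" using g T by (auto simp: mem_Times_iff)
  have form: "inner_product_form (?G (X y))" using G XU by (auto simp: differentiable_metric_def)
  have lX: "linear (X' y)" using X(1)[OF D(2)] by (rule has_derivative_linear)
  note md = metric_deriv_warped[where g = g and c = c, OF g smooth_on_imp_deriv[OF T(1,2)]]
  note nor = tangent_normal(2)[OF lX X(2) l orth[OF D(2)]]
  define r L L' where "r = fst (X y)" and "L = lam r" and "L' = deriv lam r"
  define E where "E = snd (X' y e)"
  have L: "L > 0" using T by (simp add: L_def r_def)
  have h: "e \<bullet> (second_form ?G X n y *v e) = - ?G (X y) (n y) (X2 e) +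
    metric_deriv ?G (X y) (n y) (X' y e) (X' y e) / 2 - metric_deriv ?G (X y) (X' y e) (n y) (X' y e)"
    using second_form_apply[OF G XU D X(1) X2 n orth, where v = e] by (simp add: field_simps)
  have I: "e \<bullet> (first_form ?G X y *v e) = (l E)\<^sup>2 + L\<^sup>2 * g c (snd (X y)) E E"
    unfolding first_form_apply[of ?G, OF form X(1)[OF D(2)]]
    by (simp add: warped_metric_def l(2) E_def L_def r_def power2_eq_square)
  have n1: "L\<^sup>2 * g c (snd (X y)) (snd (n y)) w = - fst (n y) * l w" for w
    using nor[of w] by (simp add: L_def r_def)
  have "?G (X y) (n y) (X2 e) = fst (n y) * (fst (X2 e) - l (snd (X2 e)))"
    using n1[of "snd (X2 e)"] by (simp add: warped_metric_def L_def r_def algebra_simps)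
  moreover have "metric_deriv ?G (X y) (n y) (X' y e) (X' y e) / 2
    = L' / L * fst (n y) * (L\<^sup>2 * g c (snd (X y)) E E)
      + L\<^sup>2 * (metric_deriv (g c) (snd (X y)) (snd (n y)) E E / 2)"
    unfolding md using L by (simp add: L_def L'_def r_def E_def power2_eq_square field_simps)
  moreover have "metric_deriv ?G (X y) (X' y e) (n y) (X' y e)
    = - 2 * (L' / L * fst (n y) * (l E)\<^sup>2) + L\<^sup>2 * metric_deriv (g c) (snd (X y)) E (snd (n y)) E"
  proof -
    have "2 * L * L' * l E * g c (snd (X y)) (snd (n y)) E
        = 2 * (L' / L) * l E * (L\<^sup>2 * g c (snd (X y)) (snd (n y)) E)"
      using L by (simp add: power2_eq_square)
    also have "\<dots> = - 2 * (L' / L * fst (n y) * (l E)\<^sup>2)"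
      unfolding n1 by (simp add: power2_eq_square)
    finally show ?thesis
      unfolding md by (simp add: l(2) L_def L'_def r_def E_def)
  qed
  ultimately show ?thesis
    unfolding h I r_def[symmetric] L_def[symmetric] L'_def[symmetric] E_def[symmetric]
    by (simp add: algebra_simps add_divide_distrib)
qed

text \<open>Only \<open>f' x e\<close> needs a derivative, and only at \<open>y\<close>, so Taylor's
  formula is avoided. On the line through \<open>y\<close> in direction \<open>e\<close>, a negative
  \<open>f2 e\<close> would make the first derivative negative just after \<open>0\<close> and push
  \<open>f\<close> below \<open>f y\<close>.\<close>

lemma local_min_second_derivative:
  fixes f :: "'a::euclidean_space \<Rightarrow> real"
  assumes D: "open D" "y \<in> D"
    and f: "\<And>x. x \<in> D \<Longrightarrow> (f has_derivative f' x) (at x)"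
    and f2: "((\<lambda>x. f' x e) has_derivative f2) (at y)"
    and min: "\<And>x. x \<in> D \<Longrightarrow> f y \<le> f x"
  shows "f' y e = 0" and "f2 e \<ge> 0"
proof -
  obtain d0 where d0: "d0 > 0" "ball y d0 \<subseteq> D" using D by (meson open_contains_ball)
  \<comment> \<open>The summand \<open>1\<close> covers the case \<open>e = 0\<close>.\<close>
  define d where "d = d0 / (norm e + 1)"
  have d: "d > 0" using d0 by (simp add: d_def add_nonneg_pos)
  have inD: "y + t *\<^sub>R e \<in> D" if "\<bar>t\<bar> < d" for t
  proof -
    have "\<bar>t\<bar> * norm e \<le> \<bar>t\<bar> * (norm e + 1)" by (intro mult_left_mono) auto
    also have "\<dots> < d0" using that by (simp add: d_def pos_less_divide_eq add_nonneg_pos)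
    finally show ?thesis using d0 by (auto simp: dist_norm)
  qed
  define w where "w t = f (y + t *\<^sub>R e)" for t
  have line: "((\<lambda>t. y + t *\<^sub>R e) has_derivative (\<lambda>s. s *\<^sub>R e)) (at t)" for t
    by (auto intro!: derivative_eq_intros)
  have w: "(w has_real_derivative f' (y + t *\<^sub>R e) e) (at t)" if "\<bar>t\<bar> < d" for t
  proof -
    note ff = f[OF inD[OF that]]
    have "(w has_derivative (\<lambda>s. f' (y + t *\<^sub>R e) (s *\<^sub>R e))) (at t)"
      using diff_chain_at[OF line, of f, OF ff] by (simp add: o_def w_def[abs_def])
    then show ?thesis
      by (simp add: has_field_derivative_def linear_cmul[OF has_derivative_linear[OF ff]] mult_commute_abs)
  qed
  have w2: "((\<lambda>t. f' (y + t *\<^sub>R e) e) has_real_derivative f2 e) (at 0)"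
  proof -
    have "((\<lambda>t. f' (y + t *\<^sub>R e) e) has_derivative (\<lambda>s. f2 (s *\<^sub>R e))) (at 0)"
      using diff_chain_at[OF line, of "\<lambda>x. f' x e" f2 0] f2 by (simp add: o_def)
    then show ?thesis
      by (simp add: has_field_derivative_def linear_cmul[OF has_derivative_linear[OF f2]] mult_commute_abs)
  qed
  have wmin: "w 0 \<le> w t" if "\<bar>t\<bar> < d" for t
    using min[OF inD[OF that]] by (simp add: w_def)
  show e0: "f' y e = 0"
    using DERIV_local_min[OF w[of 0] d] wmin d by simp
  show "f2 e \<ge> 0"
  proof (rule ccontr)
    assume "\<not> f2 e \<ge> 0"
    then obtain d1 where d1: "d1 > 0" "\<And>h. h > 0 \<Longrightarrow> h < d1 \<Longrightarrow> f' (y + h *\<^sub>R e) e < 0"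
      using DERIV_neg_dec_right[OF w2] e0 by auto
    define t where "t = min d d1 / 2"
    have t: "0 < t" "t < d" "t < d1" using d d1 by (auto simp: t_def)
    have "w t < w 0"
    proof (rule DERIV_neg_imp_decreasing_open[OF t(1)])
      fix s assume "0 < s" "s < t"
      then show "\<exists>z. DERIV w s :> z \<and> z < 0" using w[of s] d1 t by force
      next
      show "continuous_on {0..t} w"
        by (intro DERIV_continuous_on[OF has_field_derivative_at_within[OF w]]) (use t in auto)
    qed
    then show False using wmin[of t] t by simp
  qed
qed

section \<open>Uniform estimates at a touching point\<close>

lemma bilinear_family_bounded:
  fixes b :: "'p::topological_space \<Rightarrow> 'a::euclidean_space \<Rightarrow> 'a \<Rightarrow> real"
  assumes K: "compact K" and b: "\<And>p. p \<in> K \<Longrightarrow> bounded_bilinear (b p)"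
    and cont: "\<And>v w. continuous_on K (\<lambda>p. b p v w)"
  obtains C where "C \<ge> 0" "\<And>p v w. p \<in> K \<Longrightarrow> \<bar>b p v w\<bar> \<le> C * norm v * norm w"
proof -
  have "\<exists>B. \<forall>p\<in>K. \<bar>b p i j\<bar> \<le> B" for i j
    using compact_imp_bounded[OF compact_continuous_image[OF cont K], of i j]
    by (auto simp: bounded_iff)
  then obtain B where B: "\<And>p i j. p \<in> K \<Longrightarrow> \<bar>b p i j\<bar> \<le> B i j" by metis
  define C where "C = (\<Sum>i\<in>Basis. \<Sum>j\<in>Basis. \<bar>B i j\<bar>)"
  have "\<bar>b p v w\<bar> \<le> C * norm v * norm w" if p: "p \<in> K" for p v w
  proof -
    have "\<bar>b p v w\<bar> \<le> (\<Sum>i\<in>Basis. \<Sum>j\<in>Basis. \<bar>(v \<bullet> i) * (w \<bullet> j) * b p i j\<bar>)"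
      unfolding bilinear_expansion[OF b[OF p], of v w]
      by (rule order_trans[OF sum_abs sum_mono[OF sum_abs]])
    also have "\<dots> \<le> (\<Sum>i\<in>Basis. \<Sum>j\<in>Basis. (norm v * norm w) * \<bar>B i j\<bar>)"
    proof (intro sum_mono)
      fix i j :: 'a assume ij: "i \<in> Basis" "j \<in> Basis"
      have "\<bar>v \<bullet> i\<bar> * \<bar>w \<bullet> j\<bar> \<le> norm v * norm w"
        using ij by (intro mult_mono Basis_le_norm) auto
      moreover have "\<bar>b p i j\<bar> \<le> \<bar>B i j\<bar>" using B[OF p, of i j] by simp
      ultimately show "\<bar>(v \<bullet> i) * (w \<bullet> j) * b p i j\<bar> \<le> (norm v * norm w) * \<bar>B i j\<bar>"
        unfolding abs_mult by (rule mult_mono) auto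
    qed
    also have "\<dots> = C * norm v * norm w"
      by (simp only: C_def sum_distrib_left[symmetric]) simp
    finally show ?thesis .
  qed
  moreover have "C \<ge> 0" unfolding C_def by (intro sum_nonneg) auto
  ultimately show ?thesis using that by blast
qed

text \<open>The constant is the minimum of the quadratic forms over the compact set of pairs of a
  point and a unit vector; homogeneity does the rest.\<close>

lemma positive_form_family_bounded_below:
  fixes b :: "'p::topological_space \<Rightarrow> 'a::euclidean_space \<Rightarrow> 'a \<Rightarrow> real"
  assumes K: "compact K" "K \<noteq> {}" and b: "\<And>p. p \<in> K \<Longrightarrow> inner_product_form (b p)"
    and cont: "\<And>v w. continuous_on K (\<lambda>p. b p v w)"
  obtains m where "m > 0" "\<And>p v. p \<in> K \<Longrightarrow> m * (norm v)\<^sup>2 \<le> b p v v"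
proof -
  note bb = inner_product_form_bounded[OF b]
  let ?S = "K \<times> sphere (0::'a) 1"
  have "continuous_on ?S (\<lambda>q. \<Sum>i\<in>Basis. \<Sum>j\<in>Basis. (snd q \<bullet> i) * (snd q \<bullet> j) * b (fst q) i j)"
    by (intro continuous_intros continuous_on_compose2[OF cont]) auto
  then have cb: "continuous_on ?S (\<lambda>q. b (fst q) (snd q) (snd q))"
    by (rule continuous_on_eq) (auto simp: bilinear_expansion[OF bb])
  obtain e :: 'a where "norm e = 1" using vector_choose_size[of 1] by auto
  then have "?S \<noteq> {}" using K by auto
  then obtain q where q: "q \<in> ?S" "\<And>q'. q' \<in> ?S \<Longrightarrow> b (fst q) (snd q) (snd q) \<le> b (fst q') (snd q') (snd q')"
    using continuous_attains_inf[OF compact_Times[OF K(1) compact_sphere] _ cb] by blast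
  define m where "m = b (fst q) (snd q) (snd q)"
  have "m > 0"
    unfolding m_def using q(1) by (intro inner_product_form_pos b) auto
  moreover have "m * (norm v)\<^sup>2 \<le> b p v v" if p: "p \<in> K" for p v
  proof (cases "v = 0")
    case True
    then show ?thesis by (simp add: bounded_bilinear.zero_left[OF bb[OF p]])
  next
    case False
    interpret bounded_bilinear "b p" by (rule bb[OF p])
    have "m \<le> b p (v /\<^sub>R norm v) (v /\<^sub>R norm v)"
      using q(2)[of "(p, v /\<^sub>R norm v)"] p False by (simp add: m_def)
    also have "\<dots> = b p v v / (norm v)\<^sup>2"
      by (simp add: scaleR_left scaleR_right power2_eq_square field_simps)
    finally show ?thesis using False by (simp add: field_simps)
  qed
  ultimately show ?thesis using that by blast
qed

lemma metric_local_bounds: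
  fixes g :: "'a::euclidean_space \<Rightarrow> 'a \<Rightarrow> 'a \<Rightarrow> real"
  assumes V: "open V" and form: "\<And>p. p \<in> V \<Longrightarrow> inner_product_form (g p)"
    and smooth: "\<And>v w. smooth_on (\<lambda>p. g p v w) V" and K: "compact K" "K \<noteq> {}" "K \<subseteq> V"
  obtains C m where "C \<ge> 0" "m > 0" "\<And>p v. p \<in> K \<Longrightarrow> m * (norm v)\<^sup>2 \<le> g p v v"
    "\<And>p v w. p \<in> K \<Longrightarrow> \<bar>g p v w\<bar> \<le> C * norm v * norm w"
    "\<And>p z v w. p \<in> K \<Longrightarrow> \<bar>metric_deriv g p z v w\<bar> \<le> C * norm z * norm v * norm w"
proof -
  have G: "differentiable_metric V g"
    using V form differentiableI[OF smooth_on_has_derivative[OF smooth]]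
    by (auto simp: differentiable_metric_def)
  have cont: "continuous_on K (\<lambda>p. g p v w)" for v w
    using smooth_on_continuous[OF smooth] K(3) by (rule continuous_on_subset)
  have dcont: "continuous_on K (\<lambda>p. metric_deriv g p z v w)" for z v w
    unfolding metric_deriv_def
    using smooth_on_continuous[OF smooth_on_frechet_derivative[OF smooth]] K(3) by (rule continuous_on_subset)
  have KV: "p \<in> V" if "p \<in> K" for p using that K by auto
  obtain m where m: "m > 0" "\<And>p v. p \<in> K \<Longrightarrow> m * (norm v)\<^sup>2 \<le> g p v v"
    using positive_form_family_bounded_below[OF K(1,2) form[OF KV] cont] by blast
  obtain C0 where C0: "C0 \<ge> 0" "\<And>p v w. p \<in> K \<Longrightarrow> \<bar>g p v w\<bar> \<le> C0 * norm v * norm w"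
    using bilinear_family_bounded[OF K(1) inner_product_form_bounded[OF form[OF KV]] cont] by blast
  have "\<exists>C\<ge>0. \<forall>p\<in>K. \<forall>v w. \<bar>metric_deriv g p z v w\<bar> \<le> C * norm v * norm w" for z
  proof -
    obtain C where "C \<ge> 0" "\<And>p v w. p \<in> K \<Longrightarrow> \<bar>metric_deriv g p z v w\<bar> \<le> C * norm v * norm w"
      using bilinear_family_bounded[of K "\<lambda>p. metric_deriv g p z", OF K(1) bounded_bilinear_metric_deriv[OF G KV] dcont]
      by metis
    then show ?thesis by auto
  qed
  then obtain B where B: "\<And>z. B z \<ge> 0"
    "\<And>z p v w. p \<in> K \<Longrightarrow> \<bar>metric_deriv g p z v w\<bar> \<le> B z * norm v * norm w" by metis
  define C1 where "C1 = (\<Sum>k\<in>Basis. B k)"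
  have C1: "C1 \<ge> 0" using B(1) by (auto simp: C1_def intro: sum_nonneg)
  have dg: "\<bar>metric_deriv g p z v w\<bar> \<le> C1 * norm z * norm v * norm w" if p: "p \<in> K" for p z v w
  proof -
    note lin = linear_metric_deriv[OF G KV[OF p]]
    have "metric_deriv g p z v w = metric_deriv g p (\<Sum>k\<in>Basis. (z \<bullet> k) *\<^sub>R k) v w"
      by (simp add: euclidean_representation)
    also have "\<dots> = (\<Sum>k\<in>Basis. (z \<bullet> k) * metric_deriv g p k v w)"
      by (simp add: linear_sum[OF lin] linear_cmul[OF lin])
    finally have "\<bar>metric_deriv g p z v w\<bar> \<le> (\<Sum>k\<in>Basis. \<bar>(z \<bullet> k) * metric_deriv g p k v w\<bar>)"
      by (simp add: sum_abs)
    also have "\<dots> \<le> (\<Sum>k\<in>Basis. norm z * (B k * norm v * norm w))"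
      unfolding abs_mult using B p by (intro sum_mono mult_mono[of "\<bar>_ \<bullet> _\<bar>"] Basis_le_norm) auto
    also have "\<dots> = C1 * norm z * norm v * norm w"
      by (simp only: C1_def sum_distrib_left[symmetric] sum_distrib_right[symmetric]) simp
    finally show ?thesis .
  qed
  show ?thesis
  proof (rule that[of "C0 + C1" m])
    show "C0 + C1 \<ge> 0" using C0 C1 by simp
    show "\<bar>g p v w\<bar> \<le> (C0 + C1) * norm v * norm w" if "p \<in> K" for p v w
      using C0(2)[OF that, of v w] C1 by (simp add: distrib_right add_increasing2)
    show "\<bar>metric_deriv g p z v w\<bar> \<le> (C0 + C1) * norm z * norm v * norm w" if "p \<in> K" for p z v w
      using dg[OF that, of z v w] C0 by (simp add: distrib_right add_increasing)
  qed (use m in auto)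
qed

text \<open>The hypothesis on \<open>H\<close> cancels the leading terms: a multiple of
  \<open>n0 - 1 / n0\<close> remains, and this is \<open>l n\<close> because the normal has length
  one. The other terms are quadratic in \<open>l\<close> or linear in \<open>n\<close>, where
  \<open>norm n\<close> is at most a constant times \<open>n0 * k\<close>. So each bound contains
  \<open>n0\<close>, which cancels, and one factor \<open>k\<close>.\<close>

lemma touching_trace_le:
  fixes g :: "real ^ 'n::finite \<Rightarrow> real ^ 'n \<Rightarrow> real" and E :: "'i::finite \<Rightarrow> real ^ 'n"
  assumes lo: "0 < lo" "lo \<le> lam" "lam \<le> hi" and m: "m > 0" and C: "C \<ge> 0" and L: "\<bar>lam'\<bar> \<le> L"
    and g: "\<And>v. m * (norm v)\<^sup>2 \<le> g v v"
    and dg: "\<And>z v w. \<bar>dg z v w\<bar> \<le> C * norm z * norm v * norm w"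
    and n0: "n0 > 0" and nor: "\<And>w. lam\<^sup>2 * g n w = - n0 * l w" and unit: "n0\<^sup>2 + lam\<^sup>2 * g n n = 1"
    and l: "\<And>v. \<bar>l v\<bar> \<le> k * norm v" and k: "0 \<le> k" "k \<le> 1"
    and frame: "\<And>i. (l (E i))\<^sup>2 + lam\<^sup>2 * g (E i) (E i) = 1"
    and R: "\<And>i. n0 * R i = - H i + lam' / lam * n0 * (1 + (l (E i))\<^sup>2) +
       lam\<^sup>2 * (dg n (E i) (E i) / 2 - dg (E i) n (E i))"
    and H: "real CARD('i) * lam' \<le> (\<Sum>i\<in>UNIV. H i) * lam * n0"
  shows "lo\<^sup>2 * m * (norm (E i))\<^sup>2 \<le> 1"
    and "(\<Sum>i\<in>UNIV. R i) \<le>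
      real CARD('i) * (2 * (L / lo) / (lo\<^sup>2 * m) + 3 / 2 * hi\<^sup>2 * C / (lo\<^sup>2 * m)\<^sup>2) * k"
proof -
  define e2 where "e2 = 1 / (lo\<^sup>2 * m)"
  have e2: "e2 > 0" using lo m by (simp add: e2_def)
  have lam: "lam > 0" using lo by simp
  have lam2: "lo\<^sup>2 \<le> lam\<^sup>2" "lam\<^sup>2 \<le> hi\<^sup>2" using lo lam by (auto intro!: power_mono)
  have L0: "L \<ge> 0" using L by linarith
  have lowg: "lo\<^sup>2 * m * (norm v)\<^sup>2 \<le> lam\<^sup>2 * g v v" for v
  proof -
    have "lo\<^sup>2 * (m * (norm v)\<^sup>2) \<le> lam\<^sup>2 * g v v"
      using lam2 g[of v] m by (intro mult_mono) auto
    then show ?thesis by simp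
  qed
  show E1: "lo\<^sup>2 * m * (norm (E i))\<^sup>2 \<le> 1" for i
    using lowg[of "E i"] frame[of i] by (smt (verit) zero_le_power2)
  have E2: "(norm (E i))\<^sup>2 \<le> e2" for i
    using E1[of i] lo m by (simp add: e2_def field_simps)
  have n2: "norm n \<le> n0 * k * e2"
  proof (cases "n = 0")
    case False
    have "lo\<^sup>2 * m * (norm n)\<^sup>2 \<le> - n0 * l n" using lowg[of n] nor[of n] by simp
    also have "\<dots> \<le> n0 * (k * norm n)" using l[of n] n0 by (smt (verit) mult_left_mono mult_minus_left mult_minus_right)
    finally have "(lo\<^sup>2 * m * norm n) * norm n \<le> (n0 * k) * norm n" by (simp add: power2_eq_square)
    then have "lo\<^sup>2 * m * norm n \<le> n0 * k" using False by simp
    then show ?thesis using lo m by (simp add: e2_def field_simps)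
  qed (use n0 k e2 in auto)
  \<comment> \<open>One of the two factors \<open>k\<close> is traded for \<open>1\<close>, since
    the final estimate is to be linear in \<open>k\<close>.\<close>
  have l2: "(l (E i))\<^sup>2 \<le> k * e2" for i
  proof -
    have "\<bar>l (E i)\<bar>\<^sup>2 \<le> (k * norm (E i))\<^sup>2" by (intro power_mono l) auto
    also have "\<dots> = k * (k * (norm (E i))\<^sup>2)" by (simp add: power2_eq_square)
    also have "\<dots> \<le> k * (1 * e2)" using k E2[of i] by (intro mult_left_mono mult_mono) auto
    finally show ?thesis by simp
  qed
  \<comment> \<open>The factor \<open>3 / 2\<close> is \<open>1 / 2 + 1\<close>, one summand for
    each of the two derivatives of the metric.\<close>
  have T: "lam\<^sup>2 * (dg n (E i) (E i) / 2 - dg (E i) n (E i)) \<le> n0 * (3 / 2 * hi\<^sup>2 * C * e2\<^sup>2 * k)" for i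
  proof -
    have "\<bar>dg n (E i) (E i)\<bar> \<le> C * norm n * (norm (E i))\<^sup>2" "\<bar>dg (E i) n (E i)\<bar> \<le> C * norm n * (norm (E i))\<^sup>2"
      using dg[of n "E i" "E i"] dg[of "E i" n "E i"] by (simp_all add: power2_eq_square ac_simps)
    then have "dg n (E i) (E i) / 2 - dg (E i) n (E i) \<le> 3 / 2 * (C * norm n * (norm (E i))\<^sup>2)" by linarith
    also have "\<dots> \<le> 3 / 2 * (C * (n0 * k * e2) * e2)"
      using n2 E2[of i] C e2 k n0 by (intro mult_left_mono mult_mono) auto
    finally have "lam\<^sup>2 * (dg n (E i) (E i) / 2 - dg (E i) n (E i)) \<le> lam\<^sup>2 * (3 / 2 * (C * (n0 * k * e2) * e2))"
      by (intro mult_left_mono) auto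
    also have "\<dots> \<le> hi\<^sup>2 * (3 / 2 * (C * (n0 * k * e2) * e2))"
      using lam2 C n0 k e2 by (intro mult_right_mono) auto
    finally show ?thesis by (simp add: power2_eq_square ac_simps)
  qed
  have q: "\<bar>lam' / lam\<bar> \<le> L / lo"
    unfolding abs_divide using L lo lam by (intro frac_le) auto
  have H': "- (\<Sum>i\<in>UNIV. H i) \<le> - (real CARD('i) * (lam' / (lam * n0)))"
    using H lam n0 by (simp add: field_simps)
  have ln: "\<bar>l n\<bar> \<le> n0 * (k * e2)"
  proof -
    have "\<bar>l n\<bar> \<le> 1 * norm n" using l[of n] k by (meson mult_right_mono norm_ge_zero order_trans)
    then show ?thesis using n2 by simp
  qed
  have un: "n0 - 1 / n0 = l n"
  proof -
    have "n0\<^sup>2 - 1 = n0 * l n" using unit nor[of n] by simp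
    then show ?thesis using n0 by (simp add: field_simps power2_eq_square)
  qed
  have "n0 * (\<Sum>i\<in>UNIV. R i) = - (\<Sum>i\<in>UNIV. H i) + real CARD('i) * (lam' / lam * n0)
      + (\<Sum>i\<in>UNIV. lam' / lam * n0 * (l (E i))\<^sup>2 + lam\<^sup>2 * (dg n (E i) (E i) / 2 - dg (E i) n (E i)))"
    by (simp add: sum_distrib_left R sum.distrib sum_subtractf sum_negf distrib_left)
  also have "\<dots> \<le> real CARD('i) * (lam' / lam) * l n
      + (\<Sum>i\<in>(UNIV :: 'i set). n0 * (L / lo * e2 * k) + n0 * (3 / 2 * hi\<^sup>2 * C * e2\<^sup>2 * k))"
  proof (intro add_mono sum_mono T)
    have "- (\<Sum>i\<in>UNIV. H i) + real CARD('i) * (lam' / lam * n0)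
        \<le> - (real CARD('i) * (lam' / (lam * n0))) + real CARD('i) * (lam' / lam * n0)"
      using H' by simp
    also have "\<dots> = real CARD('i) * (lam' / lam) * (n0 - 1 / n0)"
      by (simp add: right_diff_distrib)
    finally show "- (\<Sum>i\<in>UNIV. H i) + real CARD('i) * (lam' / lam * n0) \<le> real CARD('i) * (lam' / lam) * l n"
      unfolding un .
    fix i
    have "lam' / lam * n0 * (l (E i))\<^sup>2 \<le> L / lo * n0 * (k * e2)"
      using abs_le_D1[OF q] l2[of i] n0 L0 lo by (intro mult_mono) auto
    then show "lam' / lam * n0 * (l (E i))\<^sup>2 \<le> n0 * (L / lo * e2 * k)" by (simp add: ac_simps)
  qed
  \<comment> \<open>The term \<open>l n\<close> yields the same bound as the terms
    \<open>(l (E i))\<^sup>2\<close>; this accounts for the \<open>2\<close> in front of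
    \<open>L / lo\<close>.\<close>
  also have "\<dots> \<le> real CARD('i) * (n0 * (L / lo * e2 * k))
      + (\<Sum>i\<in>(UNIV :: 'i set). n0 * (L / lo * e2 * k) + n0 * (3 / 2 * hi\<^sup>2 * C * e2\<^sup>2 * k))"
  proof -
    have "(lam' / lam) * l n \<le> \<bar>lam' / lam\<bar> * \<bar>l n\<bar>" by (metis abs_ge_self abs_mult)
    also have "\<dots> \<le> (L / lo) * (n0 * (k * e2))"
      using q ln L0 lo by (intro mult_mono) auto
    finally have "real CARD('i) * ((lam' / lam) * l n) \<le> real CARD('i) * (n0 * (L / lo * e2 * k))"
      by (intro mult_left_mono) (auto simp: ac_simps)
    then show ?thesis by (simp add: mult.assoc)
  qed
  also have "\<dots> = n0 * (real CARD('i) * (2 * (L / lo) * e2 + 3 / 2 * hi\<^sup>2 * C * e2\<^sup>2) * k)"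
    by (simp add: algebra_simps)
  finally have "(\<Sum>i\<in>UNIV. R i) \<le> real CARD('i) * (2 * (L / lo) * e2 + 3 / 2 * hi\<^sup>2 * C * e2\<^sup>2) * k"
    using n0 by simp
  then show "(\<Sum>i\<in>UNIV. R i) \<le>
      real CARD('i) * (2 * (L / lo) / (lo\<^sup>2 * m) + 3 / 2 * hi\<^sup>2 * C / (lo\<^sup>2 * m)\<^sup>2) * k"
    by (simp add: e2_def power_divide)
qed

text \<open>Expanding \<open>Y w\<close> in the images of the frame, Cauchy-Schwarz gives
  \<open>|Y w|^4 \<le> b w w * \<Sum> (Y w \<bullet> Y e_i)^2\<close>. It serves to bound from below
  the trace of the rank-one part of the barrier's Hessian, the part with the factor
  \<open>\<alpha>^2\<close>.\<close>

lemma frame_coordinates_ge: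
  fixes b :: "real ^ 'n::finite \<Rightarrow> real ^ 'n \<Rightarrow> real" and e :: "'n \<Rightarrow> real ^ 'n"
    and Y :: "real ^ 'n \<Rightarrow> 'a::real_inner"
  assumes b: "inner_product_form b" and e: "\<And>i j. b (e i) (e j) = (if i = j then 1 else 0)"
    and Y: "linear Y" and le: "b w w \<le> B * (norm (Y w))\<^sup>2"
  shows "(norm (Y w))\<^sup>2 \<le> B * (\<Sum>i\<in>UNIV. (Y w \<bullet> Y (e i))\<^sup>2)"
proof (cases "Y w = 0")
  case False
  let ?c = "\<lambda>i. b w (e i)" and ?y = "\<lambda>i. Y w \<bullet> Y (e i)"
  note ex = orthonormal_frame_expansion[OF b e, of w]
  have "Y w = (\<Sum>i\<in>UNIV. ?c i *\<^sub>R Y (e i))"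
    by (subst ex(1)) (simp add: linear_sum[OF Y] linear_cmul[OF Y])
  then have "(norm (Y w))\<^sup>2 = Y w \<bullet> (\<Sum>i\<in>UNIV. ?c i *\<^sub>R Y (e i))"
    by (simp add: power2_norm_eq_inner)
  also have "\<dots> = (\<Sum>i\<in>UNIV. ?c i * ?y i)" by (simp add: inner_sum_right)
  finally have "((norm (Y w))\<^sup>2)\<^sup>2 \<le> (\<Sum>i\<in>UNIV. (?c i)\<^sup>2) * (\<Sum>i\<in>UNIV. (?y i)\<^sup>2)"
    by (simp only: Cauchy_Schwarz_ineq_sum)
  also have "\<dots> \<le> (B * (norm (Y w))\<^sup>2) * (\<Sum>i\<in>UNIV. (?y i)\<^sup>2)"
    using le ex(2) by (intro mult_right_mono) (auto intro: sum_nonneg)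
  finally have "(norm (Y w))\<^sup>2 * (norm (Y w))\<^sup>2 \<le> (norm (Y w))\<^sup>2 * (B * (\<Sum>i\<in>UNIV. (?y i)\<^sup>2))"
    by (simp add: power2_eq_square ac_simps)
  moreover have "(norm (Y w))\<^sup>2 > 0" using False by simp
  ultimately show ?thesis by (simp only: mult_le_cancel_left_pos)
qed (simp add: sum_nonneg)

lemma inner_product_form_pullback:
  fixes f :: "'a::euclidean_space \<Rightarrow> 'b::euclidean_space"
  assumes b: "inner_product_form b" and f: "linear f" "inj f"
  shows "inner_product_form (\<lambda>v w. b (f v) (f w))"
proof -
  interpret bounded_bilinear b by (rule inner_product_form_bounded[OF b])
  have "bilinear (\<lambda>v w. b (f v) (f w))"
    unfolding bilinear_def
    by (auto intro!: linearI simp: linear_add[OF f(1)] linear_cmul[OF f(1)]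
        add_left add_right scaleR_left scaleR_right)
  moreover have "b (f v) (f v) > 0" if "v \<noteq> 0" for v
    using that f linear_injective_0[OF f(1)] by (intro inner_product_form_pos[OF b]) auto
  ultimately show ?thesis
    using inner_product_form_sym[OF b] by (auto simp: inner_product_form_def)
qed

text \<open>The second derivative test, traced over an orthonormal frame of the induced metric and
  combined with \<open>touching_trace_le\<close>, has the factor \<open>2 * \<alpha> * q\<close> on
  both sides. After division \<open>\<alpha>\<close> occurs on the left only, so the estimate is
  contradictory for large \<open>\<alpha>\<close> when \<open>norm d\<close> is confined between
  positive bounds.\<close>

lemma touching_estimate:
  fixes X :: "real ^ 'n::finite \<Rightarrow> real \<times> (real ^ 'n)" and kap :: "'n \<Rightarrow> real"
  assumes g: "differentiable_metric V (g c)" "snd (X y) \<in> V"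
    and T: "smooth_on lam T" "fst (X y) \<in> T" "lam (fst (X y)) > 0"
    and D: "open D" "y \<in> D"
    and X: "\<And>x. x \<in> D \<Longrightarrow> (X has_derivative X' x) (at x)" "inj (X' y)"
    and X2: "\<And>e. ((\<lambda>x. X' x e) has_derivative X2 e) (at y)"
    and n: "(n has_derivative n') (at y)"
    and orth: "\<And>x v. x \<in> D \<Longrightarrow> warped_metric lam g c (X x) (n x) (X' x v) = 0"
    and unit: "warped_metric lam g c (X y) (n y) (n y) = 1" and n0: "fst (n y) > 0"
    and l: "linear l" "\<And>v. fst (X' y v) = l (snd (X' y v))"
    and char: "\<And>t. det (second_form (warped_metric lam g c) X n y - t *\<^sub>R first_form (warped_metric lam g c) X y)
       = det (first_form (warped_metric lam g c) X y) * (\<Prod>i\<in>UNIV. kap i - t)"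
    and mean: "real CARD('n) * deriv lam (fst (X y)) \<le> (\<Sum>i\<in>UNIV. kap i) * lam (fst (X y)) * fst (n y)"
    and lo: "0 < lo" "lo \<le> lam (fst (X y))" "lam (fst (X y)) \<le> hi"
    and L: "\<bar>deriv lam (fst (X y))\<bar> \<le> L" and m: "m > 0" and C: "C \<ge> 0"
    and gm: "\<And>v. m * (norm v)\<^sup>2 \<le> g c (snd (X y)) v v"
    and gC: "\<And>v w. \<bar>g c (snd (X y)) v w\<bar> \<le> C * norm v * norm w"
    and dg: "\<And>z v w. \<bar>metric_deriv (g c) (snd (X y)) z v w\<bar> \<le> C * norm z * norm v * norm w"
    and pos: "\<alpha> > 0" "q > 0"
    and k: "2 * \<alpha> * q * norm d \<le> 1" "\<And>v. \<bar>l v\<bar> \<le> 2 * \<alpha> * q * norm d * norm v"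
    and second: "\<And>e. q * (4 * \<alpha>\<^sup>2 * (d \<bullet> snd (X' y e))\<^sup>2 - 2 * \<alpha> * (norm (snd (X' y e)))\<^sup>2)
       \<le> fst (X2 e e) - l (snd (X2 e e))"
  shows "2 * \<alpha> * (norm d)\<^sup>2 / (1 + hi\<^sup>2 * C) \<le> real CARD('n) / (lo\<^sup>2 * m) +
     real CARD('n) * (2 * (L / lo) / (lo\<^sup>2 * m) + 3 / 2 * hi\<^sup>2 * C / (lo\<^sup>2 * m)\<^sup>2) * norm d"
proof -
  let ?G = "warped_metric lam g c"
  define p where "p = X y"
  define lm where "lm = lam (fst p)"
  define b where "b v w = ?G p (X' y v) (X' y w)" for v w
  define Y where "Y v = snd (X' y v)" for v
  have "inner_product_form (g c (snd p))" using g by (auto simp: differentiable_metric_def p_def)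
  then have form: "inner_product_form (?G p)"
    using T(3) by (intro inner_product_form_warped) (auto simp: p_def)
  have lX: "linear (X' y)" using X(1)[OF D(2)] by (rule has_derivative_linear)
  have lY: "linear Y" using linear_compose[OF lX linear_snd] by (simp add: o_def Y_def[abs_def])
  have b: "inner_product_form b"
    unfolding b_def[abs_def] by (rule inner_product_form_pullback[OF form lX X(2)])
  have bY: "b v v = (l (Y v))\<^sup>2 + lm\<^sup>2 * g c (snd p) (Y v) (Y v)" for v
    by (simp add: b_def warped_metric_def l(2) Y_def lm_def power2_eq_square)
  obtain e where e: "\<And>i j :: 'n. b (e i) (e j) = (if i = j then 1 else 0)"
    using orthonormal_frame_exists[OF b] by blast
  have I: "v \<bullet> (first_form ?G X y *v w) = b v w" for v w
    using first_form_apply[of ?G X y, OF form[unfolded p_def] X(1)[OF D(2)], of v w] by (simp add: b_def p_def)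
  define R where "R i = fst (X2 (e i) (e i)) - l (snd (X2 (e i) (e i)))" for i
  define H where "H i = e i \<bullet> (second_form ?G X n y *v e i)" for i
  have sumH: "(\<Sum>i\<in>UNIV. H i) = (\<Sum>i\<in>UNIV. kap i)"
    unfolding H_def by (rule trace_second_form_eq[OF char]) (simp add: I e)
  have R: "fst (n y) * R i = - H i + deriv lam (fst p) / lm * fst (n y) * (1 + (l (Y (e i)))\<^sup>2) +
       lm\<^sup>2 * (metric_deriv (g c) (snd p) (snd (n y)) (Y (e i)) (Y (e i)) / 2
         - metric_deriv (g c) (snd p) (Y (e i)) (snd (n y)) (Y (e i)))" for i
    using tangent_second_form[where g = g and c = c, OF g T D X X2 n orth l, of "e i"]
    by (simp add: R_def H_def I e Y_def lm_def p_def)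
  have nor: "lm\<^sup>2 * g c (snd p) (snd (n y)) w = - fst (n y) * l w" for w
    using tangent_normal(2)[OF lX X(2) l orth[OF D(2)], of w] by (simp add: lm_def p_def)
  have sur: "surj Y"
    using tangent_normal(1)[OF lX X(2) l orth[OF D(2)]] by (simp add: Y_def[abs_def])
  have un: "(fst (n y))\<^sup>2 + lm\<^sup>2 * g c (snd p) (snd (n y)) (snd (n y)) = 1"
    using unit by (simp add: warped_metric_def lm_def p_def power2_eq_square)
  have fr: "(l (Y (e i)))\<^sup>2 + lm\<^sup>2 * g c (snd p) (Y (e i)) (Y (e i)) = 1" for i
    using bY[of "e i"] e[of i i] by simp
  define kk where "kk = 2 * \<alpha> * q * norm d"
  have kk: "0 \<le> kk" "kk \<le> 1" using k pos by (auto simp: kk_def)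
  have lk: "\<bar>l v\<bar> \<le> kk * norm v" for v using k by (simp add: kk_def)
  have lo': "lo \<le> lm" "lm \<le> hi" using lo by (auto simp: lm_def p_def)
  have H': "real CARD('n) * deriv lam (fst p) \<le> (\<Sum>i\<in>UNIV. H i) * lm * fst (n y)"
    using mean by (simp add: sumH lm_def p_def)
  note tt = touching_trace_le[OF lo(1) lo' m C L[folded p_def] gm[folded p_def] dg[folded p_def] n0
      nor un lk kk fr R H']
  \<comment> \<open>\<open>B\<close> compares the induced metric with the Euclidean norm on the
    tangent vector over \<open>d\<close>: \<open>1\<close> comes from the radial part, where the
    slope is at most \<open>1\<close>, and \<open>hi\<^sup>2 * C\<close> from the part along
    \<open>N\<close>.\<close>
  define B where "B = 1 + hi\<^sup>2 * C"
  have B: "B > 0" using C by (simp add: B_def add_pos_nonneg)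
  \<comment> \<open>The direction \<open>d\<close> of the barrier's gradient is a vector of the
    chart; surjectivity lifts it to a tangent vector.\<close>
  obtain w where w: "d = Y w" using sur by (rule surjE)
  have "b w w \<le> B * (norm (Y w))\<^sup>2"
  proof -
    have "\<bar>l d\<bar> \<le> 1 * norm d" using lk[of d] kk by (meson mult_right_mono norm_ge_zero order_trans)
    then have "(l d)\<^sup>2 \<le> (norm d)\<^sup>2" by (simp add: abs_le_square_iff[symmetric])
    moreover have "lm\<^sup>2 * g c (snd p) d d \<le> hi\<^sup>2 * (C * (norm d)\<^sup>2)"
    proof (rule mult_mono)
      show "lm\<^sup>2 \<le> hi\<^sup>2" using lo lo' by (intro power_mono) auto
      show "g c (snd p) d d \<le> C * (norm d)\<^sup>2"
        using abs_le_D1[OF gC[of d d]] by (simp add: p_def power2_eq_square ac_simps)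
      have "0 \<le> m * (norm d)\<^sup>2" using m by simp
      also have "\<dots> \<le> g c (snd p) d d" using gm[of d] by (simp add: p_def)
      finally show "0 \<le> g c (snd p) d d" .
    qed simp
    ultimately show ?thesis unfolding bY w[symmetric] by (simp add: B_def algebra_simps)
  qed
  then have low: "(norm d)\<^sup>2 \<le> B * (\<Sum>i\<in>UNIV. (d \<bullet> Y (e i))\<^sup>2)"
    unfolding w by (rule frame_coordinates_ge[OF b e lY])
  define A where "A = lo\<^sup>2 * m"
  have A: "A > 0" using lo m by (simp add: A_def)
  have "(norm (Y (e i)))\<^sup>2 \<le> 1 / A" for i
    using tt(1)[of i] A by (simp add: A_def field_simps)
  then have up: "(\<Sum>i\<in>UNIV. (norm (Y (e i)))\<^sup>2) \<le> real CARD('n) / A"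
    using sum_bounded_above[of UNIV "\<lambda>i. (norm (Y (e i)))\<^sup>2" "1 / A"] by simp
  have "q * (4 * \<alpha>\<^sup>2 * (\<Sum>i\<in>UNIV. (d \<bullet> Y (e i))\<^sup>2) - 2 * \<alpha> * (\<Sum>i\<in>UNIV. (norm (Y (e i)))\<^sup>2))
      = (\<Sum>i\<in>UNIV. q * (4 * \<alpha>\<^sup>2 * (d \<bullet> Y (e i))\<^sup>2 - 2 * \<alpha> * (norm (Y (e i)))\<^sup>2))"
    by (simp add: sum_distrib_left sum_subtractf right_diff_distrib)
  also have "\<dots> \<le> (\<Sum>i\<in>UNIV. R i)"
    using second by (intro sum_mono) (simp add: R_def Y_def)
  finally have "q * (4 * \<alpha>\<^sup>2 * (\<Sum>i\<in>UNIV. (d \<bullet> Y (e i))\<^sup>2) - 2 * \<alpha> * (\<Sum>i\<in>UNIV. (norm (Y (e i)))\<^sup>2))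
     \<le> real CARD('n) * (2 * (L / lo) / A + 3 / 2 * hi\<^sup>2 * C / A\<^sup>2) * kk"
    using tt(2) unfolding A_def by linarith
  moreover have "q * (4 * \<alpha>\<^sup>2 * ((norm d)\<^sup>2 / B) - 2 * \<alpha> * (real CARD('n) / A))
      \<le> q * (4 * \<alpha>\<^sup>2 * (\<Sum>i\<in>UNIV. (d \<bullet> Y (e i))\<^sup>2) - 2 * \<alpha> * (\<Sum>i\<in>UNIV. (norm (Y (e i)))\<^sup>2))"
  proof (intro mult_left_mono diff_mono)
    show "(norm d)\<^sup>2 / B \<le> (\<Sum>i\<in>UNIV. (d \<bullet> Y (e i))\<^sup>2)"
      using low B by (simp add: pos_divide_le_eq mult.commute)
  qed (use up pos in auto)
  ultimately have "q * (4 * \<alpha>\<^sup>2 * ((norm d)\<^sup>2 / B) - 2 * \<alpha> * (real CARD('n) / A))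
     \<le> real CARD('n) * (2 * (L / lo) / A + 3 / 2 * hi\<^sup>2 * C / A\<^sup>2) * kk" by (rule order_trans[rotated])
  then have "(2 * \<alpha> * q) * (2 * \<alpha> * (norm d)\<^sup>2 / B - real CARD('n) / A)
     \<le> (2 * \<alpha> * q) * (real CARD('n) * (2 * (L / lo) / A + 3 / 2 * hi\<^sup>2 * C / A\<^sup>2) * norm d)"
    by (simp add: kk_def power2_eq_square algebra_simps)
  moreover have "2 * \<alpha> * q > 0" using pos by simp
  ultimately have "2 * \<alpha> * (norm d)\<^sup>2 / B - real CARD('n) / A
     \<le> real CARD('n) * (2 * (L / lo) / A + 3 / 2 * hi\<^sup>2 * C / A\<^sup>2) * norm d"
    by (simp only: mult_le_cancel_left_pos)
  then show ?thesis unfolding A_def B_def by linarith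
qed

text \<open>Equality case of the triangle inequality, read off from the parallelogram law.\<close>

lemma norm_add_eq_double:
  fixes a b :: "'a::real_inner"
  assumes "norm a \<le> R" "norm b \<le> R" "2 * R \<le> norm (a + b)"
  shows "a = b"
proof -
  have R: "0 \<le> R" using assms(1) norm_ge_zero order_trans by blast
  have "(norm (a + b))\<^sup>2 + (norm (a - b))\<^sup>2 = 2 * (norm a)\<^sup>2 + 2 * (norm b)\<^sup>2"
    by (simp add: power2_norm_eq_inner inner_add_left inner_add_right inner_diff_left inner_diff_right inner_commute)
  moreover have "(norm a)\<^sup>2 \<le> R\<^sup>2" "(norm b)\<^sup>2 \<le> R\<^sup>2" using assms by (auto intro: power_mono)
  moreover have "(2 * R)\<^sup>2 \<le> (norm (a + b))\<^sup>2" using assms R by (intro power_mono) auto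
  moreover have "(2 * R)\<^sup>2 = 4 * R\<^sup>2" by (simp add: power2_eq_square)
  ultimately have "(norm (a - b))\<^sup>2 \<le> 0" by linarith
  then show ?thesis by simp
qed

text \<open>Let \<open>z1\<close> be a minimum point nearest to \<open>y\<close>. The ball around
  \<open>y\<close> through \<open>z1\<close> has no minimum point in its interior, but possibly
  several on its boundary. The ball of half the radius around the midpoint of \<open>y\<close> and
  \<open>z1\<close> meets that boundary in \<open>z1\<close> only.\<close>

lemma interior_ball_at_minimum_set:
  fixes f :: "'a::euclidean_space \<Rightarrow> real"
  assumes cont: "continuous_on (ball z0 (4 * s)) f" and s: "s > 0"
    and f0: "f z0 = m0" and min: "\<And>z. z \<in> ball z0 (4 * s) \<Longrightarrow> m0 \<le> f z"
    and y: "y \<in> ball z0 s" "f y \<noteq> m0"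
  obtains y1 z1 R where "0 < R" "R < s" "z1 \<in> ball z0 (2 * s)" "f z1 = m0" "dist y1 z1 = R"
    "\<And>z. z \<in> cball y1 R \<Longrightarrow> z \<noteq> z1 \<Longrightarrow> z \<in> ball z0 (4 * s) \<and> m0 < f z"
proof -
  \<comment> \<open>Radius \<open>2 * s\<close> suffices: \<open>y\<close> lies within
    \<open>s\<close> of \<open>z0\<close>, so its nearest minimum point lies within \<open>s\<close>
    of \<open>y\<close>, and the ball constructed below stays within \<open>2 * s\<close> of
    \<open>z0\<close>.\<close>
  let ?Z = "{z \<in> cball z0 (2 * s). f z = m0}"
  have sub: "cball z0 (2 * s) \<subseteq> ball z0 (4 * s)" using s by auto
  have "compact ?Z"
  proof -
    have "closed (cball z0 (2 * s) \<inter> f -` {m0})"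
      by (rule continuous_closed_preimage[OF continuous_on_subset[OF cont sub]]) auto
    moreover have "?Z = cball z0 (2 * s) \<inter> f -` {m0}" by auto
    ultimately show ?thesis by (simp add: compact_eq_bounded_closed bounded_Int)
  qed
  moreover have "z0 \<in> ?Z" using s f0 by simp
  ultimately obtain z1 where z1: "z1 \<in> ?Z" "\<And>z. z \<in> ?Z \<Longrightarrow> dist y z1 \<le> dist y z"
    using continuous_attains_inf[of ?Z "dist y", OF _ _ continuous_on_dist[OF continuous_on_const continuous_on_id]]
    by blast
  define R where "R = dist y z1 / 2"
  define y1 where "y1 = midpoint y z1"
  have ne: "y \<noteq> z1" using y z1 by auto
  have dyz0: "dist y z0 < s" using y by (simp add: dist_commute)
  have dy: "2 * R \<le> dist y z0" using z1(2)[OF \<open>z0 \<in> ?Z\<close>] by (simp add: R_def)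
  have d1: "dist y1 z1 = R" "dist y1 y = R"
    by (simp_all add: y1_def R_def dist_midpoint)
  show ?thesis
  proof (rule that)
    show "0 < R" using ne by (simp add: R_def)
    show "R < s" using dy dyz0 \<open>0 < R\<close> by linarith
    have "dist z1 z0 \<le> dist y z1 + dist y z0" by (metis dist_commute dist_triangle)
    then show "z1 \<in> ball z0 (2 * s)" using dy dyz0 by (simp add: R_def dist_commute)
    show "f z1 = m0" using z1 by simp
    show "dist y1 z1 = R" by (rule d1)
    fix z assume z: "z \<in> cball y1 R" "z \<noteq> z1"
    have "dist z y \<le> 2 * R" using z d1 dist_triangle[of z y y1] by (simp add: dist_commute)
    then have dz: "dist z0 z < 2 * s"
      using dy dyz0 dist_triangle[of z0 z y] by (simp add: dist_commute)
    then have zin: "z \<in> ball z0 (4 * s)" using s by simp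
    moreover have "f z \<noteq> m0"
    proof
      assume "f z = m0"
      \<comment> \<open>The distance from \<open>y\<close> to the minimum set is
        \<open>2 * R\<close>, whereas \<open>z\<close> and \<open>y\<close> both lie within
        \<open>R\<close> of \<open>y1\<close>. Equality must hold, which makes \<open>y1\<close>
        their midpoint.\<close>
      then have "2 * R \<le> dist y z" using z1(2)[of z] dz by (simp add: R_def)
      moreover have "norm (z - y1) \<le> R" "norm (y1 - y) \<le> R"
        using z d1 by (simp_all add: dist_norm norm_minus_commute)
      ultimately have "z - y1 = y1 - y"
        by (intro norm_add_eq_double[of _ R]) (auto simp: dist_norm norm_minus_commute)
      then have "z = 2 *\<^sub>R y1 - y" by (simp add: algebra_simps scaleR_2)
      also have "\<dots> = z1" by (simp add: y1_def midpoint_def scaleR_right_distrib)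
      finally show False using z by simp
    qed
    ultimately show "z \<in> ball z0 (4 * s) \<and> m0 < f z" using min[OF zin] by force
  qed
qed

text \<open>The barrier \<open>h\<close> is \<open>1\<close> at \<open>z1\<close> and at most
  \<open>1\<close> outside \<open>cball y1 R\<close>; on the part of the sphere around
  \<open>z1\<close> inside that ball, \<open>f\<close> exceeds \<open>m0\<close> by a fixed amount.
  For small \<open>\<delta>\<close> the value \<open>m0 - \<delta>\<close> of
  \<open>f - \<delta> h\<close> at \<open>z1\<close> is therefore not undercut on the sphere. The
  cap \<open>b\<close> leaves room to make the gradient of the barrier small.\<close>

lemma hopf_barrier_touches:
  fixes f :: "'a::euclidean_space \<Rightarrow> real"
  assumes cont: "continuous_on (cball z1 t) f" and t: "t > 0" and R: "dist y1 z1 = R" "0 < R"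
    and min: "\<And>z. z \<in> cball z1 t \<Longrightarrow> m0 \<le> f z" and z1: "f z1 = m0"
    and inner: "\<And>z. z \<in> cball y1 R \<Longrightarrow> z \<in> cball z1 t \<Longrightarrow> z \<noteq> z1 \<Longrightarrow> m0 < f z"
    and pos: "\<alpha> > 0" "b > 0"
  obtains \<delta> p where "\<delta> > 0" "\<delta> \<le> b" "p \<in> ball z1 t"
    "\<And>z. z \<in> cball z1 t \<Longrightarrow> f p - \<delta> * exp (\<alpha> * (R\<^sup>2 - (norm (p - y1))\<^sup>2))
       \<le> f z - \<delta> * exp (\<alpha> * (R\<^sup>2 - (norm (z - y1))\<^sup>2))"
proof -
  let ?h = "\<lambda>z. exp (\<alpha> * (R\<^sup>2 - (norm (z - y1))\<^sup>2))"
  let ?S = "sphere z1 t \<inter> cball y1 R"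
  obtain \<epsilon> where e: "\<epsilon> > 0" "\<And>z. z \<in> ?S \<Longrightarrow> \<epsilon> \<le> f z - m0"
  proof (cases "?S = {}")
    case True
    then show ?thesis using that[of 1] by auto
  next
    case False
    have "compact ?S" by (intro compact_Int_closed compact_sphere) auto
    moreover have "continuous_on ?S f" by (rule continuous_on_subset[OF cont]) auto
    ultimately obtain q where q: "q \<in> ?S" "\<And>z. z \<in> ?S \<Longrightarrow> f q \<le> f z"
      using continuous_attains_inf[OF _ False] by metis
    then have "m0 < f q" using inner[of q] t by auto
    then show ?thesis using that[of "f q - m0"] q by auto
  qed
  define \<delta> where "\<delta> = min b (\<epsilon> / exp (\<alpha> * R\<^sup>2))"
  have d: "\<delta> > 0" "\<delta> \<le> b" "\<delta> * exp (\<alpha> * R\<^sup>2) \<le> \<epsilon>"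
  proof -
    show "\<delta> > 0" "\<delta> \<le> b" using e pos by (auto simp: \<delta>_def)
    have "\<delta> \<le> \<epsilon> / exp (\<alpha> * R\<^sup>2)" by (simp add: \<delta>_def)
    then show "\<delta> * exp (\<alpha> * R\<^sup>2) \<le> \<epsilon>" by (simp add: pos_le_divide_eq)
  qed
  have bd: "m0 - \<delta> \<le> f z - \<delta> * ?h z" if z: "z \<in> sphere z1 t" for z
  proof (cases "z \<in> cball y1 R")
    case True
    have "\<delta> * ?h z \<le> \<delta> * exp (\<alpha> * R\<^sup>2)" using d pos by simp
    moreover have "\<epsilon> \<le> f z - m0" using e(2)[of z] z True by simp
    ultimately show ?thesis using d by linarith
  next
    case False
    then have "R\<^sup>2 \<le> (norm (z - y1))\<^sup>2"
      using R by (intro power_mono) (auto simp: dist_norm norm_minus_commute)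
    then have "\<alpha> * (R\<^sup>2 - (norm (z - y1))\<^sup>2) \<le> 0" using pos by (simp add: mult_le_0_iff)
    then have "\<delta> * ?h z \<le> \<delta> * 1" using d by (intro mult_left_mono) auto
    then show ?thesis using min[of z] z by simp
  qed
  have hz1: "f z1 - \<delta> * ?h z1 = m0 - \<delta>"
    using R z1 by (simp add: dist_norm norm_minus_commute)
  have "continuous_on (cball z1 t) (\<lambda>z. f z - \<delta> * ?h z)"
    by (intro continuous_intros cont)
  then obtain p where p: "p \<in> cball z1 t"
    "\<And>z. z \<in> cball z1 t \<Longrightarrow> f p - \<delta> * ?h p \<le> f z - \<delta> * ?h z"
    using continuous_attains_inf[of "cball z1 t"] t by (metis (no_types, lifting) cball_eq_empty compact_cball not_less_iff_gr_or_eq)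
  show ?thesis
  proof (cases "p \<in> ball z1 t")
    case True
    then show ?thesis using that[OF d(1,2)] p by blast
  next
    case False
    then have "p \<in> sphere z1 t" using p by (auto simp: dist_commute)
    \<comment> \<open>A minimiser on the sphere does no better than the centre, so \<open>z1\<close>
      can be taken instead.\<close>
    then have "f z1 - \<delta> * ?h z1 \<le> f z - \<delta> * ?h z" if "z \<in> cball z1 t" for z
      using bd[of p] p(2)[OF that] hz1 by linarith
    then show ?thesis using that[OF d(1,2), of z1] t by simp
  qed
qed

section \<open>Strong minimum principle\<close>

text \<open>In finite dimension, continuity of each directional derivative gives continuity of the
  derivative as a bounded linear map, and a surjective endomorphism is invertible; so the inverse
  function theorem applies.\<close>

lemma local_homeomorphism:
  fixes Y :: "'a::euclidean_space \<Rightarrow> 'a"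
  assumes D: "open D" "x0 \<in> D"
    and Y: "\<And>x. x \<in> D \<Longrightarrow> (Y has_derivative Y' x) (at x)"
    and cont: "\<And>v. continuous_on D (\<lambda>x. Y' x v)" and sur: "surj (Y' x0)"
  obtains U W h where "open U" "U \<subseteq> D" "x0 \<in> U" "open W" "homeomorphism U W Y h"
proof -
  define f' where "f' x = Blinfun (Y' x)" for x
  have f': "blinfun_apply (f' x) = Y' x" if "x \<in> D" for x
    using has_derivative_bounded_linear[OF Y[OF that]] by (simp add: f'_def bounded_linear_Blinfun_apply)
  have lin: "linear (Y' x0)" using Y[OF D(2)] by (rule has_derivative_linear)
  then obtain k where k: "linear k" "k \<circ> Y' x0 = id"
    using linear_injective_left_inverse[OF lin linear_surjective_imp_injective[OF lin sur]] by auto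
  have "Blinfun k o\<^sub>L f' x0 = id_blinfun"
    using k f'[OF D(2)]
    by (intro blinfun_eqI)
      (simp add: bounded_linear_Blinfun_apply linear_conv_bounded_linear[symmetric] pointfree_idE)
  moreover have "continuous_on D f'"
    by (rule continuous_on_blinfun_componentwise) (simp add: f' cont cong: continuous_on_cong)
  moreover have "(Y has_derivative blinfun_apply (f' x)) (at x)" if "x \<in> D" for x
    using Y[OF that] f'[OF that] by simp
  ultimately show ?thesis
    using inverse_function_theorem[of D Y f' x0 "Blinfun k"] D that by metis
qed

text \<open>The function minimised is \<open>r\<close> minus the barrier pulled back along
  \<open>snd \<circ> X\<close>. The first conclusion matches the differential of \<open>r\<close>
  with that of the barrier; the left-hand side of the second is the Hessian of the barrier on
  \<open>snd (X' y e)\<close>.\<close>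

lemma barrier_second_derivative_test:
  fixes X :: "'a::euclidean_space \<Rightarrow> real \<times> 'b::euclidean_space"
  assumes D: "open D" "y \<in> D"
    and X: "\<And>x. x \<in> D \<Longrightarrow> (X has_derivative X' x) (at x)"
    and X2: "((\<lambda>x. X' x e) has_derivative X2) (at y)"
    and min: "\<And>x. x \<in> D \<Longrightarrow> fst (X y) - \<delta> * exp (\<alpha> * (r - (norm (snd (X y) - y1))\<^sup>2))
      \<le> fst (X x) - \<delta> * exp (\<alpha> * (r - (norm (snd (X x) - y1))\<^sup>2))"
    and d: "d = snd (X y) - y1" and q: "q = \<delta> * exp (\<alpha> * (r - (norm d)\<^sup>2))"
  shows "fst (X' y e) = - (2 * \<alpha> * q) * (d \<bullet> snd (X' y e))"
    and "q * (4 * \<alpha>\<^sup>2 * (d \<bullet> snd (X' y e))\<^sup>2 - 2 * \<alpha> * (norm (snd (X' y e)))\<^sup>2)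
       \<le> fst (X2 e) + 2 * \<alpha> * q * (d \<bullet> snd (X2 e))"
proof -
  let ?E = "\<lambda>x. \<delta> * exp (\<alpha> * (r - (snd (X x) - y1) \<bullet> (snd (X x) - y1)))"
  let ?f = "\<lambda>x. fst (X x) - ?E x"
  let ?f' = "\<lambda>x v. fst (X' x v) + 2 * \<alpha> * ?E x * ((snd (X x) - y1) \<bullet> snd (X' x v))"
  have sX: "((\<lambda>x. snd (X x)) has_derivative (\<lambda>v. snd (X' x v))) (at x)" if "x \<in> D" for x
    by (rule has_derivative_snd[OF X[OF that]])
  have fX: "((\<lambda>x. fst (X x)) has_derivative (\<lambda>v. fst (X' x v))) (at x)" if "x \<in> D" for x
    by (rule has_derivative_fst[OF X[OF that]])
  have E: "(?E has_derivative (\<lambda>v. - 2 * \<alpha> * ?E x * ((snd (X x) - y1) \<bullet> snd (X' x v)))) (at x)"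
    if "x \<in> D" for x
    by (auto intro!: derivative_eq_intros X[OF that] simp: inner_commute algebra_simps)
  have f: "(?f has_derivative ?f' x) (at x)" if "x \<in> D" for x
    using has_derivative_diff[OF fX[OF that] E[OF that]] by simp
  have f2: "((\<lambda>x. ?f' x e) has_derivative (\<lambda>v. fst (X2 v) +
      ((2 * \<alpha> * ?E y) * ((snd (X y) - y1) \<bullet> snd (X2 v) + snd (X' y v) \<bullet> snd (X' y e)) +
       (2 * \<alpha> * (- 2 * \<alpha> * ?E y * ((snd (X y) - y1) \<bullet> snd (X' y v)))) * ((snd (X y) - y1) \<bullet> snd (X' y e))))) (at y)"
  proof (rule has_derivative_add[OF has_derivative_fst[OF X2]], rule has_derivative_mult)
    show "((\<lambda>x. 2 * \<alpha> * ?E x) has_derivative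
        (\<lambda>v. 2 * \<alpha> * (- 2 * \<alpha> * ?E y * ((snd (X y) - y1) \<bullet> snd (X' y v))))) (at y)"
      by (rule has_derivative_mult_right[OF E[OF D(2)]])
    show "((\<lambda>x. (snd (X x) - y1) \<bullet> snd (X' x e)) has_derivative
        (\<lambda>v. (snd (X y) - y1) \<bullet> snd (X2 v) + snd (X' y v) \<bullet> snd (X' y e))) (at y)"
      using has_derivative_inner[OF has_derivative_diff[OF sX[OF D(2)] has_derivative_const] has_derivative_snd[OF X2]]
      by simp
  qed
  have min': "?f y \<le> ?f x" if "x \<in> D" for x
    using min[OF that] by (simp add: power2_norm_eq_inner)
  have q': "q = ?E y" by (simp add: q d power2_norm_eq_inner)
  show "fst (X' y e) = - (2 * \<alpha> * q) * (d \<bullet> snd (X' y e))"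
    using local_min_second_derivative(1)[OF D f f2 min'] unfolding q' d by (simp add: algebra_simps)
  show "q * (4 * \<alpha>\<^sup>2 * (d \<bullet> snd (X' y e))\<^sup>2 - 2 * \<alpha> * (norm (snd (X' y e)))\<^sup>2)
       \<le> fst (X2 e) + 2 * \<alpha> * q * (d \<bullet> snd (X2 e))"
    using local_min_second_derivative(2)[OF D f f2 min']
    unfolding q'[symmetric] unfolding d[symmetric] power2_norm_eq_inner
    by (simp add: power2_eq_square algebra_simps)
qed

text \<open>At a minimum the tangent space is horizontal, so near \<open>x0\<close> the hypersurface
  is the graph of a function \<open>f\<close> over an open set of the chart. If \<open>f\<close>
  were not constant near \<open>z0\<close>, an interior ball at its minimum set would carry a
  barrier touching the graph from below, against \<open>touching_estimate\<close>. The covered ball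
  in the conclusion later makes the projection to \<open>N\<close> open.\<close>

lemma strong_minimum_local:
  fixes X :: "real ^ 'n::finite \<Rightarrow> real \<times> (real ^ 'n)" and kap :: "real ^ 'n \<Rightarrow> 'n \<Rightarrow> real"
  assumes V: "open V" "\<And>p. p \<in> V \<Longrightarrow> inner_product_form (g c p)"
      "\<And>v w. smooth_on (\<lambda>p. g c p v w) V"
    and T: "smooth_on lam T"
    and X: "smooth_on X D" and n: "smooth_on n D"
    and XV: "\<And>x. x \<in> D \<Longrightarrow> snd (X x) \<in> V"
    and XT: "\<And>x. x \<in> D \<Longrightarrow> fst (X x) \<in> T" "\<And>x. x \<in> D \<Longrightarrow> lam (fst (X x)) > 0"
    and inj: "\<And>x. x \<in> D \<Longrightarrow> inj (frechet_derivative X (at x))"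
    and orth: "\<And>x v. x \<in> D \<Longrightarrow> warped_metric lam g c (X x) (n x) (frechet_derivative X (at x) v) = 0"
    and unit: "\<And>x. x \<in> D \<Longrightarrow> warped_metric lam g c (X x) (n x) (n x) = 1"
    and n0: "\<And>x. x \<in> D \<Longrightarrow> fst (n x) > 0"
    and char: "\<And>x t. x \<in> D \<Longrightarrow>
       det (second_form (warped_metric lam g c) X n x - t *\<^sub>R first_form (warped_metric lam g c) X x)
       = det (first_form (warped_metric lam g c) X x) * (\<Prod>i\<in>UNIV. kap x i - t)"
    and mean: "\<And>x. x \<in> D \<Longrightarrow>
       real CARD('n) * deriv lam (fst (X x)) \<le> (\<Sum>i\<in>UNIV. kap x i) * lam (fst (X x)) * fst (n x)"
    and x0: "x0 \<in> D" and min: "\<And>x. x \<in> D \<Longrightarrow> fst (X x0) \<le> fst (X x)"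
  obtains W s where "open W" "x0 \<in> W" "W \<subseteq> D" "s > 0" "\<And>x. x \<in> W \<Longrightarrow> fst (X x) = fst (X x0)"
    "ball (snd (X x0)) s \<subseteq> (\<lambda>x. snd (X x)) ` W"
proof -
  define X' where "X' x = frechet_derivative X (at x)" for x
  define Y where "Y x = snd (X x)" for x
  define m0 where "m0 = fst (X x0)"
  define z0 where "z0 = Y x0"
  have D: "open D" by (rule smooth_on_open[OF X])
  have dX: "(X has_derivative X' x) (at x)" if "x \<in> D" for x
    unfolding X'_def by (rule smooth_on_has_derivative[OF X that])
  have inj': "inj (X' x)" if "x \<in> D" for x using inj[OF that] by (simp add: X'_def)
  have orth': "warped_metric lam g c (X x) (n x) (X' x v) = 0" if "x \<in> D" for x v
    using orth[OF that] by (simp add: X'_def)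
  define X2 where "X2 x e = frechet_derivative (\<lambda>x. X' x e) (at x)" for x e
  have dX2: "((\<lambda>x. X' x e) has_derivative X2 x e) (at x)" if "x \<in> D" for x e
    unfolding X2_def X'_def
    by (rule smooth_on_has_derivative[OF smooth_on_frechet_derivative[OF X] that])
  have cX': "continuous_on D (\<lambda>x. X' x v)" for v
    unfolding X'_def by (rule smooth_on_continuous[OF smooth_on_frechet_derivative[OF X]])
  have g: "differentiable_metric V (g c)"
    using V(1,2) differentiableI[OF smooth_on_has_derivative[OF V(3)]]
    by (auto simp: differentiable_metric_def)
  have dY: "(Y has_derivative (\<lambda>v. snd (X' x v))) (at x)" if "x \<in> D" for x
    unfolding Y_def[abs_def] by (rule has_derivative_snd[OF dX[OF that]])
  have crit: "fst (X' x0 v) = 0" for v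
    by (rule local_min_second_derivative(1)[OF D x0 has_derivative_fst[OF dX] has_derivative_fst[OF dX2[OF x0]]])
      (use min in auto)
  have "surj (\<lambda>v. snd (X' x0 v))"
    using tangent_normal(1)[of "X' x0" "\<lambda>_. 0", OF has_derivative_linear[OF dX[OF x0]] inj'[OF x0] _ _ orth'[OF x0]]
    by (simp add: crit linear_iff)
  then obtain U W h where U: "open U" "U \<subseteq> D" "x0 \<in> U" "open W" "homeomorphism U W Y h"
    using local_homeomorphism[OF D x0 dY continuous_on_snd[OF cX']] by metis
  have h: "h z \<in> U" "Y (h z) = z" if "z \<in> W" for z
    using that U(5) by (auto simp: homeomorphism_def)
  have hY: "h (Y x) = x" "Y x \<in> W" if "x \<in> U" for x
    using that U(5) by (auto simp: homeomorphism_def)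
  define f where "f z = fst (X (h z))" for z
  have fY: "f (Y x) = fst (X x)" if "x \<in> U" for x using hY[OF that] by (simp add: f_def)
  have cX: "continuous_on U X" using smooth_on_continuous[OF X] U(2) by (rule continuous_on_subset)
  have contf: "continuous_on W f"
    unfolding f_def
    by (intro continuous_on_fst continuous_on_compose2[OF cX])
      (use U(5) in \<open>auto simp: homeomorphism_def\<close>)
  have fmin: "m0 \<le> f z" if "z \<in> W" for z
    using min[of "h z"] h[OF that] U(2) by (auto simp: f_def m0_def)
  have fz0: "f z0 = m0" using fY[OF U(3)] by (simp add: z0_def m0_def)
  have z0W: "z0 \<in> W" using hY[OF U(3)] by (simp add: z0_def)
  have z0V: "z0 \<in> V" using XV[OF x0] by (simp add: z0_def Y_def)
  obtain r where r: "r > 0" "cball z0 r \<subseteq> V" using V(1) z0V by (meson open_contains_cball)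
  obtain C m where Cm: "C \<ge> 0" "m > 0" "\<And>p v. p \<in> cball z0 r \<Longrightarrow> m * (norm v)\<^sup>2 \<le> g c p v v"
    "\<And>p v w. p \<in> cball z0 r \<Longrightarrow> \<bar>g c p v w\<bar> \<le> C * norm v * norm w"
    "\<And>p z v w. p \<in> cball z0 r \<Longrightarrow> \<bar>metric_deriv (g c) p z v w\<bar> \<le> C * norm z * norm v * norm w"
    using metric_local_bounds[OF V compact_cball _ r(2)] r(1) by (metis cball_eq_empty not_less_iff_gr_or_eq)
  \<comment> \<open>Bounds for \<open>lam\<close> and its derivative near the minimal radius. Like
    \<open>C\<close> and \<open>m\<close> they are fixed before \<open>\<alpha>\<close>, which
    depends on them.\<close>
  define lo hi L where "lo = lam m0 / 2" and "hi = 2 * lam m0" and "L = \<bar>deriv lam m0\<bar> + 1"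
  have lam0: "lam m0 > 0" and m0T: "m0 \<in> T" using XT[OF x0] by (auto simp: m0_def)
  have Topen: "open T" by (rule smooth_on_open[OF T])
  obtain \<eta> where eta: "\<eta> > 0" "\<And>r. dist r m0 < \<eta> \<Longrightarrow> lo \<le> lam r \<and> lam r \<le> hi \<and> \<bar>deriv lam r\<bar> \<le> L"
  proof -
    have "isCont lam m0" "isCont (deriv lam) m0"
      using smooth_on_continuous[OF T] smooth_on_continuous_deriv[OF T] Topen m0T
      by (simp_all add: continuous_on_eq_continuous_at)
    then obtain e1 e2 where e: "e1 > 0" "\<And>r. dist r m0 < e1 \<Longrightarrow> dist (lam r) (lam m0) < lam m0 / 2"
      "e2 > 0" "\<And>r. dist r m0 < e2 \<Longrightarrow> dist (deriv lam r) (deriv lam m0) < 1"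
      unfolding continuous_at_eps_delta using lam0 by (metis half_gt_zero zero_less_one)
    show ?thesis
    proof (rule that[of "min e1 e2"])
      fix r assume "dist r m0 < min e1 e2"
      then have "dist (lam r) (lam m0) < lam m0 / 2" "dist (deriv lam r) (deriv lam m0) < 1"
        using e by auto
      then show "lo \<le> lam r \<and> lam r \<le> hi \<and> \<bar>deriv lam r\<bar> \<le> L"
        unfolding lo_def hi_def L_def dist_real_def by linarith
    qed (use e in auto)
  qed
  obtain s where s: "s > 0" "ball z0 (4 * s) \<subseteq> W" "ball z0 (4 * s) \<subseteq> cball z0 r"
    "\<And>z. z \<in> ball z0 (4 * s) \<Longrightarrow> dist (f z) m0 < \<eta>"
  proof -
    obtain e1 where e1: "e1 > 0" "ball z0 e1 \<subseteq> W" using U(4) z0W by (meson open_contains_ball)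
    have "isCont f z0" using contf U(4) z0W by (simp add: continuous_on_eq_continuous_at)
    then obtain e2 where e2: "e2 > 0" "\<And>z. dist z z0 < e2 \<Longrightarrow> dist (f z) m0 < \<eta>"
      unfolding continuous_at_eps_delta fz0 using eta(1) by metis
    show ?thesis
      by (rule that[of "min e1 (min e2 r) / 4"]) (use e1 e2 r in \<open>auto simp: dist_commute\<close>)
  qed
  have fmin': "m0 \<le> f z" if "z \<in> ball z0 (4 * s)" for z
    using that s(2) by (intro fmin) auto
  have const: "f y = m0" if y: "y \<in> ball z0 s" for y
  proof (rule ccontr)
    assume ne: "f y \<noteq> m0"
    obtain y1 z1 R where R: "0 < R" "R < s" "z1 \<in> ball z0 (2 * s)" "f z1 = m0" "dist y1 z1 = R"
      and inner: "\<And>z. z \<in> cball y1 R \<Longrightarrow> z \<noteq> z1 \<Longrightarrow> z \<in> ball z0 (4 * s) \<and> m0 < f z"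
      by (rule interior_ball_at_minimum_set[OF continuous_on_subset[OF contf s(2)] s(1) fz0
            fmin' y ne]) (assumption, rule that, assumption+)
    \<comment> \<open>The touching point then lies at distance between \<open>R / 2\<close> and
      \<open>3 * R / 2\<close> from \<open>y1\<close>, so the gradient of the barrier does not
      degenerate there.\<close>
    define t where "t = R / 2"
    have t: "t > 0" "cball z1 t \<subseteq> ball z0 (4 * s)"
    proof -
      show "t > 0" using R by (simp add: t_def)
      show "cball z1 t \<subseteq> ball z0 (4 * s)"
      proof
        fix z assume "z \<in> cball z1 t"
        then show "z \<in> ball z0 (4 * s)"
          using R dist_triangle[of z0 z z1] by (simp add: t_def)
      qed
    qed
    define B1 B2 where "B1 = real CARD('n) / (lo\<^sup>2 * m)"
      and "B2 = real CARD('n) * (2 * (L / lo) / (lo\<^sup>2 * m) + 3 / 2 * hi\<^sup>2 * C / (lo\<^sup>2 * m)\<^sup>2)"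
    have lo: "lo > 0" "L \<ge> 0" using lam0 by (auto simp: lo_def L_def)
    have B: "B1 \<ge> 0" "B2 \<ge> 0" using lo Cm by (auto simp: B1_def B2_def)
    define \<theta> where "\<theta> = 1 + hi\<^sup>2 * C"
    have th: "\<theta> > 0" using Cm by (simp add: \<theta>_def add_pos_nonneg)
    \<comment> \<open>Solves \<open>2 * \<alpha> * (R / 2)\<^sup>2 / \<theta> = B1 + B2 * (3 * R /
      2) + 1\<close>, which exceeds by \<open>1\<close> what \<open>touching_estimate\<close>
      permits.\<close>
    define \<alpha> where "\<alpha> = 2 * \<theta> * (B1 + B2 * (3 * R / 2) + 1) / R\<^sup>2"
    have alpha: "\<alpha> > 0" using th B R by (simp add: \<alpha>_def add_nonneg_pos)
    \<comment> \<open>As \<open>q \<le> \<delta> * exp (\<alpha> * R\<^sup>2)\<close>, this cap on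
      \<open>\<delta>\<close> keeps the slope \<open>2 * \<alpha> * q * norm d\<close> at most
      \<open>1\<close>.\<close>
    define b where "b = 1 / (2 * \<alpha> * exp (\<alpha> * R\<^sup>2) * (3 * R / 2))"
    have b: "b > 0" using alpha R by (simp add: b_def)
    have cf: "continuous_on (cball z1 t) f"
      using contf by (rule continuous_on_subset) (use t s in auto)
    have fm: "m0 \<le> f z" if "z \<in> cball z1 t" for z
      using that t s by (intro fmin) auto
    have fi: "m0 < f z" if "z \<in> cball y1 R" "z \<in> cball z1 t" "z \<noteq> z1" for z
      using inner[OF that(1,3)] by simp
    obtain \<delta> p where \<delta>: "\<delta> > 0" "\<delta> \<le> b" and p: "p \<in> ball z1 t"
      and touch: "\<And>z. z \<in> cball z1 t \<Longrightarrow> f p - \<delta> * exp (\<alpha> * (R\<^sup>2 - (norm (p - y1))\<^sup>2))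
         \<le> f z - \<delta> * exp (\<alpha> * (R\<^sup>2 - (norm (z - y1))\<^sup>2))"
      by (rule hopf_barrier_touches[where f = f and ?m0.0 = m0, OF cf t(1) R(5,1) _ R(4) _ alpha b])
        (rule fm, assumption, rule fi, assumption+, rule that, assumption+)
    have "p \<in> cball z1 t" using p by simp
    then have pW: "p \<in> W" "p \<in> ball z0 (4 * s)" using t s by blast+
    define x1 where "x1 = h p"
    have x1: "x1 \<in> U" "x1 \<in> D" "Y x1 = p" "fst (X x1) = f p"
      using h[OF pW(1)] U(2) by (auto simp: x1_def f_def)
    \<comment> \<open>The barrier stays below the graph over \<open>ball z1 t\<close>;
      \<open>D2\<close> is the corresponding open set of parameters.\<close>
    define D2 where "D2 = {x \<in> U. Y x \<in> ball z1 t}"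
    have D2: "open D2" "x1 \<in> D2" "D2 \<subseteq> D"
    proof -
      have "continuous_on U Y" using U(5) by (simp add: homeomorphism_def)
      then have "open (U \<inter> Y -` ball z1 t)" using U(1) by (rule continuous_open_preimage) simp
      moreover have "D2 = U \<inter> Y -` ball z1 t" by (auto simp: D2_def)
      ultimately show "open D2" by simp
      show "x1 \<in> D2" "D2 \<subseteq> D" using x1 p U(2) by (auto simp: D2_def)
    qed
    define d where "d = snd (X x1) - y1"
    define q where "q = \<delta> * exp (\<alpha> * (R\<^sup>2 - (norm d)\<^sup>2))"
    have dp: "d = p - y1" using x1 by (simp add: d_def Y_def)
    have dmin: "fst (X x1) - \<delta> * exp (\<alpha> * (R\<^sup>2 - (norm (snd (X x1) - y1))\<^sup>2))
      \<le> fst (X x) - \<delta> * exp (\<alpha> * (R\<^sup>2 - (norm (snd (X x) - y1))\<^sup>2))" if "x \<in> D2" for x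
    proof -
      have "f (Y x) = fst (X x)" "Y x \<in> cball z1 t" using that fY by (auto simp: D2_def)
      then show ?thesis using touch[of "Y x"] x1 by (simp add: Y_def)
    qed
    note test = barrier_second_derivative_test[OF D2(1,2) dX[OF subsetD[OF D2(3)]] dX2[OF x1(2)] dmin d_def q_def]
    have nd: "R / 2 \<le> norm d" "norm d \<le> 3 * R / 2"
    proof -
      have "dist z1 p < R / 2" using p by (simp add: t_def)
      moreover have "norm d = dist p y1" by (simp add: dp dist_norm)
      ultimately show "R / 2 \<le> norm d" "norm d \<le> 3 * R / 2"
        using dist_triangle[of p y1 z1] dist_triangle[of y1 z1 p] R(5)
        by (simp_all add: dist_commute)
    qed
    have q: "q > 0" using \<delta> by (simp add: q_def)
    have small: "2 * \<alpha> * q * norm d \<le> 1"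
    proof -
      have "q \<le> \<delta> * exp (\<alpha> * R\<^sup>2)" unfolding q_def using \<delta> alpha by simp
      also have "\<dots> \<le> b * exp (\<alpha> * R\<^sup>2)" using \<delta> by simp
      finally have "2 * \<alpha> * q * norm d \<le> 2 * \<alpha> * (b * exp (\<alpha> * R\<^sup>2)) * (3 * R / 2)"
        using nd alpha q b by (intro mult_mono) auto
      also have "\<dots> = 1" using alpha R by (simp add: b_def)
      finally show ?thesis .
    qed
    define l where "l v = - (2 * \<alpha> * q) * (d \<bullet> v)" for v
    have l: "linear l" by (rule linearI) (simp_all add: l_def inner_add_right algebra_simps)
    have l_eq: "fst (X' x1 v) = l (snd (X' x1 v))" for v
      unfolding l_def by (rule test(1))
    have l_le: "\<bar>l v\<bar> \<le> 2 * \<alpha> * q * norm d * norm v" for v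
    proof -
      have "\<bar>l v\<bar> = 2 * \<alpha> * q * \<bar>d \<bullet> v\<bar>" using alpha q by (simp add: l_def abs_mult)
      also have "\<dots> \<le> 2 * \<alpha> * q * (norm d * norm v)"
        using alpha q by (intro mult_left_mono Cauchy_Schwarz_ineq2) auto
      finally show ?thesis by simp
    qed
    have sec: "q * (4 * \<alpha>\<^sup>2 * (d \<bullet> snd (X' x1 e))\<^sup>2 - 2 * \<alpha> * (norm (snd (X' x1 e)))\<^sup>2)
       \<le> fst (X2 x1 e e) - l (snd (X2 x1 e e))" for e
      using test(2)[of e] by (simp add: l_def)
    have pr: "snd (X x1) \<in> cball z0 r" using pW s x1 by (auto simp: Y_def)
    have et: "lo \<le> lam (fst (X x1))" "lam (fst (X x1)) \<le> hi" "\<bar>deriv lam (fst (X x1))\<bar> \<le> L"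
      using eta(2)[of "fst (X x1)"] s(4)[OF pW(2)] x1(4) by auto
    have "2 * \<alpha> * (norm d)\<^sup>2 / (1 + hi\<^sup>2 * C) \<le> real CARD('n) / (lo\<^sup>2 * m) +
       real CARD('n) * (2 * (L / lo) / (lo\<^sup>2 * m) + 3 / 2 * hi\<^sup>2 * C / (lo\<^sup>2 * m)\<^sup>2) * norm d"
      by (rule touching_estimate[where g = g and c = c and y = x1 and ?X2.0 = "X2 x1" and l = l and n = n,
          OF g XV[OF x1(2)] T XT[OF x1(2)] D x1(2) dX inj'[OF x1(2)] dX2[OF x1(2)]
          smooth_on_has_derivative[OF n x1(2)] orth' unit[OF x1(2)] n0[OF x1(2)] l l_eq
          char[OF x1(2)] mean[OF x1(2)] lo(1) et Cm(2,1) Cm(3)[OF pr] Cm(4)[OF pr] Cm(5)[OF pr]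
          alpha q small l_le sec])
    then have "2 * \<alpha> * (norm d)\<^sup>2 / \<theta> \<le> B1 + B2 * norm d" by (simp add: B1_def B2_def \<theta>_def)
    also have "\<dots> \<le> B1 + B2 * (3 * R / 2)" using nd B by (intro add_left_mono mult_left_mono) auto
    finally have "2 * \<alpha> * (norm d)\<^sup>2 / \<theta> \<le> B1 + B2 * (3 * R / 2)" .
    moreover have "2 * \<alpha> * (R / 2)\<^sup>2 / \<theta> \<le> 2 * \<alpha> * (norm d)\<^sup>2 / \<theta>"
      using nd R alpha th by (intro divide_right_mono mult_left_mono power_mono) auto
    moreover have "2 * \<alpha> * (R / 2)\<^sup>2 / \<theta> = B1 + B2 * (3 * R / 2) + 1"
      using R th by (simp add: \<alpha>_def power_divide)
    ultimately show False by linarith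
  qed
  define W' where "W' = {x \<in> U. Y x \<in> ball z0 s}"
  show ?thesis
  proof (rule that)
    have "continuous_on U Y" using U(5) by (simp add: homeomorphism_def)
    then have "open (U \<inter> Y -` ball z0 s)" using U(1) by (rule continuous_open_preimage) simp
    moreover have "W' = U \<inter> Y -` ball z0 s" by (auto simp: W'_def)
    ultimately show "open W'" by simp
    show "x0 \<in> W'" "W' \<subseteq> D" "s > 0" using U s by (auto simp: W'_def z0_def)
    show "fst (X x) = fst (X x0)" if "x \<in> W'" for x
      using that const[of "Y x"] fY[of x] by (simp add: W'_def m0_def)
    have "z \<in> (\<lambda>x. snd (X x)) ` W'" if "z \<in> ball z0 s" for z
    proof -
      have "z \<in> W" using that s by auto
      then have "h z \<in> W'" "z = snd (X (h z))" using h[of z] that by (auto simp: W'_def Y_def)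
      then show ?thesis by blast
    qed
    then show "ball (snd (X x0)) s \<subseteq> (\<lambda>x. snd (X x)) ` W'" by (auto simp: z0_def Y_def)
  qed
qed

section \<open>Rigidity\<close>

text \<open>Weights with \<open>j > k\<close> vanish, so those with \<open>j \<le> k\<close> already
  sum to one and \<open>F\<close> is a convex combination of quotients with common bounds.\<close>

lemma weighted_quotients_bounds:
  fixes x :: "real ^ 'n::finite" and a :: "nat \<Rightarrow> nat \<Rightarrow> real"
  assumes x: "x \<in> Gamma_plus k" and k: "k \<le> CARD('n)"
    and a: "\<And>i j. i < j \<Longrightarrow> j \<le> CARD('n) \<Longrightarrow> a i j \<ge> 0"
    and vanish: "\<And>i j. i < j \<Longrightarrow> k < j \<Longrightarrow> j \<le> CARD('n) \<Longrightarrow> a i j = 0"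
    and sum: "(\<Sum>(i, j) | i < j \<and> j \<le> CARD('n). a i j) = 1"
  defines "F \<equiv> \<Sum>(i, j) | i < j \<and> j \<le> k. a i j * (Hk i x / Hk j x) powr (1 / (real j - real i))"
  shows "1 / Hk 1 x \<le> F" and "\<And>c. c > 0 \<Longrightarrow> (\<And>i. c \<le> x $ i) \<Longrightarrow> F \<le> 1 / c"
proof -
  let ?P = "\<lambda>m :: nat. {(i, j). i < j \<and> j \<le> m}"
  have fin: "finite (?P m)" for m
    by (rule finite_subset[of _ "{..m} \<times> {..m}"]) auto
  have "(\<Sum>(i, j)\<in>?P k. a i j) = (\<Sum>(i, j)\<in>?P CARD('n). a i j)"
    using k vanish by (intro sum.mono_neutral_left fin) (auto, metis not_le)
  then have s1: "(\<Sum>(i, j)\<in>?P k. a i j) = 1" using sum by simp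
  have c: "(\<Sum>(i, j)\<in>?P k. a i j * r) = r" for r
    using s1 by (simp add: sum_distrib_right[symmetric] case_prod_unfold)
  have "1 / Hk 1 x = (\<Sum>(i, j)\<in>?P k. a i j * (1 / Hk 1 x))" by (rule c[symmetric])
  also have "\<dots> \<le> F"
    unfolding F_def
  proof (rule sum_mono, clarify)
    fix i j assume "i < j" "j \<le> k"
    then show "a i j * (1 / Hk 1 x) \<le> a i j * (Hk i x / Hk j x) powr (1 / (real j - real i))"
      using a[of i j] k curvature_quotient_ge[OF x k] by (intro mult_left_mono) auto
  qed
  finally show "1 / Hk 1 x \<le> F" .
  fix b :: real assume b: "b > 0" "\<And>i. b \<le> x $ i"
  have "F \<le> (\<Sum>(i, j)\<in>?P k. a i j * (1 / b))"
    unfolding F_def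
  proof (rule sum_mono, clarify)
    fix i j assume "i < j" "j \<le> k"
    then show "a i j * (Hk i x / Hk j x) powr (1 / (real j - real i)) \<le> a i j * (1 / b)"
      using a[of i j] k curvature_quotient_le[OF b, of i j] by (intro mult_left_mono) auto
  qed
  then show "F \<le> 1 / b" unfolding c .
qed

lemma riemannian_manifold_chart:
  assumes "riemannian_manifold N A g" "c \<in> A"
  shows "openin (top_of_set N) (cdom c)" "open (cimage c)"
    "homeomorphism (cdom c) (cimage c) (cmap c) (cinv c)"
    "\<And>x. x \<in> cimage c \<Longrightarrow> inner_product_form (g c x)"
    "\<And>v w. smooth_on (\<lambda>x. g c x v w) (cimage c)"
  using assms by (auto simp: riemannian_manifold_def smooth_atlas_def riemannian_metric_def)

text \<open>Chart transitions act on the factor \<open>N\<close> only, so the radial component of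
  \<open>\<nu>\<close> is the same in every chart.\<close>

lemma support_function_eq:
  assumes N: "riemannian_manifold N A g" and \<nu>: "unit_normal A g lam S \<nu>"
    and p: "p \<in> S" and c: "c \<in> A" "snd p \<in> cdom c"
  shows "support_function A g lam \<nu> p = lam (fst p) * fst (\<nu> c p)"
proof -
  define c' where "c' = (SOME c. c \<in> A \<and> snd p \<in> cdom c)"
  have c': "c' \<in> A" "snd p \<in> cdom c'"
    using someI[of "\<lambda>c. c \<in> A \<and> snd p \<in> cdom c" c] c by (auto simp: c'_def)
  have "inner_product_form (g c' (cmap c' (snd p)))"
    using riemannian_manifold_chart(4)[OF N c'(1)] c'(2) by simp
  note bb = inner_product_form_bounded[OF this]
  have "fst (\<nu> c' p) = fst (\<nu> c p)"
    using \<nu> p c c' unfolding unit_normal_def smooth_field_along_def by (metis IntI fst_conv)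
  then show ?thesis
    by (simp add: support_function_def c'_def[symmetric] warped_metric_def mmap_def
        bounded_bilinear.zero_left[OF bb])
qed

lemma local_parametrization_point:
  assumes P: "local_parametrization A S c D X" and N: "riemannian_manifold N A g" and y: "y \<in> D"
  shows "minv c (X y) \<in> S" "fst (minv c (X y)) = fst (X y)" "snd (minv c (X y)) \<in> cdom c"
    "cmap c (snd (minv c (X y))) = snd (X y)" "snd (X y) \<in> cimage c"
proof -
  have im: "openin (top_of_set S) ((minv c \<circ> X) ` D)" using P by (simp add: local_parametrization_def)
  show "minv c (X y) \<in> S" using openin_imp_subset[OF im] y by auto
  show "fst (minv c (X y)) = fst (X y)" by (simp add: minv_def)
  have cA: "c \<in> A" and "X y \<in> UNIV \<times> cimage c" using P y by (auto simp: local_parametrization_def)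
  then show z: "snd (X y) \<in> cimage c" by (auto simp: mem_Times_iff)
  show "snd (minv c (X y)) \<in> cdom c" "cmap c (snd (minv c (X y))) = snd (X y)"
    using riemannian_manifold_chart(3)[OF N cA] z by (auto simp: homeomorphism_def minv_def)
qed

text \<open>The tangent space is horizontal, so the normal is \<open>\<partial>_r\<close>, with the
  sign given by \<open>n0\<close>. For \<open>l = 0\<close> and \<open>snd (n y) = 0\<close>,
  \<open>tangent_second_form\<close> loses all derivatives of the metric of \<open>N\<close>:
  \<open>h\<close> is \<open>\<lambda>' / \<lambda>\<close> times the induced metric minus the
  second derivative of \<open>r\<close>, which is nonpositive at a maximum.\<close>

lemma principal_curvatures_at_maximum:
  fixes X :: "real ^ 'n::finite \<Rightarrow> real \<times> (real ^ 'n)" and kap :: "'n \<Rightarrow> real"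
  assumes g: "differentiable_metric V (g c)" "snd (X y) \<in> V"
    and T: "smooth_on lam T" "fst (X y) \<in> T" "lam (fst (X y)) > 0"
    and X: "smooth_on X D" and n: "smooth_on n D" and y: "y \<in> D"
    and inj: "inj (frechet_derivative X (at y))"
    and orth: "\<And>x v. x \<in> D \<Longrightarrow> warped_metric lam g c (X x) (n x) (frechet_derivative X (at x) v) = 0"
    and unit: "warped_metric lam g c (X y) (n y) (n y) = 1" and n0: "fst (n y) > 0"
    and char: "\<And>t. det (second_form (warped_metric lam g c) X n y - t *\<^sub>R first_form (warped_metric lam g c) X y)
       = det (first_form (warped_metric lam g c) X y) * (\<Prod>i\<in>UNIV. kap i - t)"
    and max: "\<And>x. x \<in> D \<Longrightarrow> fst (X x) \<le> fst (X y)"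
  shows "fst (n y) = 1" and "deriv lam (fst (X y)) / lam (fst (X y)) \<le> kap i"
proof -
  let ?G = "warped_metric lam g c"
  define X' where "X' x = frechet_derivative X (at x)" for x
  have D: "open D" by (rule smooth_on_open[OF X])
  have dX: "(X has_derivative X' x) (at x)" if "x \<in> D" for x
    unfolding X'_def by (rule smooth_on_has_derivative[OF X that])
  define X2 where "X2 e = frechet_derivative (\<lambda>x. X' x e) (at y)" for e
  have dX2: "((\<lambda>x. X' x e) has_derivative X2 e) (at y)" for e
    unfolding X2_def X'_def
    by (rule smooth_on_has_derivative[OF smooth_on_frechet_derivative[OF X] y])
  have lX: "linear (X' y)" by (rule has_derivative_linear[OF dX[OF y]])
  have inj': "inj (X' y)" and orth': "\<And>x v. x \<in> D \<Longrightarrow> ?G (X x) (n x) (X' x v) = 0"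
    using inj orth by (simp_all add: X'_def)
  have form: "inner_product_form (g c (snd (X y)))"
    using g by (auto simp: differentiable_metric_def)
  have Gform: "inner_product_form (?G (X y))"
    using form T(3) by (intro inner_product_form_warped) auto
  have "- fst (X' y e) = 0 \<and> - fst (X2 e e) \<ge> 0" for e
  proof (intro conjI)
    have a: "((\<lambda>x. - fst (X x)) has_derivative (\<lambda>v. - fst (X' x v))) (at x)" if "x \<in> D" for x
      by (rule has_derivative_minus[OF has_derivative_fst[OF dX[OF that]]])
    have b: "((\<lambda>x. - fst (X' x e)) has_derivative (\<lambda>v. - fst (X2 e v))) (at y)"
      by (rule has_derivative_minus[OF has_derivative_fst[OF dX2]])
    have c: "- fst (X y) \<le> - fst (X x)" if "x \<in> D" for x using max[OF that] by simp
    show "- fst (X' y e) = 0" by (rule local_min_second_derivative(1)[OF D y a b c])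
    show "- fst (X2 e e) \<ge> 0" by (rule local_min_second_derivative(2)[OF D y a b c])
  qed
  then have X1: "fst (X' y e) = 0" and X2: "fst (X2 e e) \<le> 0" for e by auto
  have l0: "linear (\<lambda>_ :: real ^ 'n. 0 :: real)" by (simp add: linear_iff)
  have "(lam (fst (X y)))\<^sup>2 * g c (snd (X y)) (snd (n y)) (snd (n y)) = 0"
    using tangent_normal(2)[OF lX inj' l0 X1 orth'[OF y], of "snd (n y)"] by simp
  then have sn: "snd (n y) = 0" using T(3) inner_product_form_eq_0[OF form] by simp
  then have "fst (n y) * fst (n y) = 1"
    using unit bounded_bilinear.zero_left[OF inner_product_form_bounded[OF form]]
    by (simp add: warped_metric_def)
  then show n1: "fst (n y) = 1" using n0 by (metis less_asym mult_1 mult_eq_1 square_eq_1_iff neg_less_0_iff_less zero_less_one)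
  let ?r = "deriv lam (fst (X y)) / lam (fst (X y))"
  have md: "metric_deriv (g c) (snd (X y)) 0 v w = 0" "metric_deriv (g c) (snd (X y)) v 0 w = 0" for v w
    using linear_0[OF linear_metric_deriv[OF g]] linear_0[OF linear_metric_deriv_left[OF g]] by auto
  have "e \<bullet> (second_form ?G X n y *v e) = ?r * (e \<bullet> (first_form ?G X y *v e)) - fst (X2 e e)" for e
    using tangent_second_form[where g = g and c = c, OF g T D y dX inj' dX2 smooth_on_has_derivative[OF n y] orth' l0 X1, of e]
    by (simp add: n1 sn md)
  then have h: "?r * (e \<bullet> (first_form ?G X y *v e)) \<le> e \<bullet> (second_form ?G X n y *v e)" for e
    using X2[of e] by simp
  have "v \<bullet> (first_form ?G X y *v v) > 0" if "v \<noteq> 0" for v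
  proof -
    have "X' y v \<noteq> 0" using that linear_injective_0[OF lX] inj' by auto
    then show ?thesis
      using first_form_apply[of ?G X y, OF Gform dX[OF y], of v v] inner_product_form_pos[OF Gform] by simp
  qed
  then show "?r \<le> kap i" by (rule relative_eigenvalue_ge[OF char _ h])
qed

text \<open>Connectedness is used twice. The set where \<open>r\<close> is minimal is open and
  closed in \<open>S\<close>, hence all of \<open>S\<close>. Then every point of \<open>S\<close> is
  a minimum point, so by the covered balls the projection of \<open>S\<close> is open in
  \<open>N\<close>; it is also compact, hence all of \<open>N\<close>.\<close>

lemma slice_if_locally_constant:
  fixes N :: "('p::t2_space) set" and A :: "('p, 'n::finite) chart set"
  assumes N: "riemannian_manifold N A g" and S: "compact S" "connected S" "S \<noteq> {}" "S \<subseteq> I \<times> N"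
    and cover: "\<And>p. p \<in> S \<Longrightarrow> \<exists>c D X. local_parametrization A S c D X \<and> p \<in> (minv c \<circ> X) ` D"
    and const: "\<And>c D X y0. local_parametrization A S c D X \<Longrightarrow> y0 \<in> D \<Longrightarrow>
      (\<And>q. q \<in> S \<Longrightarrow> fst (X y0) \<le> fst q) \<Longrightarrow>
      \<exists>W s. open W \<and> y0 \<in> W \<and> W \<subseteq> D \<and> s > 0 \<and> (\<forall>x\<in>W. fst (X x) = fst (X y0)) \<and>
        ball (snd (X y0)) s \<subseteq> (\<lambda>x. snd (X x)) ` W"
  shows "\<exists>r0\<in>I. S = {r0} \<times> N"
proof -
  obtain p0 where p0: "p0 \<in> S" "\<And>q. q \<in> S \<Longrightarrow> fst p0 \<le> fst q"
    using continuous_attains_inf[OF S(1,3) continuous_on_fst[OF continuous_on_id]] by auto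
  define Z where "Z = {q \<in> S. fst q = fst p0}"
  have loc: "\<exists>U V. openin (top_of_set S) U \<and> q \<in> U \<and> U \<subseteq> Z \<and>
      openin (top_of_set N) V \<and> snd q \<in> V \<and> V \<subseteq> snd ` S" if q: "q \<in> Z" for q
  proof -
    have qS: "q \<in> S" "fst q = fst p0" using q by (auto simp: Z_def)
    obtain c D X y0 where P: "local_parametrization A S c D X" and y0: "y0 \<in> D" "q = minv c (X y0)"
      using cover[OF qS(1)] by auto
    note pt = local_parametrization_point[OF P N]
    have q0: "fst (X y0) = fst p0" using pt(2)[OF y0(1)] y0 qS by simp
    obtain W s where W: "open W" "y0 \<in> W" "W \<subseteq> D" "s > 0" "\<forall>x\<in>W. fst (X x) = fst (X y0)"
      "ball (snd (X y0)) s \<subseteq> (\<lambda>x. snd (X x)) ` W"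
      using const[OF P y0(1)] p0(2) q0 by metis
    obtain Y where Y: "homeomorphism D ((minv c \<circ> X) ` D) (minv c \<circ> X) Y"
      and op: "openin (top_of_set S) ((minv c \<circ> X) ` D)"
      using P by (auto simp: local_parametrization_def)
    let ?U = "(minv c \<circ> X) ` W"
    have "openin (top_of_set D) W" by (rule open_subset[OF W(3,1)])
    then have "openin (top_of_set S) ?U"
      using homeomorphism_imp_open_map[OF Y] openin_trans[OF _ op] by blast
    moreover have "q \<in> ?U" using W(2) y0 by auto
    moreover have "?U \<subseteq> Z"
      using pt(1,2) W(3,5) q0 by (auto simp: Z_def)
    moreover
    have cA: "c \<in> A" using P by (simp add: local_parametrization_def)
    note ch = riemannian_manifold_chart[OF N cA]
    let ?B = "ball (snd (X y0)) s \<inter> cimage c"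
    have hom: "homeomorphism (cimage c) (cdom c) (cinv c) (cmap c)" by (rule homeomorphism_symD[OF ch(3)])
    have "openin (top_of_set (cimage c)) ?B" by (auto simp: openin_open)
    then have "openin (top_of_set N) (cinv c ` ?B)"
      using homeomorphism_imp_open_map[OF hom] openin_trans[OF _ ch(1)] by blast
    moreover have "snd q \<in> cinv c ` ?B"
      using y0 pt(5)[OF y0(1)] W(4) by (auto simp: minv_def)
    moreover have "cinv c ` ?B \<subseteq> snd ` S"
    proof
      fix p assume "p \<in> cinv c ` ?B"
      then obtain z where z: "p = cinv c z" "z \<in> ball (snd (X y0)) s" by blast
      from subsetD[OF W(6) z(2)] obtain x where x: "z = snd (X x)" "x \<in> W" by (rule imageE)
      have "p = snd (minv c (X x))" by (simp add: minv_def z x)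
      moreover have "minv c (X x) \<in> S" by (rule pt(1)[OF subsetD[OF W(3) x(2)]])
      ultimately show "p \<in> snd ` S" by blast
    qed
    ultimately show ?thesis by blast
  qed
  have "openin (top_of_set S) Z"
    by (subst openin_subopen) (use loc in blast)
  moreover have "closedin (top_of_set S) Z"
    using continuous_closedin_preimage_constant[OF continuous_on_fst[OF continuous_on_id[of S]], of "fst p0"]
    by (simp add: Z_def)
  moreover have "p0 \<in> Z" using p0 by (simp add: Z_def)
  ultimately have ZS: "Z = S" using S(2) unfolding connected_clopen by blast
  have "openin (top_of_set N) (snd ` S)"
    by (subst openin_subopen) (use loc ZS in blast)
  moreover have "closedin (top_of_set N) (snd ` S)"
  proof (rule closed_subset)
    show "snd ` S \<subseteq> N" using S(4) by auto
    show "closed (snd ` S)"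
      by (intro compact_imp_closed compact_continuous_image continuous_on_snd continuous_on_id S)
  qed
  moreover have "connected N" using N by (simp add: riemannian_manifold_def)
  ultimately have PN: "snd ` S = N" using S(3) unfolding connected_clopen by blast
  have eq: "fst q = fst p0" if "q \<in> S" for q
    using that unfolding ZS[symmetric] by (simp add: Z_def)
  have "S = {fst p0} \<times> N"
  proof
    show "S \<subseteq> {fst p0} \<times> N" using S(4) eq by fastforce
    show "{fst p0} \<times> N \<subseteq> S"
    proof
      fix q assume q: "q \<in> {fst p0} \<times> N"
      then obtain q' where q': "q' \<in> S" "snd q' = snd q" using PN by force
      then have "q' = q" using eq[of q'] q by (auto simp: prod_eq_iff)
      then show "q \<in> S" using q' by simp
    qed
  qed
  moreover have "fst p0 \<in> I" using p0 S(4) by auto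
  ultimately show ?thesis by blast
qed

theorem theorem1p5:
  fixes rbar :: ereal
    and lam :: "real \<Rightarrow> real"
    and N :: "('p::t2_space) set"
    and A :: "('p, 'n::finite) chart set"
    and gN :: "('p, 'n) metric"
    and K \<epsilon> \<beta> :: real
    and S :: "(real \<times> 'p) set"
    and \<nu> :: "('p, 'n) field_along"
    and \<kappa> :: "real \<times> 'p \<Rightarrow> real ^ 'n"
    and u :: "real \<times> 'p \<Rightarrow> real"
    and a :: "nat \<Rightarrow> nat \<Rightarrow> real \<times> 'p \<Rightarrow> real"
    and k :: nat
  assumes dim: "CARD('n) \<ge> 2"
    and rbar: "0 < rbar"
    and lam: "warping_function rbar lam"
    and N: "riemannian_manifold N A gN" "compact N" "constant_sectional_curvature A gN K"
    and lam_K: "\<And>r. 0 < r \<Longrightarrow> ereal r < rbar \<Longrightarrow>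
                  (deriv lam r)\<^sup>2 - deriv (deriv lam) r * lam r < K"
    and S: "closed_hypersurface A (warped_space rbar N) S"
    and \<nu>: "unit_outward_normal rbar N A gN lam S \<nu>"
    and \<kappa>: "principal_curvatures A gN lam S \<nu> \<kappa>"
    and u: "u = support_function A gN lam \<nu>"
    and a_nonneg: "\<And>i j p. i < j \<Longrightarrow> j \<le> CARD('n) \<Longrightarrow> p \<in> S \<Longrightarrow> a i j p \<ge> 0"
    and a_sum: "\<And>p. p \<in> S \<Longrightarrow> (\<Sum>(i, j) | i < j \<and> j \<le> CARD('n). a i j p) = 1"
    and k: "k = Max {j. j \<le> CARD('n) \<and> (\<exists>i<j. \<exists>p\<in>S. a i j p > 0)}"
    and convex: "\<And>p. p \<in> S \<Longrightarrow> shifted \<epsilon> (\<kappa> p) \<in> Gamma_plus k"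
    and pos: "\<And>p. p \<in> S \<Longrightarrow> deriv lam (fst p) - \<epsilon> * u p > 0"
    and \<beta>: "\<beta> > 0"
    and eq: "\<And>p. p \<in> S \<Longrightarrow>
       (\<Sum>(i, j) | i < j \<and> j \<le> k.
          a i j p * (Hk i (shifted \<epsilon> (\<kappa> p)) / Hk j (shifted \<epsilon> (\<kappa> p))) powr (1 / (real j - real i)))
       = \<beta> * (u p / (deriv lam (fst p) - \<epsilon> * u p))"
  shows "\<exists>r0\<in>base_interval rbar. S = {r0} \<times> N"
proof -
  let ?n = "CARD('n)"
  have Smf: "S \<subseteq> warped_space rbar N" "S \<noteq> {}" "connected S" "compact S"
    and cover: "\<And>p. p \<in> S \<Longrightarrow> \<exists>c D X. local_parametrization A S c D X \<and> p \<in> (minv c \<circ> X) ` D"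
    using S by (auto simp: closed_hypersurface_def hypersurface_def)
  obtain T where T: "base_interval rbar \<subseteq> T" "smooth_on lam T"
    and lpos: "\<And>r. r \<in> base_interval rbar \<Longrightarrow> lam r > 0"
    using lam by (auto simp: warping_function_def)
  have un: "unit_normal A gN lam S \<nu>" using \<nu> by (simp add: unit_outward_normal_def)
  have Sr: "fst p \<in> base_interval rbar" if "p \<in> S" for p
    using that Smf(1) by (auto simp: warped_space_def)

  \<comment> \<open>\<open>Max\<close> is informative only on a nonempty set. The weights at a point
    of \<open>S\<close> sum to one, so one of them is positive.\<close>
  let ?J = "{j. j \<le> ?n \<and> (\<exists>i<j. \<exists>p\<in>S. a i j p > 0)}"
  have finJ: "finite ?J" by (rule finite_subset[of _ "{..?n}"]) auto
  obtain p1 where p1: "p1 \<in> S" using Smf(2) by auto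
  have "?J \<noteq> {}"
  proof
    assume "?J = {}"
    then have "a i j p1 = 0" if "i < j" "j \<le> ?n" for i j
      using a_nonneg[OF that p1] that p1 by force
    then have "(\<Sum>(i, j) | i < j \<and> j \<le> ?n. a i j p1) = 0" by (intro sum.neutral) auto
    then show False using a_sum[OF p1] by simp
  qed
  then have "k \<in> ?J" unfolding k by (rule Max_in[OF finJ])
  then have k1: "1 \<le> k" "k \<le> ?n" by auto
  have vanish: "a i j p = 0" if "i < j" "k < j" "j \<le> ?n" "p \<in> S" for i j p
  proof (rule ccontr)
    assume "a i j p \<noteq> 0"
    then have "j \<in> ?J" using a_nonneg[of i j p] that by force
    then have "j \<le> k" unfolding k by (rule Max_ge[OF finJ])
    then show False using that by simp
  qed

  define x where "x p = shifted \<epsilon> (\<kappa> p)" for p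
  define F where "F p = (\<Sum>(i, j) | i < j \<and> j \<le> k.
     a i j p * (Hk i (x p) / Hk j (x p)) powr (1 / (real j - real i)))" for p
  define m where "m p = deriv lam (fst p) - \<epsilon> * u p" for p
  have m: "m p > 0" if "p \<in> S" for p using pos[OF that] by (simp add: m_def)
  have eqF: "F p = \<beta> * (u p / m p)" if "p \<in> S" for p
    using eq[OF that] by (simp add: F_def x_def m_def)
  have H1: "Hk 1 (x p) > 0" if "p \<in> S" for p
    using Gamma_plus_Hk_pos[OF convex[OF that] k1] by (simp add: x_def)
  have Fge: "1 / Hk 1 (x p) \<le> F p" if p: "p \<in> S" for p
    unfolding F_def x_def
    by (rule weighted_quotients_bounds(1)[OF convex[OF p] k1(2) a_nonneg[OF _ _ p] vanish[OF _ _ _ p] a_sum[OF p]])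
  have Fle: "F p \<le> 1 / c" if p: "p \<in> S" and "c > 0" "\<And>i. c \<le> x p $ i" for p c
    unfolding F_def x_def
    by (rule weighted_quotients_bounds(2)[OF convex[OF p] k1(2) a_nonneg[OF _ _ p] vanish[OF _ _ _ p] a_sum[OF p]])
      (use that in \<open>auto simp: x_def\<close>)
  have upos: "u p > 0" if p: "p \<in> S" for p
  proof -
    have "0 < 1 / Hk 1 (x p)" using H1[OF p] by simp
    then have "0 < \<beta> * (u p / m p)" using Fge[OF p] eqF[OF p] by linarith
    then show ?thesis using \<beta> m[OF p] by (simp add: zero_less_mult_iff zero_less_divide_iff)
  qed

  have par: "smooth_on X D" "smooth_on (\<lambda>y. \<nu> c (minv c (X y))) D"
      "open (cimage c)" "\<And>z. z \<in> cimage c \<Longrightarrow> inner_product_form (gN c z)"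
      "\<And>v w. smooth_on (\<lambda>z. gN c z v w) (cimage c)"
      "differentiable_metric (cimage c) (gN c)"
    if P: "local_parametrization A S c D X" for c D X
  proof -
    have cA: "c \<in> A" using P by (simp add: local_parametrization_def)
    show "smooth_on X D" using P by (simp add: local_parametrization_def)
    show "smooth_on (\<lambda>y. \<nu> c (minv c (X y))) D"
      using un P unfolding unit_normal_def smooth_field_along_def by blast
    note ch = riemannian_manifold_chart[OF N(1) cA]
    show "open (cimage c)" "\<And>z. z \<in> cimage c \<Longrightarrow> inner_product_form (gN c z)"
      "\<And>v w. smooth_on (\<lambda>z. gN c z v w) (cimage c)" using ch by auto
    show "differentiable_metric (cimage c) (gN c)"
      using ch(2,4) differentiableI[OF smooth_on_has_derivative[OF ch(5)]]
      by (auto simp: differentiable_metric_def)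
  qed
  have ppt: "snd (X y) \<in> cimage c" "fst (X y) \<in> base_interval rbar"
      "minv c (X y) \<in> S" "fst (minv c (X y)) = fst (X y)"
      "inj (frechet_derivative X (at y))"
      "warped_metric lam gN c (X y) (\<nu> c (minv c (X y))) (frechet_derivative X (at y) v) = 0"
      "warped_metric lam gN c (X y) (\<nu> c (minv c (X y))) (\<nu> c (minv c (X y))) = 1"
      "u (minv c (X y)) = lam (fst (X y)) * fst (\<nu> c (minv c (X y)))"
      "fst (\<nu> c (minv c (X y))) > 0"
      "det (second_form (warped_metric lam gN c) X (\<lambda>y. \<nu> c (minv c (X y))) y
          - t *\<^sub>R first_form (warped_metric lam gN c) X y)
       = det (first_form (warped_metric lam gN c) X y) * (\<Prod>i\<in>UNIV. \<kappa> (minv c (X y)) $ i - t)"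
    if P: "local_parametrization A S c D X" and y: "y \<in> D" for c D X y v t
  proof -
    note pt = local_parametrization_point[OF P N(1) y]
    have cA: "c \<in> A" using P by (simp add: local_parametrization_def)
    show "snd (X y) \<in> cimage c" "minv c (X y) \<in> S" "fst (minv c (X y)) = fst (X y)" using pt by auto
    show r: "fst (X y) \<in> base_interval rbar" using Sr[OF pt(1)] pt(2) by simp
    show "inj (frechet_derivative X (at y))" using P y by (simp add: local_parametrization_def)
    show "warped_metric lam gN c (X y) (\<nu> c (minv c (X y))) (frechet_derivative X (at y) v) = 0"
      "warped_metric lam gN c (X y) (\<nu> c (minv c (X y))) (\<nu> c (minv c (X y))) = 1"
      using un P y unfolding unit_normal_def Let_def by blast+
    show uu: "u (minv c (X y)) = lam (fst (X y)) * fst (\<nu> c (minv c (X y)))"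
      unfolding u using support_function_eq[OF N(1) un pt(1) cA pt(3)] pt(2) by simp
    \<comment> \<open>\<open>u\<close> is \<open>lam\<close> times the radial component, so its sign
      orients the normal upwards, as needed for the comparison at the maximum and for the
      barrier.\<close>
    show "fst (\<nu> c (minv c (X y))) > 0"
      using upos[OF pt(1)] lpos[OF r] unfolding uu by (simp add: zero_less_mult_iff)
    show "det (second_form (warped_metric lam gN c) X (\<lambda>y. \<nu> c (minv c (X y))) y
          - t *\<^sub>R first_form (warped_metric lam gN c) X y)
       = det (first_form (warped_metric lam gN c) X y) * (\<Prod>i\<in>UNIV. \<kappa> (minv c (X y)) $ i - t)"
      using \<kappa> P y unfolding principal_curvatures_def Let_def by blast
  qed

  have "\<beta> \<le> 1"
  proof -
    obtain p where p: "p \<in> S" "\<And>q. q \<in> S \<Longrightarrow> fst q \<le> fst p"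
      using continuous_attains_sup[OF Smf(4,2) continuous_on_fst[OF continuous_on_id]] by auto
    obtain c D X y where P: "local_parametrization A S c D X" and y: "y \<in> D" "p = minv c (X y)"
      using cover[OF p(1)] by auto
    note pp = ppt[OF P y(1)] and pr = par[OF P]
    have T': "fst (X y) \<in> T" using pp(2) T(1) by auto
    have max: "fst (X x) \<le> fst (X y)" if "x \<in> D" for x
      using p(2)[OF ppt(3)[OF P that]] ppt(4)[OF P that] pp(4) y by simp
    note pm = principal_curvatures_at_maximum[where g = gN and c = c, OF pr(6) pp(1) T(2) T' lpos[OF pp(2)]
        pr(1,2) y(1) pp(5) ppt(6)[OF P] pp(7) pp(9) pp(10) max]
    have r: "fst p = fst (X y)" using pp(4) y by simp
    have up: "u p = lam (fst p)" using pp(8) pm(1) y r by simp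
    have "deriv lam (fst p) / lam (fst p) \<le> \<kappa> p $ i" for i
      using pm(2)[of i] y r by simp
    \<comment> \<open>At the maximum \<open>u = \<lambda>\<close>, so
      \<open>m / u = \<lambda>' / \<lambda> - \<epsilon>\<close> is the shifted curvature of the
      slice. Being positive, it can serve as the lower bound \<open>c\<close> in
      \<open>Fle\<close>.\<close>
    then have "m p / u p \<le> x p $ i" for i
      using upos[OF p(1)] by (simp add: x_def shifted_def m_def up diff_divide_distrib)
    then have "F p \<le> 1 / (m p / u p)"
      using upos[OF p(1)] m[OF p(1)] by (intro Fle p) auto
    then have "\<beta> * (u p / m p) \<le> 1 * (u p / m p)" using eqF[OF p(1)] by simp
    then show ?thesis
      using upos[OF p(1)] m[OF p(1)] by (simp only: mult_le_cancel_right_pos divide_pos_pos)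
  qed

  have mean: "real ?n * deriv lam (fst p) \<le> (\<Sum>i\<in>UNIV. \<kappa> p $ i) * u p" if p: "p \<in> S" for p
  proof -
    have "1 / Hk 1 (x p) \<le> \<beta> * (u p / m p)" using Fge[OF p] eqF[OF p] by simp
    also have "\<dots> \<le> 1 * (u p / m p)"
      using \<open>\<beta> \<le> 1\<close> upos[OF p] m[OF p] by (intro mult_right_mono) auto
    finally have "m p \<le> Hk 1 (x p) * u p" using H1[OF p] m[OF p] by (simp add: field_simps)
    then have "deriv lam (fst p) \<le> (\<Sum>i\<in>UNIV. \<kappa> p $ i) / ?n * u p"
      unfolding m_def x_def Hk_1_shifted by (simp add: algebra_simps)
    then show ?thesis by (simp add: field_simps)
  qed

  show ?thesis
  proof (rule slice_if_locally_constant[OF N(1) Smf(4,3,2) _ cover])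
    show "S \<subseteq> base_interval rbar \<times> N" using Smf(1) by (simp add: warped_space_def)
    fix c D X y0
    assume P: "local_parametrization A S c D X" and y0: "y0 \<in> D"
      and min: "\<And>q. q \<in> S \<Longrightarrow> fst (X y0) \<le> fst q"
    note pr = par[OF P] and pp = ppt[OF P]
    have min': "fst (X y0) \<le> fst (X y)" if "y \<in> D" for y
      using min[OF pp(3)[OF that]] pp(4)[OF that] by simp
    have mean': "real ?n * deriv lam (fst (X y)) \<le>
        (\<Sum>i\<in>UNIV. \<kappa> (minv c (X y)) $ i) * lam (fst (X y)) * fst (\<nu> c (minv c (X y)))" if "y \<in> D" for y
      using mean[OF pp(3)[OF that]] pp(4,8)[OF that] by (simp add: mult.assoc)
    have T': "fst (X y) \<in> T" "lam (fst (X y)) > 0" if "y \<in> D" for y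
      using pp(2)[OF that] T(1) lpos by auto
    show "\<exists>W s. open W \<and> y0 \<in> W \<and> W \<subseteq> D \<and> s > 0 \<and> (\<forall>x\<in>W. fst (X x) = fst (X y0)) \<and>
        ball (snd (X y0)) s \<subseteq> (\<lambda>x. snd (X x)) ` W"
      by (rule strong_minimum_local[where g = gN and c = c and kap = "\<lambda>y i. \<kappa> (minv c (X y)) $ i",
            OF pr(3,4,5) T(2) pr(1,2) pp(1) T' pp(5,6,7,9,10) mean' y0 min']) blast+
  qed
qed

end
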